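(* Let $f\in\mathfrak{X}$ and consider the planar system of ODEs $$\dot u_1=f(u_1,u_2),\qquad \dot u_2=-f(u_2,u_1).$$ Then the only equilibrium of this system is $(0,0)$. Moreover, for every $a>0$, the solution $(u_1(t;a),u_2(t;a))$ with initial condition $(u_1(0;a),u_2(0;a))=(a,0)$ is periodic, with minimal period denoted $p_f(a)$. Furthermore, if $f\in C^k(\mathbb{R}^2,\mathbb{R})$ with $k\ge 2$ (respectively, if $f$ is analytic), then the map $p_f:(0,\infty)\to\mathbb{R}$, which takes $a>0$ to the minimal period $p_f(a)$ of $(u_1(t;a),u_2(t;a))$, is $C^k$ (respectively, analytic).
   Context: $\mathfrak{X}^+$ is the set of all $f\in C^2(\mathbb{R}^2,\mathbb{R})$ such that $f(u_1,u_2)=f(-u_1,u_2)$, $f(u_1,u_2)=-f(u_1,-u_2)$ and $\partial_2 f(u_1,u_2)>0$ for all $(u_1,u_2)\in\mathbb{R}^2$, where $\partial_2$ is the partial derivative in the second component. $\mathfrak{X}^-:=-\mathfrak{X}^+=\{-f: f\in\mathfrak{X}^+\}$ and $\mathfrak{X}:=\mathfrak{X}^+\cup\mathfrak{X}^-$. Periodic solutions are understood to be nonconstant; the minimal period is the smallest positive period. *)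

theory Defs
  imports "HOL-Analysis.Analysis"
begin

text \<open>
  Differentiability class \<open>C\<^sup>k\<close> on an open set \<open>S\<close>: every directional (in particular every
  partial) derivative of order at most \<open>k\<close> exists and is continuous.
  The definition is only meant for open \<open>S\<close>.
\<close>

fun C_k_on :: "nat \<Rightarrow> ('a::euclidean_space \<Rightarrow> real) \<Rightarrow> 'a set \<Rightarrow> bool" where
  "C_k_on 0 f S \<longleftrightarrow> continuous_on S f"
| "C_k_on (Suc k) f S \<longleftrightarrow>
     (\<forall>x\<in>S. f differentiable (at x)) \<and>
     (\<forall>v. C_k_on k (\<lambda>x. frechet_derivative f (at x) v) S)"

text \<open>
  Real analyticity in one and in two variables. The library predicate \<open>analytic_on\<close> is
  complex analyticity. As \<open>0 ^ 0 = 1\<close>, the constant term of each series is the value at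
  the centre.
\<close>

definition real_analytic_on :: "(real \<Rightarrow> real) \<Rightarrow> real set \<Rightarrow> bool" where
  "real_analytic_on g S \<longleftrightarrow>
     (\<forall>a\<in>S. \<exists>r>0. \<exists>c :: nat \<Rightarrow> real. \<forall>x. \<bar>x - a\<bar> < r \<longrightarrow>
        ((\<lambda>n. c n * (x - a) ^ n) has_sum g x) UNIV)"

definition real_analytic2_on :: "(real \<times> real \<Rightarrow> real) \<Rightarrow> (real \<times> real) set \<Rightarrow> bool" where
  "real_analytic2_on f S \<longleftrightarrow>
     (\<forall>(a, b)\<in>S. \<exists>r>0. \<exists>c :: nat \<Rightarrow> nat \<Rightarrow> real. \<forall>x y. \<bar>x - a\<bar> < r \<and> \<bar>y - b\<bar> < r \<longrightarrow>
        ((\<lambda>(m, n). c m n * (x - a) ^ m * (y - b) ^ n) has_sum f (x, y)) UNIV)"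

definition X_plus :: "(real \<times> real \<Rightarrow> real) set" where
  "X_plus = {f. C_k_on 2 f UNIV \<and>
     (\<forall>u1 u2. f (u1, u2) = f (- u1, u2)) \<and>
     (\<forall>u1 u2. f (u1, u2) = - f (u1, - u2)) \<and>
     (\<forall>u1 u2. deriv (\<lambda>v. f (u1, v)) u2 > 0)}"

definition X_minus :: "(real \<times> real \<Rightarrow> real) set" where
  "X_minus = {(\<lambda>z. - f z) | f. f \<in> X_plus}"

definition X_class :: "(real \<times> real \<Rightarrow> real) set" where
  "X_class = X_plus \<union> X_minus"

definition vfield :: "(real \<times> real \<Rightarrow> real) \<Rightarrow> real \<times> real \<Rightarrow> real \<times> real" where
  "vfield f = (\<lambda>(u1, u2). (f (u1, u2), - f (u2, u1)))"

definition equilibria :: "(real \<times> real \<Rightarrow> real) \<Rightarrow> (real \<times> real) set" where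
  "equilibria f = {z. vfield f z = (0, 0)}"

definition solves_ivp :: "(real \<times> real \<Rightarrow> real) \<Rightarrow> (real \<Rightarrow> real \<times> real) \<Rightarrow> real \<times> real \<Rightarrow> bool" where
  "solves_ivp f u z0 \<longleftrightarrow>
     (\<forall>t. (u has_vector_derivative vfield f (u t)) (at t)) \<and> u 0 = z0"

text \<open>
  The solution started at \<open>(a, 0)\<close>. The definite description is meaningful only
  together with the existence of a unique solution on the whole real line.
\<close>

definition sol :: "(real \<times> real \<Rightarrow> real) \<Rightarrow> real \<Rightarrow> real \<Rightarrow> real \<times> real" where
  "sol f a = (THE u. solves_ivp f u (a, 0))"

definition is_period :: "(real \<Rightarrow> 'b) \<Rightarrow> real \<Rightarrow> bool" where
  "is_period u T \<longleftrightarrow> T > 0 \<and> (\<forall>t. u (t + T) = u t)"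

definition periodic :: "(real \<Rightarrow> 'b) \<Rightarrow> bool" where
  "periodic u \<longleftrightarrow> \<not> u constant_on UNIV \<and> (\<exists>T. is_period u T)"

definition is_minimal_period :: "(real \<Rightarrow> 'b) \<Rightarrow> real \<Rightarrow> bool" where
  "is_minimal_period u T \<longleftrightarrow> is_period u T \<and> (\<forall>S. is_period u S \<longrightarrow> T \<le> S)"

definition period_map :: "(real \<times> real \<Rightarrow> real) \<Rightarrow> real \<Rightarrow> real" where
  "period_map f a = (THE T. is_minimal_period (sol f a) T)"

end

theory Submission
  imports Defs "HOL-Complex_Analysis.Complex_Analysis"
begin

text \<open>
Let \<open>f\<close> lie in \<open>X_plus\<close>; the class \<open>X_minus\<close> reduces to it by reversing time.
Since \<open>f\<close> is odd and increasing in its second argument, \<open>f (u, v)\<close> has the sign of \<open>v\<close>.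
Hence for the time-reversed system \<open>x' = - f (x, y)\<close>, \<open>y' = f (y, x)\<close> the quantity
\<open>x y' - y x' = x f (y, x) + y f (x, y)\<close> is positive away from the origin: the polar angle
\<open>\<theta>\<close> increases strictly along every orbit and may replace time as the independent variable. With
\<open>\<rho> = ln r\<close> an orbit becomes the graph of a solution of one scalar equation
\<open>d\<rho>/d\<theta> = g \<theta> \<rho>\<close>, and time is recovered by integrating \<open>dt/d\<theta> = time_density \<theta> \<rho>\<close>.

The symmetries of \<open>f\<close> make \<open>g\<close> change sign under \<open>\<theta> \<mapsto> - \<theta>\<close> and under
\<open>\<theta> \<mapsto> \<pi>/2 - \<theta>\<close>, so each solution \<open>\<rho>\<close> is even about \<open>0\<close> and about \<open>\<pi>/4\<close>, hence has
period \<open>\<pi>/2\<close>: the orbit closes up after one turn. The same symmetries confine the a priori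
estimates to the octant \<open>0 \<le> \<theta> \<le> \<pi>/4\<close>, where \<open>- K \<le> g \<le> 1\<close> below any given
height; this excludes blow-up (\<open>polar_family\<close>). If \<open>R \<theta> b\<close> is the solution with
\<open>R 0 b = b\<close>, the orbit through \<open>(exp b, 0)\<close> has minimal period
\<open>\<integral>\<close> of \<open>time_density \<theta> (R \<theta> b)\<close> over \<open>0 \<le> \<theta> \<le> 2\<pi>\<close> (\<open>polar_orbit_period\<close>).
The domain of integration is fixed, so only the dependence of \<open>R\<close> on \<open>b\<close> matters.

For a scalar equation the linearised equation is solved by a formula: the \<open>b\<close>-derivative of
\<open>R \<theta> b\<close> is the exponential of the integral of \<open>\<partial>g/\<partial>\<rho>\<close> along the solution
(\<open>parametrized_flow.has_derivative_initial_value\<close>). If \<open>f\<close> is \<open>C\<^sup>k\<close> and \<open>R\<close> is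
already known to be \<open>C\<^sup>j\<close> in \<open>b\<close> with \<open>j < k\<close>, the right-hand side is \<open>C\<^sup>j\<close>, so
\<open>R\<close> is \<open>C\<^bsup>j+1\<^esup>\<close>; this gives the \<open>C\<^sup>k\<close> claim (\<open>C_param_flow\<close>). If \<open>f\<close> is
analytic, \<open>g\<close> extends holomorphically in \<open>\<rho>\<close> to a neighbourhood of a given real solution,
uniformly over \<open>0 \<le> \<theta> \<le> 2\<pi>\<close>. The equation can then be solved for complex initial values, and
the derivative formula, valid over the complex field as well, says that the complex solution is holomorphic in its
initial value (\<open>complex_flow\<close>). Integrating, the period extends holomorphically near every
initial value, which is real analyticity.
\<close>

section \<open>Ordinary differential equations\<close>

lemma continuous_on_compose_pair:
  assumes "continuous_on (A \<times> B) (\<lambda>(s, x). F s x)"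
    and "continuous_on S a" "continuous_on S b"
    and "\<And>p. p \<in> S \<Longrightarrow> a p \<in> A" "\<And>p. p \<in> S \<Longrightarrow> b p \<in> B"
  shows "continuous_on S (\<lambda>p. F (a p) (b p))"
proof -
  have "continuous_on S (\<lambda>p. case (a p, b p) of (s, x) \<Rightarrow> F s x)"
    by (rule continuous_on_compose2[OF assms(1)]) (use assms in \<open>auto intro: continuous_on_Pair\<close>)
  then show ?thesis by simp
qed

lemma continuous_on_integral_01:
  fixes F :: "'b::topological_space \<Rightarrow> real \<Rightarrow> 'a::banach"
  assumes "continuous_on (U \<times> {0..1}) (\<lambda>(x, s). F x s)"
  shows "continuous_on U (\<lambda>x. integral {0..1} (F x))"
  using integral_continuous_on_param[of U 0 1 F] assms by simp

text \<open>
Gronwall's inequality for two solutions: along the segment from \<open>t0\<close> to \<open>t\<close>, run through at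
constant speed, \<open>\<parallel>u - v\<parallel>\<^sup>2\<close> times a decaying exponential is nonincreasing. The bound on
\<open>u' - v'\<close> is only required along the two curves, so a vector field that is Lipschitz on
a set containing both is enough, and \<open>t\<close> may lie on either side of \<open>t0\<close>.
\<close>

lemma gronwall_distance:
  fixes u v :: "real \<Rightarrow> 'a::real_inner"
  assumes u: "\<And>s. s \<in> closed_segment t0 t \<Longrightarrow> (u has_vector_derivative u' s) (at s)"
    and v: "\<And>s. s \<in> closed_segment t0 t \<Longrightarrow> (v has_vector_derivative v' s) (at s)"
    and L: "\<And>s. s \<in> closed_segment t0 t \<Longrightarrow> norm (u' s - v' s) \<le> L * norm (u s - v s)"
  shows "norm (u t - v t) \<le> norm (u t0 - v t0) * exp (L * \<bar>t - t0\<bar>)"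
proof -
  define p where "p s = t0 + s * (t - t0)" for s
  define w where "w s = u (p s) - v (p s)" for s
  define w' where "w' s = (t - t0) *\<^sub>R (u' (p s) - v' (p s))" for s
  define c where "c = L * \<bar>t - t0\<bar>"
  define h where "h s = (w s \<bullet> w s) * exp (- 2 * c * s)" for s
  have seg: "p s \<in> closed_segment t0 t" if "0 \<le> s" "s \<le> 1" for s
    using that unfolding p_def closed_segment_def by (auto intro!: exI[of _ s] simp: algebra_simps)
  have w: "(w has_vector_derivative w' s) (at s)" if "0 \<le> s" "s \<le> 1" for s
  proof -
    have p: "(p has_vector_derivative (t - t0)) (at s)"
      unfolding p_def has_real_derivative_iff_has_vector_derivative[symmetric]
      by (auto intro!: derivative_eq_intros)
    show ?thesis
      using has_vector_derivative_diff[OF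
          vector_diff_chain_at[OF p u[OF seg[OF that]]] vector_diff_chain_at[OF p v[OF seg[OF that]]]]
      by (simp add: w_def[abs_def] w'_def o_def scaleR_diff_right)
  qed
  have "h 1 \<le> h 0"
  proof (rule DERIV_nonpos_imp_nonincreasing[of 0 1 h])
    fix s :: real assume s: "0 \<le> s" "s \<le> 1"
    have wd: "(w has_derivative (\<lambda>x. x *\<^sub>R w' s)) (at s)"
      using w[OF s] by (simp add: has_vector_derivative_def)
    have "((\<lambda>s. w s \<bullet> w s) has_real_derivative 2 * (w s \<bullet> w' s)) (at s)"
      unfolding has_field_derivative_def
      by (rule has_derivative_eq_rhs[OF has_derivative_inner[OF wd wd]])
        (auto simp: inner_commute)
    moreover have "((\<lambda>s. exp (- 2 * c * s)) has_real_derivative - 2 * c * exp (- 2 * c * s)) (at s)"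
      by (auto intro!: derivative_eq_intros)
    ultimately have "(h has_real_derivative
        (2 * (w s \<bullet> w' s) - 2 * c * (w s \<bullet> w s)) * exp (- 2 * c * s)) (at s)"
      unfolding h_def by (rule DERIV_cong[OF DERIV_mult]) (simp add: algebra_simps)
    moreover have "w s \<bullet> w' s \<le> c * (w s \<bullet> w s)"
    proof -
      have "w s \<bullet> w' s \<le> norm (w s) * norm (w' s)" by (rule norm_cauchy_schwarz)
      also have "norm (w' s) \<le> \<bar>t - t0\<bar> * (L * norm (w s))"
        using L[OF seg[OF s]] by (simp add: w'_def w_def mult_left_mono)
      also have "norm (w s) * (\<bar>t - t0\<bar> * (L * norm (w s))) = c * (w s \<bullet> w s)"
        by (simp add: c_def dot_square_norm power2_eq_square)
      finally show ?thesis by (simp add: mult_left_mono)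
    qed
    ultimately show "\<exists>y. (h has_real_derivative y) (at s) \<and> y \<le> 0"
      by (intro exI conjI) (auto simp: mult_le_0_iff)
  qed simp
  then have "(norm (w 1))\<^sup>2 \<le> (norm (w 0) * exp c)\<^sup>2"
    by (simp add: h_def dot_square_norm power_mult_distrib exp_minus field_simps
        flip: exp_double)
  then have "norm (w 1) \<le> norm (w 0) * exp c"
    by (rule power2_le_imp_le) simp
  then show ?thesis by (simp add: w_def p_def c_def)
qed

corollary ode_unique:
  fixes u v :: "real \<Rightarrow> 'a::real_inner"
  assumes "\<And>s. s \<in> closed_segment t0 t \<Longrightarrow> (u has_vector_derivative u' s) (at s)"
    and "\<And>s. s \<in> closed_segment t0 t \<Longrightarrow> (v has_vector_derivative v' s) (at s)"
    and "\<And>s. s \<in> closed_segment t0 t \<Longrightarrow> norm (u' s - v' s) \<le> L * norm (u s - v s)"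
    and "u t0 = v t0"
  shows "u t = v t"
proof -
  have "norm (u t - v t) \<le> norm (u t0 - v t0) * exp (L * \<bar>t - t0\<bar>)"
    by (rule gronwall_distance) (fact assms)+
  then show ?thesis using assms(4) by simp
qed

text \<open>
The case distinction orients the integral for negative \<open>t\<close>.
\<close>

definition primitive :: "(real \<Rightarrow> 'a::banach) \<Rightarrow> real \<Rightarrow> 'a" where
  "primitive h t = (if 0 \<le> t then integral {0..t} h else - integral {t..0} h)"

lemma primitive_0 [simp]: "primitive h 0 = 0"
  by (simp add: primitive_def)

lemma has_vector_derivative_primitive:
  fixes h :: "real \<Rightarrow> 'a::banach"
  assumes h: "continuous_on UNIV h"
  shows "(primitive h has_vector_derivative h t) (at t)"
proof -
  define B where "B = \<bar>t\<bar> + 1"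
  have int: "h integrable_on {a..b}" for a b
    by (rule integrable_continuous_real) (rule continuous_on_subset[OF h], simp)
  have eq: "primitive h s = integral {-B..s} h - integral {-B..0} h" if "s \<in> {-B<..<B}" for s
  proof (cases "0 \<le> s")
    case True
    have "integral {-B..0} h + integral {0..s} h = integral {-B..s} h"
      using True by (intro Henstock_Kurzweil_Integration.integral_combine int) (auto simp: B_def)
    then show ?thesis using True by (simp add: primitive_def algebra_simps)
  next
    case False
    have "integral {-B..s} h + integral {s..0} h = integral {-B..0} h"
      using False that by (intro Henstock_Kurzweil_Integration.integral_combine int) auto
    then show ?thesis using False by (simp add: primitive_def algebra_simps)
  qed
  have t: "t \<in> {-B<..<B}" by (auto simp: B_def)
  have "((\<lambda>s. integral {-B..s} h) has_vector_derivative h t) (at t within {-B..B})"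
    by (rule integral_has_vector_derivative) (use t in \<open>auto intro: continuous_on_subset[OF h]\<close>)
  then have "((\<lambda>s. integral {-B..s} h) has_vector_derivative h t) (at t within {-B<..<B})"
    by (rule has_vector_derivative_within_subset) auto
  then have "((\<lambda>s. integral {-B..s} h) has_vector_derivative h t) (at t)"
    using at_within_open[OF t] by simp
  then have "((\<lambda>s. integral {-B..s} h - integral {-B..0} h) has_vector_derivative h t) (at t)"
    by (simp add: has_vector_derivative_diff_const)
  then show ?thesis
    by (rule has_vector_derivative_transform_within_open[where S="{-B<..<B}"]) (use t eq in auto)
qed

lemma primitive_rescale:
  fixes h :: "real \<Rightarrow> 'a::banach"
  assumes h: "continuous_on UNIV h"
  shows "primitive h t = t *\<^sub>R integral {0..1} (\<lambda>s. h (t * s))"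
proof -
  have "((\<lambda>s. primitive h (t * s)) has_vector_derivative t *\<^sub>R h (t * s)) (at s within {0..1})" for s
  proof -
    have "((\<lambda>s. t * s) has_vector_derivative t) (at s)"
      unfolding has_real_derivative_iff_has_vector_derivative[symmetric]
      by (auto intro!: derivative_eq_intros)
    from vector_diff_chain_at[OF this has_vector_derivative_primitive[OF h]]
    show ?thesis by (simp add: o_def has_vector_derivative_at_within)
  qed
  then have "((\<lambda>s. t *\<^sub>R h (t * s)) has_integral primitive h (t * 1) - primitive h (t * 0)) {0..1}"
    by (intro fundamental_theorem_of_calculus) auto
  then show ?thesis by (simp add: integral_unique flip: integral_cmul)
qed

text \<open>
Picard iteration on the whole line at once. The norm weighted by \<open>exp (- 2 L \<bar>t\<bar>)\<close> makes the
integral operator a contraction with factor \<open>1/2\<close> for every Lipschitz constant \<open>L\<close>, and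
boundedness of \<open>q\<close> keeps its values in the space of weighted bounded curves.
\<close>

lemma global_ode_solution:
  fixes q :: "real \<Rightarrow> 'a::banach \<Rightarrow> 'a"
  assumes cont: "continuous_on UNIV (\<lambda>(t, x). q t x)"
    and bound: "\<And>t x. norm (q t x) \<le> M"
    and lip: "\<And>t x y. norm (q t x - q t y) \<le> L * norm (x - y)"
    and L: "L > 0"
  shows "\<exists>R. R 0 = x0 \<and> (\<forall>t. (R has_vector_derivative q t (R t)) (at t))"
proof -
  define e where "e t = exp (2 * L * \<bar>t\<bar>)" for t :: real
  have e_pos: "e t > 0" for t by (simp add: e_def)
  define path where "path y = (\<lambda>t. e t *\<^sub>R apply_bcontfun y t)" for y :: "real \<Rightarrow>\<^sub>C 'a"
  define h where "h y = (\<lambda>t. q t (path y t))" for y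
  have h_cont: "continuous_on UNIV (h y)" for y
  proof -
    have "continuous_on UNIV (\<lambda>t. (t, path y t))"
      unfolding path_def e_def by (intro continuous_intros) auto
    from continuous_on_compose2[OF cont this] show ?thesis by (simp add: h_def)
  qed
  have M: "0 \<le> M" using bound[of 0 0] norm_ge_zero order_trans by blast
  define \<Phi> where "\<Phi> y = (\<lambda>t. inverse (e t) *\<^sub>R (x0 + primitive (h y) t))" for y
  have prim_cont: "continuous_on UNIV (primitive (h y))" for y
    using has_vector_derivative_continuous[OF has_vector_derivative_primitive[OF h_cont]]
    by (simp add: continuous_on_eq_continuous_within)
  have te: "\<bar>t\<bar> \<le> e t / (2 * L)" for t
  proof -
    have "2 * L * \<bar>t\<bar> \<le> e t" unfolding e_def using exp_ge_add_one_self[of "2 * L * \<bar>t\<bar>"] by linarith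
    then show ?thesis using L by (simp add: field_simps)
  qed
  have \<Phi>_in: "\<Phi> y \<in> bcontfun" for y
  proof (rule bcontfun_normI)
    show "continuous_on UNIV (\<Phi> y)"
      unfolding \<Phi>_def using e_pos
      by (intro continuous_intros prim_cont) (auto simp: e_def intro!: continuous_intros)
    fix t
    have "norm (integral {0..1} (\<lambda>s. h y (t * s))) \<le> M * (1 - 0)"
      by (rule integral_bound)
        (auto simp: h_def bound intro!: continuous_on_compose2[OF h_cont[unfolded h_def]] continuous_intros)
    then have "norm (primitive (h y) t) \<le> \<bar>t\<bar> * M"
      by (simp add: primitive_rescale[OF h_cont] mult_left_mono)
    also have "\<dots> \<le> e t / (2 * L) * M" using te M by (rule mult_right_mono)
    finally have "norm (x0 + primitive (h y) t) \<le> norm x0 + e t / (2 * L) * M"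
      by (meson add_mono norm_triangle_le order_refl)
    moreover have "norm x0 \<le> e t * norm x0"
      using mult_right_mono[of 1 "e t" "norm x0"] L by (simp add: e_def)
    ultimately have "norm (x0 + primitive (h y) t) \<le> e t * (norm x0 + M / (2 * L))"
      by (simp add: algebra_simps)
    then show "norm (\<Phi> y t) \<le> norm x0 + M / (2 * L)"
      using e_pos[of t] by (simp add: \<Phi>_def pos_divide_le_eq divide_inverse_commute[symmetric]
          mult.commute del: inverse_eq_divide)
  qed
  have contraction: "dist (Bcontfun (\<Phi> y)) (Bcontfun (\<Phi> z)) \<le> 1 / 2 * dist y z" for y z
  proof (rule dist_bound)
    fix t
    define d where "d = dist y z"
    have d: "norm (apply_bcontfun y s - apply_bcontfun z s) \<le> d" for s
      unfolding d_def using dist_bounded[of y s z] by (simp add: dist_norm)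
    have hd: "norm (h y s - h z s) \<le> L * d * e s" for s
    proof -
      have "norm (h y s - h z s) \<le> L * norm (path y s - path z s)" unfolding h_def by (rule lip)
      also have "norm (path y s - path z s) = e s * norm (apply_bcontfun y s - apply_bcontfun z s)"
        using e_pos[of s] by (simp add: path_def flip: scaleR_diff_right)
      also have "L * \<dots> \<le> L * (e s * d)" using d[of s] e_pos[of s] L by (intro mult_left_mono) auto
      finally show ?thesis by (simp add: mult_ac)
    qed
    define k where "k = 2 * L * \<bar>t\<bar>"
    have int_h: "(\<lambda>s. h y (t * s)) integrable_on {0..1}" for y
      by (rule integrable_continuous_real)
         (auto intro!: continuous_on_compose2[OF h_cont] continuous_intros)
    have int_e: "((\<lambda>s. L * d * e (t * s)) has_integral L * d * ((e t - 1) / k)) {0..1}" if "t \<noteq> 0"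
    proof -
      have k: "k \<noteq> 0" using that L by (simp add: k_def)
      have "((\<lambda>s. exp (k * s)) has_integral exp (k * 1) / k - exp (k * 0) / k) {0..1}"
        using k by (intro fundamental_theorem_of_calculus)
          (auto simp: has_real_derivative_iff_has_vector_derivative[symmetric]
             intro!: derivative_eq_intros)
      then have "((\<lambda>s. L * d * exp (k * s)) has_integral L * d * ((exp k - 1) / k)) {0..1}"
        by (intro has_integral_mult_right) (simp add: diff_divide_distrib)
      moreover have "e (t * s) = exp (k * s)" if "s \<in> {0..1}" for s
        using that by (simp add: e_def k_def abs_mult mult_ac)
      moreover have "e t = exp k" by (simp add: e_def k_def)
      ultimately show ?thesis by (auto elim: has_integral_eq[rotated])
    qed
    have "norm (primitive (h y) t - primitive (h z) t) \<le> d * e t / 2"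
    proof (cases "t = 0")
      case True
      then show ?thesis using e_pos[of t] by (simp add: d_def)
    next
      case False
      have "primitive (h y) t - primitive (h z) t
          = t *\<^sub>R integral {0..1} (\<lambda>s. h y (t * s) - h z (t * s))"
        by (simp add: primitive_rescale[OF h_cont] integral_diff[OF int_h int_h] scaleR_diff_right)
      moreover have "norm (integral {0..1} (\<lambda>s. h y (t * s) - h z (t * s)))
          \<le> integral {0..1} (\<lambda>s. L * d * e (t * s))"
        using hd int_e[OF False]
        by (intro integral_norm_bound_integral integrable_diff int_h) auto
      ultimately have "norm (primitive (h y) t - primitive (h z) t) \<le> \<bar>t\<bar> * (L * d * ((e t - 1) / k))"
        unfolding integral_unique[OF int_e[OF False]] by (simp only: norm_scaleR mult_left_mono abs_ge_zero)
      also have "\<dots> = d * (e t - 1) / 2"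
        using False L by (simp add: k_def field_simps)
      also have "\<dots> \<le> d * e t / 2" by (simp add: d_def mult_left_mono)
      finally show ?thesis .
    qed
    then have "inverse (e t) * norm (primitive (h y) t - primitive (h z) t) \<le> d / 2"
      using e_pos[of t] by (simp add: field_simps)
    moreover have "\<Phi> y t - \<Phi> z t = inverse (e t) *\<^sub>R (primitive (h y) t - primitive (h z) t)"
      by (simp add: \<Phi>_def flip: scaleR_diff_right)
    ultimately show "dist (apply_bcontfun (Bcontfun (\<Phi> y)) t) (apply_bcontfun (Bcontfun (\<Phi> z)) t)
        \<le> 1 / 2 * dist y z"
      using e_pos[of t] by (simp add: Bcontfun_inverse[OF \<Phi>_in] dist_norm d_def)
  qed
  obtain y where y: "Bcontfun (\<Phi> y) = y"
    using banach_fix_type[of "1/2" "\<lambda>y. Bcontfun (\<Phi> y)"] contraction by auto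
  have "path y t = x0 + primitive (h y) t" for t
  proof -
    have "apply_bcontfun y t = \<Phi> y t" using Bcontfun_inverse[OF \<Phi>_in, of y] y by simp
    then show ?thesis using e_pos[of t] by (simp add: path_def \<Phi>_def)
  qed
  then have "path y = (\<lambda>t. x0 + primitive (h y) t)" and "path y 0 = x0" by auto
  moreover have "((\<lambda>t. x0 + primitive (h y) t) has_vector_derivative 0 + h y t) (at t)" for t
    by (intro has_vector_derivative_add has_vector_derivative_const
        has_vector_derivative_primitive h_cont)
  ultimately show ?thesis
    by (intro exI[of _ "path y"]) (auto simp: h_def)
qed

text \<open>
If the right-hand side changes sign under reflection of the time axis in \<open>\<theta>0\<close>, then the
reflected solution solves the same equation and agrees with the original one at \<open>\<theta>0\<close>.
\<close>

lemma reversible_solution_symmetric: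
  fixes r :: "real \<Rightarrow> real"
  assumes r: "\<And>\<theta>. (r has_real_derivative c \<theta> (r \<theta>)) (at \<theta>)"
    and lip: "\<And>\<theta> x y. \<bar>c \<theta> x - c \<theta> y\<bar> \<le> L * \<bar>x - y\<bar>"
    and c: "\<And>\<theta> x. c (2 * \<theta>0 - \<theta>) x = - c \<theta> x"
  shows "r (2 * \<theta>0 - \<theta>) = r \<theta>"
proof (rule ode_unique[of \<theta>0 \<theta> _ "\<lambda>s. c s (r (2 * \<theta>0 - s))" _ "\<lambda>s. c s (r s)" L])
  fix s
  have "((\<lambda>s. r (2 * \<theta>0 - s)) has_real_derivative c (2 * \<theta>0 - s) (r (2 * \<theta>0 - s)) * (0 - 1)) (at s)"
    by (rule DERIV_chain2[OF r]) (intro derivative_intros)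
  then show "((\<lambda>s. r (2 * \<theta>0 - s)) has_vector_derivative c s (r (2 * \<theta>0 - s))) (at s)"
    by (simp add: has_real_derivative_iff_has_vector_derivative c)
  show "(r has_vector_derivative c s (r s)) (at s)"
    using r[of s] by (simp add: has_real_derivative_iff_has_vector_derivative)
  show "norm (c s (r (2 * \<theta>0 - s)) - c s (r s)) \<le> L * norm (r (2 * \<theta>0 - s) - r s)"
    using lip by simp
qed simp

text \<open>
Composition with the nearest-point projection onto a compact convex set turns a locally defined
field into one that satisfies the hypotheses of \<open>global_ode_solution\<close>. Solutions that stay in
the set do not notice the change.
\<close>

lemma clamped_field_bounds:
  fixes q q' :: "real \<Rightarrow> 'a \<Rightarrow> 'a::{euclidean_space, real_normed_field}"
  assumes K: "compact K" and V: "compact V" "convex V" "V \<noteq> {}"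
    and cont: "continuous_on (K \<times> V) (\<lambda>(s, x). q s x)"
    and cont': "continuous_on (K \<times> V) (\<lambda>(s, x). q' s x)"
    and deriv: "\<And>s x. s \<in> K \<Longrightarrow> x \<in> V \<Longrightarrow> (q s has_field_derivative q' s x) (at x)"
  shows "\<exists>L M. L > 0 \<and> (\<forall>s\<in>K. \<forall>x. norm (q s (closest_point V x)) \<le> M) \<and>
    (\<forall>s\<in>K. \<forall>x\<in>V. norm (q' s x) \<le> L) \<and>
    (\<forall>s\<in>K. \<forall>x y. norm (q s (closest_point V x) - q s (closest_point V y)) \<le> L * norm (x - y)) \<and>
    (\<forall>s\<in>K. \<forall>x\<in>V. \<forall>y\<in>V. norm (q s x - q s y) \<le> L * norm (x - y))"
proof -
  note closed = compact_imp_closed[OF V(1)]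
  have cp: "closest_point V x \<in> V" for x by (rule closest_point_in_set[OF closed V(3)])
  have "bounded ((\<lambda>(s, x). q s x) ` (K \<times> V))" "bounded ((\<lambda>(s, x). q' s x) ` (K \<times> V))"
    using cont cont' K V by (auto intro!: compact_imp_bounded compact_continuous_image compact_Times)
  then obtain M L0 where
    M: "\<And>s x. s \<in> K \<Longrightarrow> x \<in> V \<Longrightarrow> norm (q s x) \<le> M" and
    L0: "\<And>s x. s \<in> K \<Longrightarrow> x \<in> V \<Longrightarrow> norm (q' s x) \<le> L0"
    unfolding bounded_iff by fastforce
  define L where "L = max L0 1"
  have L: "norm (q' s x) \<le> L" if "s \<in> K" "x \<in> V" for s x using L0[OF that] by (simp add: L_def)
  have lip: "norm (q s x - q s y) \<le> L * norm (x - y)" if "s \<in> K" "x \<in> V" "y \<in> V" for s x y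
    by (rule field_differentiable_bound[OF V(2), of "q s" "q' s"])
      (use that L in \<open>auto intro: has_field_derivative_at_within deriv\<close>)
  have lip_cp: "norm (q s (closest_point V x) - q s (closest_point V y)) \<le> L * norm (x - y)"
    if "s \<in> K" for s x y
  proof -
    have "norm (q s (closest_point V x) - q s (closest_point V y))
        \<le> L * norm (closest_point V x - closest_point V y)"
      using that cp by (intro lip)
    also have "\<dots> \<le> L * norm (x - y)"
      using closest_point_lipschitz[OF V(2) closed V(3), of x y]
      by (intro mult_left_mono) (auto simp: dist_norm L_def)
    finally show ?thesis .
  qed
  have "L > 0" by (simp add: L_def)
  then show ?thesis using L M cp lip lip_cp by blast
qed

section \<open>Differentiating a flow with respect to its initial value\<close>

lemma segment_in_convex:
  assumes "convex V" "x \<in> V" "y \<in> V" "r \<in> {0..1}"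
  shows "x + r *\<^sub>R (y - x) \<in> V"
proof -
  have "x + r *\<^sub>R (y - x) = (1 - r) *\<^sub>R x + r *\<^sub>R y" by (simp add: algebra_simps)
  then show ?thesis using assms by (simp add: convex_def)
qed

lemma slope_integral:
  fixes g :: "'a::{banach, real_normed_field} \<Rightarrow> 'a"
  assumes V: "convex V"
    and g': "\<And>x. x \<in> V \<Longrightarrow> (g has_field_derivative g' x) (at x)"
    and cont: "continuous_on V g'"
    and x: "x \<in> V" and y: "y \<in> V"
  shows "g y - g x = integral {0..1} (\<lambda>r. g' (x + r *\<^sub>R (y - x))) * (y - x)"
proof -
  note inV = segment_in_convex[OF V x y]
  have "((\<lambda>r. g (x + r *\<^sub>R (y - x))) has_vector_derivative (y - x) * g' (x + r *\<^sub>R (y - x)))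
      (at r within {0..1})" if "r \<in> {0..1}" for r
  proof -
    have "((\<lambda>r. x + r *\<^sub>R (y - x)) has_vector_derivative (y - x)) (at r)"
      by (auto intro!: derivative_eq_intros simp: has_vector_derivative_def)
    from field_vector_diff_chain_at[OF this g'[OF inV[OF that]]]
    show ?thesis by (simp add: o_def has_vector_derivative_at_within)
  qed
  then have "((\<lambda>r. (y - x) * g' (x + r *\<^sub>R (y - x))) has_integral
      g (x + 1 *\<^sub>R (y - x)) - g (x + 0 *\<^sub>R (y - x))) {0..1}"
    by (intro fundamental_theorem_of_calculus) auto
  from integral_unique[OF this]
  have "integral {0..1} (\<lambda>r. (y - x) * g' (x + r *\<^sub>R (y - x))) = g y - g x"
    by (simp del: integral_mult_right)
  moreover have "(\<lambda>r. g' (x + r *\<^sub>R (y - x))) integrable_on {0..1}"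
    by (intro integrable_continuous_real continuous_on_compose2[OF cont] continuous_intros)
      (use inV in auto)
  ultimately show ?thesis by (simp add: mult.commute)
qed

lemma linear_ode_solution:
  fixes \<Delta> A :: "real \<Rightarrow> 'a::{banach, real_normed_field}"
  assumes \<Delta>: "\<And>s. s \<in> {0..T} \<Longrightarrow> (\<Delta> has_vector_derivative A s * \<Delta> s) (at s)"
    and A: "continuous_on {0..T} A" and s: "s \<in> {0..T}"
  shows "\<Delta> s = \<Delta> 0 * exp (integral {0..s} A)"
proof -
  define I where "I s = integral {0..s} A" for s
  have I: "(I has_vector_derivative A s) (at s within {0..T})" if "s \<in> {0..T}" for s
    unfolding I_def using A that by (rule integral_has_vector_derivative)
  have "((\<lambda>s. \<Delta> s * exp (- I s)) has_vector_derivative 0) (at s within {0..T})" if "s \<in> {0..T}" for s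
  proof -
    have "((\<lambda>z. exp (- z)) has_field_derivative - exp (- I s)) (at (I s) within I ` {0..T})"
      by (auto intro!: derivative_eq_intros)
    from field_vector_diff_chain_within[OF I[OF that] this]
    have "((\<lambda>s. exp (- I s)) has_vector_derivative A s * - exp (- I s)) (at s within {0..T})"
      by (simp add: o_def)
    from has_vector_derivative_mult[OF has_vector_derivative_at_within[OF \<Delta>[OF that]] this]
    show ?thesis by (simp add: algebra_simps)
  qed
  then obtain c where c: "\<And>s. s \<in> {0..T} \<Longrightarrow> \<Delta> s * exp (- I s) = c"
    using has_vector_derivative_zero_constant[of "{0..T}" "\<lambda>s. \<Delta> s * exp (- I s)"] by auto
  have "\<Delta> s * exp (- I s) = \<Delta> 0"
    using c[of s] c[of 0] s by (simp add: I_def)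
  then have "\<Delta> s * (exp (- I s) * exp (I s)) = \<Delta> 0 * exp (I s)" by (simp add: mult.assoc[symmetric])
  then show ?thesis by (simp add: I_def exp_minus_inverse flip: exp_add)
qed

text \<open>
The values lie in a field, real or complex: for such a scalar equation the linearisation along a
solution is solved by an exponential. Convexity of \<open>V\<close> provides the mean slope of \<open>g\<close> between
two solutions.
\<close>

locale parametrized_flow =
  fixes g g' :: "real \<Rightarrow> 'a \<Rightarrow> 'a::{euclidean_space, real_normed_field}"
    and R :: "real \<Rightarrow> 'a \<Rightarrow> 'a" and T L :: real and U V :: "'a set"
  assumes T: "0 \<le> T" and V: "convex V" and U: "open U"
    and deriv: "\<And>s x. s \<in> {0..T} \<Longrightarrow> x \<in> V \<Longrightarrow> (g s has_field_derivative g' s x) (at x)"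
    and cont: "continuous_on ({0..T} \<times> V) (\<lambda>(s, x). g' s x)"
    and bound: "\<And>s x. s \<in> {0..T} \<Longrightarrow> x \<in> V \<Longrightarrow> norm (g' s x) \<le> L"
    and flow: "\<And>s x. s \<in> {0..T} \<Longrightarrow> x \<in> U \<Longrightarrow> ((\<lambda>s. R s x) has_vector_derivative g s (R s x)) (at s)"
    and initial: "\<And>x. x \<in> U \<Longrightarrow> R 0 x = x"
    and range: "\<And>s x. s \<in> {0..T} \<Longrightarrow> x \<in> U \<Longrightarrow> R s x \<in> V"
begin

text \<open>
The mean of \<open>g'\<close> over the segment from \<open>x\<close> to \<open>y\<close>, that is, a difference quotient of
\<open>g s\<close> that is jointly continuous up to the diagonal.
\<close>

definition slope :: "real \<Rightarrow> 'a \<Rightarrow> 'a \<Rightarrow> 'a" where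
  "slope s x y = integral {0..1} (\<lambda>r. g' s (x + r *\<^sub>R (y - x)))"

lemmas segment_in_V = segment_in_convex[OF V]

lemma g'_continuous: "s \<in> {0..T} \<Longrightarrow> continuous_on V (g' s)"
  by (intro continuous_on_compose_pair[OF cont] continuous_intros)

lemma slope:
  assumes "s \<in> {0..T}" "x \<in> V" "y \<in> V"
  shows "g s y - g s x = slope s x y * (y - x)"
  unfolding slope_def using assms
  by (intro slope_integral[OF V] deriv g'_continuous)

lemma slope_same: "slope s x x = g' s x"
  by (simp add: slope_def)

lemma slope_bound:
  assumes "s \<in> {0..T}" "x \<in> V" "y \<in> V"
  shows "norm (slope s x y) \<le> L"
proof -
  have "norm (slope s x y) \<le> L * (1 - 0)"
    unfolding slope_def using assms
    by (intro integral_bound continuous_on_compose2[OF g'_continuous] continuous_intros)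
      (auto intro!: bound segment_in_V)
  then show ?thesis by simp
qed

lemma slope_continuous: "continuous_on ({0..T} \<times> V \<times> V) (\<lambda>(s, x, y). slope s x y)"
proof -
  have "continuous_on (({0..T} \<times> V \<times> V) \<times> {0..1})
      (\<lambda>p. g' (fst (fst p)) (fst (snd (fst p)) + snd p *\<^sub>R (snd (snd (fst p)) - fst (snd (fst p)))))"
    by (intro continuous_on_compose_pair[OF cont] continuous_intros) (auto intro!: segment_in_V)
  then have "continuous_on (({0..T} \<times> V \<times> V) \<times> {0..1})
      (\<lambda>(p, r). g' (fst p) (fst (snd p) + r *\<^sub>R (snd (snd p) - fst (snd p))))"
    by (simp add: split_def)
  from continuous_on_integral_01[OF this]
  show ?thesis by (simp add: slope_def split_def)
qed

lemma time_continuous: "x \<in> U \<Longrightarrow> continuous_on {0..T} (\<lambda>s. R s x)"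
  by (intro continuous_at_imp_continuous_on ballI has_vector_derivative_continuous[OF flow])

lemma slope_along_continuous:
  assumes "x \<in> U" "y \<in> U"
  shows "continuous_on {0..T} (\<lambda>s. slope s (R s x) (R s y))"
proof -
  have *: "continuous_on ({0..T} \<times> (V \<times> V)) (\<lambda>(s, p). slope s (fst p) (snd p))"
    using slope_continuous by (simp add: split_def)
  have "continuous_on {0..T} (\<lambda>s. slope s (fst (R s x, R s y)) (snd (R s x, R s y)))"
    by (rule continuous_on_compose_pair[OF *])
      (use assms range in \<open>auto intro!: continuous_intros time_continuous\<close>)
  then show ?thesis by simp
qed

text \<open>
The difference of two solutions satisfies a linear equation, with coefficient the slope of the field
between them; its solution formula is exact, before any limit is taken.
\<close>

lemma difference:
  assumes x: "x \<in> U" and y: "y \<in> U" and s: "s \<in> {0..T}"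
  shows "R s y - R s x = (y - x) * exp (integral {0..s} (\<lambda>s. slope s (R s x) (R s y)))"
proof -
  have "((\<lambda>s. R s y - R s x) has_vector_derivative
      slope s (R s x) (R s y) * (R s y - R s x)) (at s)" if "s \<in> {0..T}" for s
    using has_vector_derivative_diff[OF flow[OF that y] flow[OF that x]]
      slope[OF that range[OF that x] range[OF that y]] by simp
  from linear_ode_solution[OF this slope_along_continuous[OF x y] s]
  show ?thesis using x y by (simp add: initial)
qed

lemma L_nonneg: "U \<noteq> {} \<Longrightarrow> 0 \<le> L"
  using bound[of 0 "R 0 x" for x] range[of 0] T norm_ge_zero order_trans
  by (metis all_not_in_conv atLeastAtMost_iff order_refl)

lemma lipschitz:
  assumes x: "x \<in> U" and y: "y \<in> U" and s: "s \<in> {0..T}"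
  shows "norm (R s y - R s x) \<le> norm (y - x) * exp (L * T)"
proof -
  have L: "0 \<le> L" using L_nonneg x by auto
  have "norm (integral {0..s} (\<lambda>s. slope s (R s x) (R s y))) \<le> L * (s - 0)"
    using s x y
    by (intro integral_bound continuous_on_subset[OF slope_along_continuous]) (auto intro!: slope_bound range)
  also have "\<dots> \<le> L * T" using L s by (simp add: mult_left_mono)
  finally have "norm (exp (integral {0..s} (\<lambda>s. slope s (R s x) (R s y)))) \<le> exp (L * T)"
    using norm_exp order_trans by (metis exp_le_cancel_iff)
  then show ?thesis by (simp add: difference[OF assms] norm_mult mult_left_mono)
qed

lemma joint_continuous: "continuous_on ({0..T} \<times> U) (\<lambda>(s, x). R s x)"
  unfolding continuous_on_def
proof
  fix p0 assume "p0 \<in> {0..T} \<times> U"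
  then obtain s0 x0 where p0: "p0 = (s0, x0)" and s0: "s0 \<in> {0..T}" and x0: "x0 \<in> U" by auto
  let ?F = "at (s0, x0) within {0..T} \<times> U"
  have "((\<lambda>p. R (fst p) x0) \<longlongrightarrow> R s0 x0) ?F"
  proof -
    have "continuous_on ({0..T} \<times> U) (\<lambda>p. R (fst p) x0)"
      by (rule continuous_on_compose2[OF time_continuous[OF x0] continuous_on_fst])
        (auto intro: continuous_on_id)
    then show ?thesis using s0 x0 unfolding continuous_on_def by fastforce
  qed
  then have "((\<lambda>p. norm (snd p - x0) * exp (L * T) + norm (R (fst p) x0 - R s0 x0)) \<longlongrightarrow>
      norm (snd (s0, x0) - x0) * exp (L * T) + norm (R s0 x0 - R s0 x0)) ?F"
    by (intro tendsto_intros)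
  then have lim: "((\<lambda>p. norm (snd p - x0) * exp (L * T) + norm (R (fst p) x0 - R s0 x0)) \<longlongrightarrow> 0) ?F"
    by simp
  have "((\<lambda>p. R (fst p) (snd p) - R s0 x0) \<longlongrightarrow> 0) ?F"
  proof (rule Lim_null_comparison[OF _ lim])
    have "norm (R (fst p) (snd p) - R s0 x0)
        \<le> norm (snd p - x0) * exp (L * T) + norm (R (fst p) x0 - R s0 x0)" if "p \<in> {0..T} \<times> U" for p
      using lipschitz[OF x0, of "snd p" "fst p"] that
        norm_triangle_ineq[of "R (fst p) (snd p) - R (fst p) x0" "R (fst p) x0 - R s0 x0"] by auto
    then show "\<forall>\<^sub>F p in ?F. norm (R (fst p) (snd p) - R s0 x0)
        \<le> norm (snd p - x0) * exp (L * T) + norm (R (fst p) x0 - R s0 x0)"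
      by (simp add: eventually_at_filter)
  qed
  then show "((\<lambda>(s, x). R s x) \<longlongrightarrow> (case p0 of (s, x) \<Rightarrow> R s x)) (at p0 within {0..T} \<times> U)"
    by (simp add: split_def LIM_zero_iff p0)
qed

text \<open>
Dividing the formula for the difference of two solutions by \<open>y - x\<close> leaves the exponential,
which depends continuously on \<open>y\<close>; as \<open>y\<close> tends to \<open>x\<close> the slope becomes the
derivative of the field along the solution.
\<close>

lemma has_derivative_initial_value:
  assumes x: "x \<in> U" and s: "s \<in> {0..T}"
  shows "(R s has_field_derivative exp (integral {0..s} (\<lambda>\<sigma>. g' \<sigma> (R \<sigma> x)))) (at x)"
proof -
  define E where "E y = exp (integral {0..s} (\<lambda>\<sigma>. slope \<sigma> (R \<sigma> x) (R \<sigma> y)))" for y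
  have *: "continuous_on ({0..T} \<times> (V \<times> V)) (\<lambda>(s, p). slope s (fst p) (snd p))"
    using slope_continuous by (simp add: split_def)
  have "continuous_on (U \<times> {0..s}) (\<lambda>p. R (snd p) (fst p))"
    by (rule continuous_on_compose_pair[OF joint_continuous])
      (use s in \<open>auto intro!: continuous_intros\<close>)
  moreover have "continuous_on (U \<times> {0..s}) (\<lambda>p. R (snd p) x)"
    using s x by (intro continuous_on_compose_pair[OF joint_continuous] continuous_intros) auto
  ultimately have "continuous_on (U \<times> {0..s})
      (\<lambda>p. slope (snd p) (fst (R (snd p) x, R (snd p) (fst p))) (snd (R (snd p) x, R (snd p) (fst p))))"
    by (intro continuous_on_compose_pair[OF *] continuous_intros) (use s x range in auto)
  then have "continuous_on (U \<times> cbox 0 s) (\<lambda>(y, \<sigma>). slope \<sigma> (R \<sigma> x) (R \<sigma> y))"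
    by (simp add: split_def)
  then have "continuous_on U E" unfolding E_def
    by (intro continuous_on_exp) (use integral_continuous_on_param in fastforce)
  then have "(E \<longlongrightarrow> E x) (at x)"
    using U x by (simp add: continuous_on_eq_continuous_at isCont_def)
  moreover have "\<forall>\<^sub>F y in at x. E y = (R s y - R s x) / (y - x)"
  proof -
    have "\<forall>\<^sub>F y in at x. y \<in> U" using U x by (simp add: eventually_at_in_open')
    moreover have "\<forall>\<^sub>F y in at x. y \<noteq> x" by (simp add: eventually_at_filter)
    ultimately show ?thesis
      by eventually_elim (simp add: difference[OF x _ s] E_def)
  qed
  ultimately have "((\<lambda>y. (R s y - R s x) / (y - x)) \<longlongrightarrow> E x) (at x)"
    by (rule Lim_transform_eventually)
  then show ?thesis by (simp add: has_field_derivative_iff E_def slope_same)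
qed

end

section \<open>Functions that are \<open>C\<^sup>k\<close> in a parameter\<close>

text \<open>
Derivatives are taken in the parameter \<open>x\<close> only; in the time variable \<open>s\<close> mere continuity
is demanded, jointly with \<open>x\<close>. This is what differentiation under the integral sign preserves.
\<close>

fun C_param :: "nat \<Rightarrow> real \<Rightarrow> real set \<Rightarrow> (real \<Rightarrow> real \<Rightarrow> real) \<Rightarrow> bool" where
  "C_param 0 T U F \<longleftrightarrow> continuous_on ({0..T} \<times> U) (\<lambda>(s, x). F s x)"
| "C_param (Suc k) T U F \<longleftrightarrow> continuous_on ({0..T} \<times> U) (\<lambda>(s, x). F s x) \<and>
     (\<exists>F'. (\<forall>s\<in>{0..T}. \<forall>x\<in>U. (F s has_real_derivative F' s x) (at x)) \<and> C_param k T U F')"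

lemma C_param_continuous:
  "C_param k T U F \<Longrightarrow> continuous_on ({0..T} \<times> U) (\<lambda>(s, x). F s x)"
  by (cases k) auto

lemma C_param_SucI:
  assumes "continuous_on ({0..T} \<times> U) (\<lambda>(s, x). F s x)"
    and "\<And>s x. s \<in> {0..T} \<Longrightarrow> x \<in> U \<Longrightarrow> (F s has_real_derivative F' s x) (at x)"
    and "C_param k T U F'"
  shows "C_param (Suc k) T U F"
  using assms by (auto intro!: exI[of _ F'])

lemma C_param_SucE:
  assumes "C_param (Suc k) T U F"
  obtains F' where "\<And>s x. s \<in> {0..T} \<Longrightarrow> x \<in> U \<Longrightarrow> (F s has_real_derivative F' s x) (at x)"
    and "C_param k T U F'"
proof -
  from assms obtain F' where "\<forall>s\<in>{0..T}. \<forall>x\<in>U. (F s has_real_derivative F' s x) (at x)"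
    "C_param k T U F'" by auto
  then show ?thesis by (intro that) auto
qed

lemma C_param_SucD: "C_param (Suc k) T U F \<Longrightarrow> C_param k T U F"
proof (induction k arbitrary: F)
  case (Suc k)
  from Suc.prems obtain F' where
    F': "\<And>s x. s \<in> {0..T} \<Longrightarrow> x \<in> U \<Longrightarrow> (F s has_real_derivative F' s x) (at x)"
      "C_param (Suc k) T U F'"
    by (rule C_param_SucE) blast
  show ?case
    by (rule C_param_SucI[OF C_param_continuous[OF Suc.prems] F'(1) Suc.IH[OF F'(2)]])
qed auto

lemma C_param_mono: "j \<le> k \<Longrightarrow> C_param k T U F \<Longrightarrow> C_param j T U F"
  by (induction rule: inc_induct) (auto dest: C_param_SucD simp del: C_param.simps)

lemma C_param_const:
  "continuous_on {0..T} c \<Longrightarrow> C_param k T U (\<lambda>s x. c s)"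
proof (induction k arbitrary: c)
  case 0
  then show ?case
    by (auto simp: split_def intro!: continuous_on_compose2[OF _ continuous_on_fst] continuous_on_id)
next
  case (Suc k)
  show ?case
  proof (rule C_param_SucI[where F' = "\<lambda>s x. 0"])
    show "continuous_on ({0..T} \<times> U) (\<lambda>(s, x). c s)"
      using Suc.prems
      by (auto simp: split_def intro!: continuous_on_compose2[OF _ continuous_on_fst] continuous_on_id)
  qed (auto intro!: Suc.IH[of "\<lambda>_. 0"])
qed

lemma C_param_id: "C_param k T U (\<lambda>s x. x)"
proof (cases k)
  case (Suc j)
  show ?thesis unfolding Suc
    by (rule C_param_SucI[where F' = "\<lambda>s x. 1"])
      (auto intro!: continuous_intros C_param_const simp: split_def)
qed (auto intro!: continuous_intros simp: split_def)

lemma C_param_add: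
  "C_param k T U F \<Longrightarrow> C_param k T U G \<Longrightarrow> C_param k T U (\<lambda>s x. F s x + G s x)"
proof (induction k arbitrary: F G)
  case 0
  then show ?case by (auto simp: split_def intro: continuous_on_add)
next
  case (Suc k)
  from Suc.prems(1) obtain F' where
    F': "\<And>s x. s \<in> {0..T} \<Longrightarrow> x \<in> U \<Longrightarrow> (F s has_real_derivative F' s x) (at x)" "C_param k T U F'"
    by (rule C_param_SucE) blast
  from Suc.prems(2) obtain G' where
    G': "\<And>s x. s \<in> {0..T} \<Longrightarrow> x \<in> U \<Longrightarrow> (G s has_real_derivative G' s x) (at x)" "C_param k T U G'"
    by (rule C_param_SucE) blast
  show ?case
  proof (rule C_param_SucI)
    show "continuous_on ({0..T} \<times> U) (\<lambda>(s, x). F s x + G s x)"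
      using Suc.prems[THEN C_param_continuous] by (auto simp: split_def intro: continuous_on_add)
    show "((\<lambda>x. F s x + G s x) has_real_derivative F' s x + G' s x) (at x)"
      if "s \<in> {0..T}" "x \<in> U" for s x
      using DERIV_add[OF F'(1)[OF that] G'(1)[OF that]] .
    show "C_param k T U (\<lambda>s x. F' s x + G' s x)" using F'(2) G'(2) by (rule Suc.IH)
  qed
qed

lemma C_param_mult:
  "C_param k T U F \<Longrightarrow> C_param k T U G \<Longrightarrow> C_param k T U (\<lambda>s x. F s x * G s x)"
proof (induction k arbitrary: F G)
  case 0
  then show ?case by (auto simp: split_def intro: continuous_on_mult)
next
  case (Suc k)
  from Suc.prems(1) obtain F' where
    F': "\<And>s x. s \<in> {0..T} \<Longrightarrow> x \<in> U \<Longrightarrow> (F s has_real_derivative F' s x) (at x)" "C_param k T U F'"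
    by (rule C_param_SucE) blast
  from Suc.prems(2) obtain G' where
    G': "\<And>s x. s \<in> {0..T} \<Longrightarrow> x \<in> U \<Longrightarrow> (G s has_real_derivative G' s x) (at x)" "C_param k T U G'"
    by (rule C_param_SucE) blast
  show ?case
  proof (rule C_param_SucI)
    show "continuous_on ({0..T} \<times> U) (\<lambda>(s, x). F s x * G s x)"
      using Suc.prems[THEN C_param_continuous] by (auto simp: split_def intro: continuous_on_mult)
    show "((\<lambda>x. F s x * G s x) has_real_derivative F' s x * G s x + G' s x * F s x) (at x)"
      if "s \<in> {0..T}" "x \<in> U" for s x
      using DERIV_mult[OF F'(1)[OF that] G'(1)[OF that]] .
    show "C_param k T U (\<lambda>s x. F' s x * G s x + G' s x * F s x)"
      by (intro C_param_add Suc.IH F' G' Suc.prems[THEN C_param_SucD])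
  qed
qed

lemma C_param_uminus: "C_param k T U F \<Longrightarrow> C_param k T U (\<lambda>s x. - F s x)"
  using C_param_mult[OF C_param_const[of T "\<lambda>_. -1" k U], of F] by simp

lemma C_param_inverse:
  "C_param k T U F \<Longrightarrow> (\<And>s x. s \<in> {0..T} \<Longrightarrow> x \<in> U \<Longrightarrow> F s x \<noteq> 0) \<Longrightarrow>
    C_param k T U (\<lambda>s x. inverse (F s x))"
proof (induction k)
  case 0
  then show ?case by (auto simp: split_def intro!: continuous_on_inverse)
next
  case (Suc k)
  from Suc.prems(1) obtain F' where
    F': "\<And>s x. s \<in> {0..T} \<Longrightarrow> x \<in> U \<Longrightarrow> (F s has_real_derivative F' s x) (at x)" "C_param k T U F'"
    by (rule C_param_SucE) blast
  show ?case
  proof (rule C_param_SucI)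
    show "continuous_on ({0..T} \<times> U) (\<lambda>(s, x). inverse (F s x))"
      using Suc.prems(1)[THEN C_param_continuous] Suc.prems(2)
      by (auto simp: split_def intro!: continuous_on_inverse)
    show "((\<lambda>x. inverse (F s x)) has_real_derivative
        - F' s x * (inverse (F s x) * inverse (F s x))) (at x)"
      if "s \<in> {0..T}" "x \<in> U" for s x
      using DERIV_inverse_fun[OF F'(1)[OF that] Suc.prems(2)[OF that]]
      by (rule DERIV_cong) (simp add: power2_eq_square)
    show "C_param k T U (\<lambda>s x. - F' s x * (inverse (F s x) * inverse (F s x)))"
      by (intro C_param_mult C_param_uminus Suc.IH F' Suc.prems(1)[THEN C_param_SucD] Suc.prems(2))
  qed
qed

lemma C_param_exp: "C_param k T U F \<Longrightarrow> C_param k T U (\<lambda>s x. exp (F s x))"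
proof (induction k)
  case 0
  then show ?case by (auto simp: split_def intro!: continuous_on_exp)
next
  case (Suc k)
  from Suc.prems(1) obtain F' where
    F': "\<And>s x. s \<in> {0..T} \<Longrightarrow> x \<in> U \<Longrightarrow> (F s has_real_derivative F' s x) (at x)" "C_param k T U F'"
    by (rule C_param_SucE) blast
  show ?case
  proof (rule C_param_SucI)
    show "continuous_on ({0..T} \<times> U) (\<lambda>(s, x). exp (F s x))"
      using Suc.prems(1)[THEN C_param_continuous] by (auto simp: split_def intro!: continuous_on_exp)
    show "((\<lambda>x. exp (F s x)) has_real_derivative exp (F s x) * F' s x) (at x)"
      if "s \<in> {0..T}" "x \<in> U" for s x
      using DERIV_fun_exp[OF F'(1)[OF that]] .
    show "C_param k T U (\<lambda>s x. exp (F s x) * F' s x)"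
      by (intro C_param_mult Suc.IH F' Suc.prems(1)[THEN C_param_SucD])
  qed
qed

lemma C_param_compose:
  assumes "\<And>s x. s \<in> {0..T} \<Longrightarrow> x \<in> U \<Longrightarrow> R s x \<in> V"
  shows "C_param k T V G \<Longrightarrow> C_param k T U R \<Longrightarrow> C_param k T U (\<lambda>s x. G s (R s x))"
proof (induction k arbitrary: G)
  case 0
  then have "continuous_on ({0..T} \<times> U) (\<lambda>p. G (fst p) (R (fst p) (snd p)))"
    by (intro continuous_on_compose_pair[of "{0..T}" V G] continuous_intros)
      (use assms in \<open>auto simp: split_def\<close>)
  then show ?case by (simp add: split_def)
next
  case (Suc k)
  from Suc.prems(1) obtain G' where
    G': "\<And>s x. s \<in> {0..T} \<Longrightarrow> x \<in> V \<Longrightarrow> (G s has_real_derivative G' s x) (at x)" "C_param k T V G'"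
    by (rule C_param_SucE) blast
  from Suc.prems(2) obtain R' where
    R': "\<And>s x. s \<in> {0..T} \<Longrightarrow> x \<in> U \<Longrightarrow> (R s has_real_derivative R' s x) (at x)" "C_param k T U R'"
    by (rule C_param_SucE) blast
  show ?case
  proof (rule C_param_SucI)
    have "continuous_on ({0..T} \<times> U) (\<lambda>p. G (fst p) (R (fst p) (snd p)))"
      by (intro continuous_on_compose_pair[of "{0..T}" V G] continuous_intros)
        (use assms Suc.prems[THEN C_param_continuous] in \<open>auto simp: split_def\<close>)
    then show "continuous_on ({0..T} \<times> U) (\<lambda>(s, x). G s (R s x))" by (simp add: split_def)
    show "((\<lambda>x. G s (R s x)) has_real_derivative G' s (R s x) * R' s x) (at x)"
      if "s \<in> {0..T}" "x \<in> U" for s x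
      using DERIV_chain2[OF G'(1)[OF that(1) assms[OF that]] R'(1)[OF that]] .
    show "C_param k T U (\<lambda>s x. G' s (R s x) * R' s x)"
      by (rule C_param_mult[OF Suc.IH[OF G'(2) Suc.prems(2)[THEN C_param_SucD]] R'(2)])
  qed
qed

text \<open>
Rescaling to the fixed interval from \<open>0\<close> to \<open>1\<close> reduces the variable upper limit to continuity
of a parameter integral.
\<close>

lemma continuous_on_running_integral:
  fixes F :: "real \<Rightarrow> 'a::topological_space \<Rightarrow> 'b::banach"
  assumes F: "continuous_on ({0..T} \<times> U) (\<lambda>(s, x). F s x)"
  shows "continuous_on ({0..T} \<times> U) (\<lambda>(s, x). integral {0..s} (\<lambda>\<sigma>. F \<sigma> x))"
proof -
  have eq: "integral {0..s} (\<lambda>\<sigma>. F \<sigma> x) = s *\<^sub>R integral {0..1} (\<lambda>r. F (r * s) x)"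
    if "s \<in> {0..T}" "x \<in> U" for s x
  proof (cases "s = 0")
    case False
    then have s: "s > 0" using that by auto
    have "continuous_on {0..s} (\<lambda>\<sigma>. F \<sigma> x)"
      using that by (intro continuous_on_compose_pair[OF F] continuous_intros) auto
    then have "((\<lambda>\<sigma>. F \<sigma> x) has_integral integral {0..s} (\<lambda>\<sigma>. F \<sigma> x)) (cbox 0 s)"
      using integrable_integral integrable_continuous_real by (metis cbox_interval)
    from has_integral_affinity'[OF this s, of 0] s
    have "((\<lambda>r. F (r * s) x) has_integral (integral {0..s} (\<lambda>\<sigma>. F \<sigma> x) /\<^sub>R s)) {0..1}"
      by (simp add: mult.commute)
    then show ?thesis using s by (simp add: integral_unique)
  qed auto
  have "continuous_on (({0..T} \<times> U) \<times> {0..1}) (\<lambda>p. F (snd p * fst (fst p)) (snd (fst p)))"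
  proof (intro continuous_on_compose_pair[OF F] continuous_intros)
    fix p :: "(real \<times> 'a) \<times> real" assume p: "p \<in> ({0..T} \<times> U) \<times> {0..1}"
    then have "snd p * fst (fst p) \<le> 1 * T" by (intro mult_mono) auto
    then show "snd p * fst (fst p) \<in> {0..T}" using p by auto
  qed auto
  then have "continuous_on (({0..T} \<times> U) \<times> {0..1}) (\<lambda>(q, r). F (r * fst q) (snd q))"
    by (simp add: split_def)
  from continuous_on_integral_01[OF this]
  have "continuous_on ({0..T} \<times> U) (\<lambda>q. fst q *\<^sub>R integral {0..1} (\<lambda>r. F (r * fst q) (snd q)))"
    by (intro continuous_intros)
  then show ?thesis
    by (rule continuous_on_cong[THEN iffD1, rotated -1]) (auto simp: eq)
qed

lemma C_param_integral:
  assumes U: "open U" "convex U"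
  shows "C_param k T U F \<Longrightarrow> C_param k T U (\<lambda>s x. integral {0..s} (\<lambda>\<sigma>. F \<sigma> x))"
proof (induction k arbitrary: F)
  case 0
  then show ?case using continuous_on_running_integral by auto
next
  case (Suc k)
  from Suc.prems(1) obtain F' where
    F': "\<And>s x. s \<in> {0..T} \<Longrightarrow> x \<in> U \<Longrightarrow> (F s has_real_derivative F' s x) (at x)" "C_param k T U F'"
    by (rule C_param_SucE) blast
  note cont = Suc.prems[THEN C_param_continuous] and cont' = F'(2)[THEN C_param_continuous]
  show ?case
  proof (rule C_param_SucI)
    show "continuous_on ({0..T} \<times> U) (\<lambda>(s, x). integral {0..s} (\<lambda>\<sigma>. F \<sigma> x))"
      using cont by (rule continuous_on_running_integral)
    show "C_param k T U (\<lambda>s x. integral {0..s} (\<lambda>\<sigma>. F' \<sigma> x))"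
      using F'(2) by (rule Suc.IH)
    fix s x assume s: "s \<in> {0..T}" and x: "x \<in> U"
    have "((\<lambda>x. integral (cbox 0 s) (\<lambda>\<sigma>. F \<sigma> x)) has_field_derivative
        integral (cbox 0 s) (\<lambda>\<sigma>. F' \<sigma> x)) (at x within U)"
    proof (rule leibniz_rule_field_derivative[OF _ _ _ x U(2)])
      show "((\<lambda>x. F t x) has_field_derivative F' t y) (at y within U)" if "y \<in> U" "t \<in> cbox 0 s" for y t
        by (rule has_field_derivative_at_within, rule F'(1)) (use that s in auto)
      show "(\<lambda>\<sigma>. F \<sigma> y) integrable_on cbox 0 s" if "y \<in> U" for y
        using that s by (intro integrable_continuous continuous_on_compose_pair[OF cont] continuous_intros) auto
      have "continuous_on (U \<times> cbox 0 s) (\<lambda>p. F' (snd p) (fst p))"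
        using s by (intro continuous_on_compose_pair[OF cont'] continuous_intros) auto
      then show "continuous_on (U \<times> cbox 0 s) (\<lambda>(y, t). F' t y)" by (simp add: split_def)
    qed
    then show "((\<lambda>x. integral {0..s} (\<lambda>\<sigma>. F \<sigma> x)) has_real_derivative
        integral {0..s} (\<lambda>\<sigma>. F' \<sigma> x)) (at x)"
      using at_within_open[OF x U(1)] by simp
  qed
qed

lemma C_k_on_continuous: "C_k_on k f S \<Longrightarrow> continuous_on S f"
  by (cases k)
    (auto intro!: continuous_at_imp_continuous_on differentiable_imp_continuous_within)

lemma C_param_of_C_k:
  fixes f :: "real \<times> real \<Rightarrow> real"
  shows "C_k_on k f UNIV \<Longrightarrow> C_param k T U X \<Longrightarrow> C_param k T U Y \<Longrightarrow> C_param k T U (\<lambda>s x. f (X s x, Y s x))"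
proof (induction k arbitrary: f)
  case 0
  then show ?case
    by (auto simp: split_def intro!: continuous_on_compose2[of UNIV f] continuous_on_Pair)
next
  case (Suc k)
  from Suc.prems(2) obtain X' where
    X': "\<And>s x. s \<in> {0..T} \<Longrightarrow> x \<in> U \<Longrightarrow> (X s has_real_derivative X' s x) (at x)" "C_param k T U X'"
    by (rule C_param_SucE) blast
  from Suc.prems(3) obtain Y' where
    Y': "\<And>s x. s \<in> {0..T} \<Longrightarrow> x \<in> U \<Longrightarrow> (Y s has_real_derivative Y' s x) (at x)" "C_param k T U Y'"
    by (rule C_param_SucE) blast
  define D where "D v z = frechet_derivative f (at z) v" for v z
  have f: "(f has_derivative (\<lambda>v. D v z)) (at z)" for z
    unfolding D_def frechet_derivative_works[symmetric] using Suc.prems(1) by (cases z) simp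
  have D: "D (a, b) z = a * D (1, 0) z + b * D (0, 1) z" for a b z
  proof -
    interpret linear "\<lambda>v. D v z" using f has_derivative_linear by blast
    have "(a, b) = a *\<^sub>R (1, 0) + b *\<^sub>R (0, 1 :: real)" by simp
    then show ?thesis by (simp only: add scaleR) simp
  qed
  have Ck: "C_k_on k (D v) UNIV" for v
    using Suc.prems(1) unfolding D_def[abs_def] C_k_on.simps by blast
  show ?case
  proof (rule C_param_SucI)
    show "continuous_on ({0..T} \<times> U) (\<lambda>(s, x). f (X s x, Y s x))"
      using Suc.prems(2,3)[THEN C_param_continuous] C_k_on_continuous[OF Suc.prems(1)]
      by (auto simp: split_def intro!: continuous_on_compose2[of UNIV f] continuous_on_Pair)
    show "((\<lambda>x. f (X s x, Y s x)) has_real_derivative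
        X' s x * D (1, 0) (X s x, Y s x) + Y' s x * D (0, 1) (X s x, Y s x)) (at x)"
      if "s \<in> {0..T}" "x \<in> U" for s x
      using has_derivative_compose[OF has_derivative_Pair[OF
            X'(1)[OF that, unfolded has_field_derivative_def] Y'(1)[OF that, unfolded has_field_derivative_def]] f]
      unfolding has_field_derivative_def
      by (rule has_derivative_eq_rhs) (subst D, simp add: algebra_simps fun_eq_iff)
    show "C_param k T U (\<lambda>s x. X' s x * D (1, 0) (X s x, Y s x) + Y' s x * D (0, 1) (X s x, Y s x))"
      by (intro C_param_add C_param_mult X' Y' Suc.IH Ck Suc.prems(2,3)[THEN C_param_SucD])
  qed
qed

lemma C_k_on_cong:
  fixes f h :: "'a::euclidean_space \<Rightarrow> real"
  assumes S: "open S"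
  shows "(\<And>x. x \<in> S \<Longrightarrow> f x = h x) \<Longrightarrow> C_k_on k f S \<Longrightarrow> C_k_on k h S"
proof (induction k arbitrary: f h)
  case 0
  then show ?case by (auto cong: continuous_on_cong)
next
  case (Suc k)
  have h: "(h has_derivative frechet_derivative f (at x)) (at x)" if "x \<in> S" for x
  proof (rule has_derivative_transform_within_open[OF _ S that])
    show "(f has_derivative frechet_derivative f (at x)) (at x)"
      using Suc.prems(2) that by (simp add: frechet_derivative_works[symmetric])
  qed (use Suc.prems in auto)
  then have "frechet_derivative h (at x) = frechet_derivative f (at x)" if "x \<in> S" for x
    using that frechet_derivative_at by metis
  then have "C_k_on k (\<lambda>x. frechet_derivative h (at x) v) S" for v
    using Suc.prems(2) Suc.IH[of "\<lambda>x. frechet_derivative f (at x) v"] by simp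
  then show ?case using h by (auto simp: differentiable_def)
qed

lemma C_k_on_of_C_param:
  assumes U: "open U" and s: "s \<in> {0..T}"
  shows "C_param k T U F \<Longrightarrow> C_k_on k (F s) U"
proof (induction k arbitrary: F)
  case 0
  then have "continuous_on U (\<lambda>x. F s x)"
    using s by (intro continuous_on_compose_pair[of "{0..T}" U F] continuous_intros) auto
  then show ?case by simp
next
  case (Suc k)
  from Suc.prems(1) obtain F' where
    F': "\<And>s x. s \<in> {0..T} \<Longrightarrow> x \<in> U \<Longrightarrow> (F s has_real_derivative F' s x) (at x)" "C_param k T U F'"
    by (rule C_param_SucE) blast
  have F: "(F s has_derivative (*) (F' s x)) (at x)" if "x \<in> U" for x
    using F'(1)[OF s that] by (rule has_field_derivative_imp_has_derivative)
  have "C_k_on k (\<lambda>x. frechet_derivative (F s) (at x) v) U" for v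
  proof (rule C_k_on_cong[OF U])
    have "C_param k T U (\<lambda>s x. F' s x * v)"
      by (intro C_param_mult F' C_param_const continuous_on_const)
    then show "C_k_on k (\<lambda>x. F' s x * v) U" by (rule Suc.IH)
    show "F' s x * v = frechet_derivative (F s) (at x) v" if "x \<in> U" for x
      using frechet_derivative_at[OF F[OF that]] by metis
  qed
  then show ?case using F unfolding C_k_on.simps differentiable_def by blast
qed

lemma C_param_cong:
  assumes U: "open U" and eq: "\<And>s x. s \<in> {0..T} \<Longrightarrow> x \<in> U \<Longrightarrow> F s x = G s x"
    and F: "C_param k T U F"
  shows "C_param k T U G"
proof -
  have cont: "continuous_on ({0..T} \<times> U) (\<lambda>(s, x). G s x)"
    using C_param_continuous[OF F]
    by (rule continuous_on_cong[THEN iffD1, rotated -1]) (use eq in auto)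
  show ?thesis
  proof (cases k)
    case (Suc j)
    then have "C_param (Suc j) T U F" using F by simp
    then obtain F' where F': "\<And>s x. s \<in> {0..T} \<Longrightarrow> x \<in> U \<Longrightarrow> (F s has_real_derivative F' s x) (at x)"
      "C_param j T U F'" by (rule C_param_SucE) blast
    show ?thesis unfolding Suc
    proof (rule C_param_SucI[OF cont _ F'(2)])
      show "(G s has_real_derivative F' s x) (at x)" if "s \<in> {0..T}" "x \<in> U" for s x
        using F'(1)[OF that] U that(2) eq[OF that(1)]
        by (rule has_field_derivative_transform_within_open)
    qed
  qed (use cont in simp)
qed

lemma C_param_subset: "V \<subseteq> U \<Longrightarrow> C_param k T U F \<Longrightarrow> C_param k T V F"
proof (induction k arbitrary: F)
  case 0
  then show ?case by (auto intro: continuous_on_subset)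
next
  case (Suc k)
  from Suc.prems(2) obtain F' where
    F': "\<And>s x. s \<in> {0..T} \<Longrightarrow> x \<in> U \<Longrightarrow> (F s has_real_derivative F' s x) (at x)" "C_param k T U F'"
    by (rule C_param_SucE) blast
  show ?case
  proof (rule C_param_SucI[OF _ _ Suc.IH[OF Suc.prems(1) F'(2)]])
    show "continuous_on ({0..T} \<times> V) (\<lambda>(s, x). F s x)"
      by (rule continuous_on_subset[OF C_param_continuous[OF Suc.prems(2)]]) (use Suc.prems(1) in auto)
    show "(F s has_real_derivative F' s x) (at x)" if "s \<in> {0..T}" "x \<in> V" for s x
      using F'(1) that Suc.prems(1) by auto
  qed
qed

lemma C_param_ln:
  assumes "U \<subseteq> {0<..}"
  shows "C_param k T U (\<lambda>s x. ln x)"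
proof -
  have "continuous_on ({0..T} \<times> U) (\<lambda>(s, x). ln x :: real)"
    using assms by (auto simp: split_def intro!: continuous_intros)
  moreover have "C_param j T U (\<lambda>s x. inverse x)" for j
    using assms by (intro C_param_inverse C_param_id) auto
  moreover have "(ln has_real_derivative inverse x) (at x)" if "x \<in> U" for x :: real
    using assms that by (intro DERIV_ln) auto
  ultimately have "C_param (Suc j) T U (\<lambda>s x. ln x)" for j
    by (intro C_param_SucI[where F' = "\<lambda>s x. inverse x"]) auto
  then show ?thesis by (rule C_param_SucD)
qed

lemma C_k_on_local:
  fixes h :: "'a::euclidean_space \<Rightarrow> real"
  shows "(\<And>x. x \<in> S \<Longrightarrow> \<exists>U. open U \<and> x \<in> U \<and> C_k_on k h U) \<Longrightarrow> C_k_on k h S"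
proof (induction k arbitrary: h)
  case 0
  have "isCont h x" if "x \<in> S" for x
    using 0[OF that] by (auto simp: continuous_on_eq_continuous_at)
  then show ?case by (simp add: continuous_at_imp_continuous_on)
next
  case (Suc k)
  have "C_k_on k (\<lambda>x. frechet_derivative h (at x) v) S" for v
    by (rule Suc.IH) (use Suc.prems in fastforce)
  moreover have "h differentiable (at x)" if "x \<in> S" for x
    using Suc.prems[OF that] by auto
  ultimately show ?case by simp
qed

lemma C_k_on_uminus:
  fixes f :: "'a::euclidean_space \<Rightarrow> real"
  shows "C_k_on k f UNIV \<Longrightarrow> C_k_on k (\<lambda>x. - f x) UNIV"
proof (induction k arbitrary: f)
  case 0
  then show ?case by (auto intro: continuous_on_minus)
next
  case (Suc k)
  have d: "((\<lambda>x. - f x) has_derivative (\<lambda>v. - frechet_derivative f (at x) v)) (at x)" for x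
  proof -
    have "(f has_derivative frechet_derivative f (at x)) (at x)"
      using Suc.prems unfolding C_k_on.simps frechet_derivative_works[symmetric] by blast
    then show ?thesis by (rule has_derivative_minus)
  qed
  have "frechet_derivative (\<lambda>x. - f x) (at x) v = - frechet_derivative f (at x) v" for x v
    using frechet_derivative_at[OF d] by metis
  moreover have "C_k_on k (\<lambda>x. - frechet_derivative f (at x) v) UNIV" for v
    using Suc.prems by (intro Suc.IH) simp
  moreover have "(\<lambda>x. - f x) differentiable (at x)" for x
    using d unfolding differentiable_def by blast
  ultimately show ?case by simp
qed

text \<open>
The bootstrap: by the formula for the derivative in the initial value, \<open>R\<close> gains one derivative
as long as it has no more of them than \<open>g'\<close>.
\<close>

lemma C_param_flow:
  fixes g g' :: "real \<Rightarrow> real \<Rightarrow> real"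
  assumes "parametrized_flow g g' R T L U V" and convex: "convex U"
    and g': "C_param k T V g'"
  shows "C_param (Suc k) T U R"
proof -
  interpret parametrized_flow g g' R T L U V by fact
  have "C_param j T U R" if "j \<le> Suc k" for j
    using that
  proof (induction j)
    case 0
    show ?case using joint_continuous by simp
  next
    case (Suc j)
    show ?case
    proof (rule C_param_SucI[OF joint_continuous has_derivative_initial_value])
      show "C_param j T U (\<lambda>s x. exp (integral {0..s} (\<lambda>\<sigma>. g' \<sigma> (R \<sigma> x))))"
        using Suc
        by (intro C_param_exp C_param_integral C_param_compose[OF range C_param_mono[OF _ g']] U convex) auto
    qed auto
  qed
  then show ?thesis by blast
qed

section \<open>Holomorphic extension in a parameter\<close>

text \<open>
One radius \<open>\<epsilon>\<close> serves all \<open>\<theta>\<close>. In \<open>\<theta>\<close> only continuity is asked, since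
\<open>\<theta>\<close> stays real throughout.
\<close>

definition complex_extension ::
  "real set \<Rightarrow> real \<Rightarrow> (real \<Rightarrow> real \<Rightarrow> real) \<Rightarrow> (real \<Rightarrow> complex \<Rightarrow> complex) \<Rightarrow> bool" where
  "complex_extension S \<epsilon> F G \<longleftrightarrow> 0 < \<epsilon> \<and> continuous_on (S \<times> ball 0 \<epsilon>) (\<lambda>(\<theta>, z). G \<theta> z) \<and>
     (\<forall>\<theta>\<in>S. G \<theta> holomorphic_on ball 0 \<epsilon> \<and> (\<forall>x. \<bar>x\<bar> < \<epsilon> \<longrightarrow> G \<theta> (of_real x) = of_real (F \<theta> x)))"

definition extends_near :: "(real \<Rightarrow> real \<Rightarrow> real) \<Rightarrow> real \<Rightarrow> bool" where
  "extends_near F \<theta> \<longleftrightarrow> (\<exists>\<epsilon> G. complex_extension (ball \<theta> \<epsilon>) \<epsilon> F G)"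

lemma complex_extension_mono:
  assumes "complex_extension S \<epsilon> F G" "S' \<subseteq> S" "0 < \<epsilon>'" "\<epsilon>' \<le> \<epsilon>"
  shows "complex_extension S' \<epsilon>' F G"
proof -
  have "S' \<times> ball (0 :: complex) \<epsilon>' \<subseteq> S \<times> ball 0 \<epsilon>" "ball (0 :: complex) \<epsilon>' \<subseteq> ball 0 \<epsilon>"
    using assms by auto
  then show ?thesis
    using assms unfolding complex_extension_def
    by (auto intro: continuous_on_subset holomorphic_on_subset)
qed

lemma extends_nearE2:
  assumes "extends_near F \<theta>" "extends_near F2 \<theta>"
  obtains \<epsilon> G G2 where "complex_extension (ball \<theta> \<epsilon>) \<epsilon> F G" "complex_extension (ball \<theta> \<epsilon>) \<epsilon> F2 G2"
proof -
  from assms obtain \<epsilon>1 \<epsilon>2 G G2 where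
    "complex_extension (ball \<theta> \<epsilon>1) \<epsilon>1 F G" "complex_extension (ball \<theta> \<epsilon>2) \<epsilon>2 F2 G2"
    unfolding extends_near_def by auto
  note ext = this
  define \<epsilon> where "\<epsilon> = min \<epsilon>1 \<epsilon>2"
  have "\<epsilon> > 0" "\<epsilon> \<le> \<epsilon>1" "\<epsilon> \<le> \<epsilon>2" using ext by (auto simp: complex_extension_def \<epsilon>_def)
  then have "complex_extension (ball \<theta> \<epsilon>) \<epsilon> F G" "complex_extension (ball \<theta> \<epsilon>) \<epsilon> F2 G2"
    by (auto intro: complex_extension_mono[OF ext(1)] complex_extension_mono[OF ext(2)] subset_ball)
  then show thesis by (rule that)
qed

lemma extends_near_const:
  assumes "continuous_on UNIV c"
  shows "extends_near (\<lambda>\<theta> x. c \<theta>) \<theta>"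
  unfolding extends_near_def complex_extension_def using assms
  by (intro exI[of _ 1] exI[of _ "\<lambda>\<theta> z. of_real (c \<theta>)"])
    (auto simp: split_def intro!: continuous_intros intro: continuous_on_compose2[of UNIV c])

lemma extends_near_id: "extends_near (\<lambda>\<theta> x. x) \<theta>"
  unfolding extends_near_def complex_extension_def
  by (intro exI[of _ 1] exI[of _ "\<lambda>\<theta> z. z"])
    (auto simp: split_def intro!: continuous_intros)

lemma extends_near_add:
  assumes "extends_near F \<theta>" "extends_near F2 \<theta>"
  shows "extends_near (\<lambda>\<theta> x. F \<theta> x + F2 \<theta> x) \<theta>"
proof -
  obtain \<epsilon> G G2 where "complex_extension (ball \<theta> \<epsilon>) \<epsilon> F G" "complex_extension (ball \<theta> \<epsilon>) \<epsilon> F2 G2"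
    using extends_nearE2[OF assms] .
  then have "complex_extension (ball \<theta> \<epsilon>) \<epsilon> (\<lambda>\<theta> x. F \<theta> x + F2 \<theta> x) (\<lambda>\<theta> z. G \<theta> z + G2 \<theta> z)"
    by (auto simp: complex_extension_def split_def intro!: holomorphic_intros continuous_on_add)
  then show ?thesis unfolding extends_near_def by blast
qed

lemma extends_near_mult:
  assumes "extends_near F \<theta>" "extends_near F2 \<theta>"
  shows "extends_near (\<lambda>\<theta> x. F \<theta> x * F2 \<theta> x) \<theta>"
proof -
  obtain \<epsilon> G G2 where "complex_extension (ball \<theta> \<epsilon>) \<epsilon> F G" "complex_extension (ball \<theta> \<epsilon>) \<epsilon> F2 G2"
    using extends_nearE2[OF assms] .
  then have "complex_extension (ball \<theta> \<epsilon>) \<epsilon> (\<lambda>\<theta> x. F \<theta> x * F2 \<theta> x) (\<lambda>\<theta> z. G \<theta> z * G2 \<theta> z)"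
    by (auto simp: complex_extension_def split_def intro!: holomorphic_intros continuous_on_mult)
  then show ?thesis unfolding extends_near_def by blast
qed

lemma extends_near_uminus: "extends_near F \<theta> \<Longrightarrow> extends_near (\<lambda>\<theta> x. - F \<theta> x) \<theta>"
  using extends_near_mult[OF extends_near_const[of "\<lambda>_. -1" \<theta>]] by force

lemma extends_near_exp:
  assumes "extends_near F \<theta>"
  shows "extends_near (\<lambda>\<theta> x. exp (F \<theta> x)) \<theta>"
proof -
  obtain \<epsilon> G where "complex_extension (ball \<theta> \<epsilon>) \<epsilon> F G"
    using assms unfolding extends_near_def by blast
  then have "complex_extension (ball \<theta> \<epsilon>) \<epsilon> (\<lambda>\<theta> x. exp (F \<theta> x)) (\<lambda>\<theta> z. exp (G \<theta> z))"
    by (auto simp: complex_extension_def split_def exp_of_real intro!: holomorphic_intros continuous_on_exp)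
  then show ?thesis unfolding extends_near_def by blast
qed

lemma open_contains_ball_product:
  fixes \<theta> :: "'a::metric_space" and z :: "'b::metric_space"
  assumes "open W" "(\<theta>, z) \<in> W"
  obtains \<epsilon> where "\<epsilon> > 0" "ball \<theta> \<epsilon> \<times> ball z \<epsilon> \<subseteq> W"
proof -
  obtain A B where AB: "open A" "open B" "(\<theta>, z) \<in> A \<times> B" "A \<times> B \<subseteq> W"
    using open_prod_elim[OF assms] .
  then obtain a b where "a > 0" "ball \<theta> a \<subseteq> A" "b > 0" "ball z b \<subseteq> B"
    using open_contains_ball by (metis mem_Sigma_iff)
  moreover from this have "ball \<theta> (min a b) \<times> ball z (min a b) \<subseteq> A \<times> B" by auto
  ultimately have "min a b > 0" "ball \<theta> (min a b) \<times> ball z (min a b) \<subseteq> W" using AB(4) by auto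
  then show thesis by (rule that)
qed

text \<open>
By continuity a complex extension keeps any open condition that it satisfies at its centre.
\<close>

lemma complex_extension_shrink:
  assumes G: "complex_extension (ball \<theta> \<epsilon>) \<epsilon> F G" and W: "open W" "G \<theta> 0 \<in> W"
  obtains \<delta> where "complex_extension (ball \<theta> \<delta>) \<delta> F G"
    "\<And>\<theta>' z. \<theta>' \<in> ball \<theta> \<delta> \<Longrightarrow> z \<in> ball 0 \<delta> \<Longrightarrow> G \<theta>' z \<in> W"
proof -
  from G have \<epsilon>: "\<epsilon> > 0" and c: "continuous_on (ball \<theta> \<epsilon> \<times> ball 0 \<epsilon>) (\<lambda>(\<theta>, z). G \<theta> z)"
    by (auto simp: complex_extension_def)
  have "open ((ball \<theta> \<epsilon> \<times> ball 0 \<epsilon>) \<inter> (\<lambda>(\<theta>, z). G \<theta> z) -` W)"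
    using continuous_open_preimage[OF c _ W(1)] by (auto intro: open_Times)
  moreover have "(\<theta>, 0) \<in> (ball \<theta> \<epsilon> \<times> ball 0 \<epsilon>) \<inter> (\<lambda>(\<theta>, z). G \<theta> z) -` W"
    using W \<epsilon> by auto
  ultimately obtain d where d: "d > 0"
    "ball \<theta> d \<times> ball 0 d \<subseteq> (ball \<theta> \<epsilon> \<times> ball 0 \<epsilon>) \<inter> (\<lambda>(\<theta>, z). G \<theta> z) -` W"
    using open_contains_ball_product by blast
  show thesis
  proof (rule that)
    show "complex_extension (ball \<theta> (min d \<epsilon>)) (min d \<epsilon>) F G"
      using d \<epsilon> by (intro complex_extension_mono[OF G]) auto
    show "G \<theta>' z \<in> W" if "\<theta>' \<in> ball \<theta> (min d \<epsilon>)" "z \<in> ball 0 (min d \<epsilon>)" for \<theta>' z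
    proof -
      have "(\<theta>', z) \<in> ball \<theta> d \<times> ball 0 d" using that by auto
      then have "(\<theta>', z) \<in> (\<lambda>(\<theta>, z). G \<theta> z) -` W" using d(2) by blast
      then show ?thesis by simp
    qed
  qed
qed

lemma complex_extension_centre:
  "complex_extension (ball \<theta> \<epsilon>) \<epsilon> F G \<Longrightarrow> G \<theta> 0 = of_real (F \<theta> 0)"
  unfolding complex_extension_def by (metis abs_zero centre_in_ball of_real_0)

lemma extends_near_inverse:
  assumes "extends_near F \<theta>" "F \<theta> 0 \<noteq> 0"
  shows "extends_near (\<lambda>\<theta> x. inverse (F \<theta> x)) \<theta>"
proof -
  obtain \<epsilon>0 G where G0: "complex_extension (ball \<theta> \<epsilon>0) \<epsilon>0 F G"
    using assms(1) unfolding extends_near_def by blast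
  have "G \<theta> 0 \<in> - {0}" using complex_extension_centre[OF G0] assms(2) by simp
  then obtain \<epsilon> where G: "complex_extension (ball \<theta> \<epsilon>) \<epsilon> F G"
    and nz: "\<And>\<theta>' z. \<theta>' \<in> ball \<theta> \<epsilon> \<Longrightarrow> z \<in> ball 0 \<epsilon> \<Longrightarrow> G \<theta>' z \<in> - {0}"
    using complex_extension_shrink[OF G0, of "- {0}"] by (metis open_Compl closed_singleton)
  have "complex_extension (ball \<theta> \<epsilon>) \<epsilon> (\<lambda>\<theta> x. inverse (F \<theta> x)) (\<lambda>\<theta> z. inverse (G \<theta> z))"
    using G nz
    by (auto simp: complex_extension_def split_def intro!: holomorphic_intros continuous_on_inverse)
  then show ?thesis unfolding extends_near_def by blast
qed

text \<open>
The double power series of \<open>f\<close> at the point \<open>(X \<theta> 0, Y \<theta> 0)\<close> converges absolutely on a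
complex polydisc, because it does so on a real square. Inserting the extensions of \<open>X\<close> and
\<open>Y\<close> gives, by the Weierstrass M-test, a uniform limit of functions that are jointly continuous,
and holomorphic in \<open>z\<close>.
\<close>

lemma extends_near_analytic2:
  assumes f: "real_analytic2_on f UNIV" and X: "extends_near X \<theta>" and Y: "extends_near Y \<theta>"
  shows "extends_near (\<lambda>\<theta> x. f (X \<theta> x, Y \<theta> x)) \<theta>"
proof -
  define a b where "a = X \<theta> 0" and "b = Y \<theta> 0"
  have "\<exists>r>0. \<exists>c :: nat \<Rightarrow> nat \<Rightarrow> real. \<forall>x y. \<bar>x - a\<bar> < r \<and> \<bar>y - b\<bar> < r \<longrightarrow>
      ((\<lambda>(m, n). c m n * (x - a) ^ m * (y - b) ^ n) has_sum f (x, y)) UNIV"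
    using f unfolding real_analytic2_on_def by blast
  then obtain r and c :: "nat \<Rightarrow> nat \<Rightarrow> real" where r: "r > 0"
    and c: "\<And>x y. \<bar>x - a\<bar> < r \<Longrightarrow> \<bar>y - b\<bar> < r \<Longrightarrow>
      ((\<lambda>(m, n). c m n * (x - a) ^ m * (y - b) ^ n) has_sum f (x, y)) UNIV"
    by blast
  define \<rho> where "\<rho> = r / 2"
  have \<rho>: "0 < \<rho>" "\<rho> < r" using r by (auto simp: \<rho>_def)
  define M where "M = (\<lambda>(m, n). norm (c m n * \<rho> ^ m * \<rho> ^ n))"
  have "(\<lambda>(m, n). c m n * \<rho> ^ m * \<rho> ^ n) summable_on UNIV"
    using c[of "a + \<rho>" "b + \<rho>"] \<rho> by (auto intro!: has_sum_imp_summable)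
  then have M: "M summable_on UNIV"
    by (subst (asm) summable_on_iff_abs_summable_on_real) (simp add: M_def split_def)
  obtain \<epsilon>0 X' Y' where X0: "complex_extension (ball \<theta> \<epsilon>0) \<epsilon>0 X X'"
    and Y0: "complex_extension (ball \<theta> \<epsilon>0) \<epsilon>0 Y Y'"
    using extends_nearE2[OF X Y] .
  have "X' \<theta> 0 \<in> ball (of_real a) \<rho>" "Y' \<theta> 0 \<in> ball (of_real b) \<rho>"
    using \<rho> complex_extension_centre[OF X0] complex_extension_centre[OF Y0] by (auto simp: a_def b_def)
  then obtain \<epsilon>1 \<epsilon>2 where
    X1: "complex_extension (ball \<theta> \<epsilon>1) \<epsilon>1 X X'"
      "\<And>\<theta>' z. \<theta>' \<in> ball \<theta> \<epsilon>1 \<Longrightarrow> z \<in> ball 0 \<epsilon>1 \<Longrightarrow> X' \<theta>' z \<in> ball (of_real a) \<rho>" and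
    Y1: "complex_extension (ball \<theta> \<epsilon>2) \<epsilon>2 Y Y'"
      "\<And>\<theta>' z. \<theta>' \<in> ball \<theta> \<epsilon>2 \<Longrightarrow> z \<in> ball 0 \<epsilon>2 \<Longrightarrow> Y' \<theta>' z \<in> ball (of_real b) \<rho>"
    using complex_extension_shrink[OF X0, of "ball (of_real a) \<rho>"]
      complex_extension_shrink[OF Y0, of "ball (of_real b) \<rho>"] open_ball by metis
  define \<epsilon> where "\<epsilon> = min \<epsilon>1 \<epsilon>2"
  have \<epsilon>: "\<epsilon> > 0" using X1(1) Y1(1) by (auto simp: \<epsilon>_def complex_extension_def)
  have X': "complex_extension (ball \<theta> \<epsilon>) \<epsilon> X X'" and Y': "complex_extension (ball \<theta> \<epsilon>) \<epsilon> Y Y'"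
    using \<epsilon> by (auto simp: \<epsilon>_def intro!: complex_extension_mono[OF X1(1)] complex_extension_mono[OF Y1(1)])
  define summand where "summand = (\<lambda>(m, n) (\<theta>', z). of_real (c m n) * (X' \<theta>' z - of_real a) ^ m * (Y' \<theta>' z - of_real b) ^ n)"
  define G where "G \<theta>' z = (\<Sum>\<^sub>\<infinity>p. summand p (\<theta>', z))" for \<theta>' z
  have small: "norm (X' \<theta>' z - of_real a) \<le> \<rho>" "norm (Y' \<theta>' z - of_real b) \<le> \<rho>"
    if "\<theta>' \<in> ball \<theta> \<epsilon>" "z \<in> ball 0 \<epsilon>" for \<theta>' z
    using X1(2)[of \<theta>' z] Y1(2)[of \<theta>' z] that by (auto simp: \<epsilon>_def dist_norm norm_minus_commute)
  have "uniform_limit (ball \<theta> \<epsilon> \<times> ball 0 \<epsilon>) (\<lambda>I p. \<Sum>i\<in>I. summand i p) (\<lambda>p. \<Sum>\<^sub>\<infinity>i. summand i p)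
      (finite_subsets_at_top UNIV)"
  proof (rule Weierstrass_m_test_general[OF _ M])
    fix i :: "nat \<times> nat" and p assume p: "p \<in> ball \<theta> \<epsilon> \<times> ball (0 :: complex) \<epsilon>"
    show "norm (summand i p) \<le> M i"
      using small[of "fst p" "snd p"] p \<rho>
      by (auto simp: summand_def M_def norm_mult norm_power abs_mult split_def
          intro!: mult_mono power_mono)
  qed
  then have ulim: "uniform_limit (ball \<theta> \<epsilon> \<times> ball 0 \<epsilon>) (\<lambda>I p. \<Sum>i\<in>I. summand i p) (\<lambda>(\<theta>', z). G \<theta>' z)
      (finite_subsets_at_top UNIV)"
    by (simp add: G_def split_def)
  have summand_cont: "continuous_on (ball \<theta> \<epsilon> \<times> ball 0 \<epsilon>) (summand i)" for i
    using X' Y' by (auto simp: summand_def complex_extension_def split_def intro!: continuous_intros)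
  have cont: "continuous_on (ball \<theta> \<epsilon> \<times> ball 0 \<epsilon>) (\<lambda>(\<theta>', z). G \<theta>' z)"
    by (rule uniform_limit_theorem[OF _ ulim])
      (auto intro!: always_eventually continuous_on_sum summand_cont)
  \<comment> \<open>The limit theorem asks for uniform convergence on a closed disc; hence half the radius.\<close>
  have holo: "G \<theta>' holomorphic_on ball 0 (\<epsilon> / 2)" if \<theta>': "\<theta>' \<in> ball \<theta> \<epsilon>" for \<theta>'
  proof (rule holomorphic_uniform_limit[of 0 "\<epsilon> / 2" "\<lambda>I z. \<Sum>i\<in>I. summand i (\<theta>', z)" "finite_subsets_at_top UNIV" "G \<theta>'"])
    have sub: "cball 0 (\<epsilon> / 2) \<subseteq> ball (0 :: complex) \<epsilon>" using \<epsilon> by auto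
    have "(\<lambda>z. summand i (\<theta>', z)) holomorphic_on ball 0 \<epsilon>" for i
      using X' Y' \<theta>' by (auto simp: summand_def complex_extension_def split_def intro!: holomorphic_intros)
    then have "(\<lambda>z. \<Sum>i\<in>I. summand i (\<theta>', z)) holomorphic_on ball 0 \<epsilon>" for I
      by (intro holomorphic_on_sum)
    then have "(\<lambda>z. \<Sum>i\<in>I. summand i (\<theta>', z)) holomorphic_on cball 0 (\<epsilon> / 2)" for I
      using sub holomorphic_on_subset by blast
    then show "\<forall>\<^sub>F I in finite_subsets_at_top UNIV.
        continuous_on (cball 0 (\<epsilon> / 2)) (\<lambda>z. \<Sum>i\<in>I. summand i (\<theta>', z)) \<and>
        (\<lambda>z. \<Sum>i\<in>I. summand i (\<theta>', z)) holomorphic_on ball 0 (\<epsilon> / 2)"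
      using holomorphic_on_imp_continuous_on holomorphic_on_subset[OF _ ball_subset_cball]
      by (intro always_eventually allI conjI) blast+
    show "uniform_limit (cball 0 (\<epsilon> / 2)) (\<lambda>I z. \<Sum>i\<in>I. summand i (\<theta>', z)) (G \<theta>')
        (finite_subsets_at_top UNIV)"
      using ulim sub \<theta>' unfolding uniform_limit_iff by (fastforce elim!: eventually_mono)
  qed auto
  have real: "G \<theta>' (of_real x) = of_real (f (X \<theta>' x, Y \<theta>' x))"
    if \<theta>': "\<theta>' \<in> ball \<theta> \<epsilon>" and x: "\<bar>x\<bar> < \<epsilon>" for \<theta>' x
  proof -
    have XY: "X' \<theta>' (of_real x) = of_real (X \<theta>' x)" "Y' \<theta>' (of_real x) = of_real (Y \<theta>' x)"
      using X' Y' \<theta>' x by (auto simp: complex_extension_def)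
    have "complex_of_real x \<in> ball 0 \<epsilon>" using x by simp
    from small[OF \<theta>' this] have "\<bar>X \<theta>' x - a\<bar> < r" "\<bar>Y \<theta>' x - b\<bar> < r"
      using \<rho> by (auto simp: XY simp flip: of_real_diff)
    from has_sum_of_real[OF c[OF this], where 'a = complex]
    have "((\<lambda>p. summand p (\<theta>', of_real x)) has_sum of_real (f (X \<theta>' x, Y \<theta>' x))) UNIV"
      by (simp add: summand_def split_def XY)
    then show ?thesis by (simp add: G_def infsumI)
  qed
  have "complex_extension (ball \<theta> (\<epsilon> / 2)) (\<epsilon> / 2) (\<lambda>\<theta> x. f (X \<theta> x, Y \<theta> x)) G"
    unfolding complex_extension_def using \<epsilon> holo real
    by (auto intro: continuous_on_subset[OF cont])
  then show ?thesis unfolding extends_near_def by blast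
qed

text \<open>
The real points accumulate at the centre, so the identity theorem applies.
\<close>

lemma extension_unique:
  assumes "G holomorphic_on ball 0 \<epsilon>" "G' holomorphic_on ball 0 \<epsilon>" "0 < \<epsilon>"
    and eq: "\<And>x. \<bar>x\<bar> < \<epsilon> \<Longrightarrow> G (of_real x) = G' (of_real x)" and z: "z \<in> ball 0 \<epsilon>"
  shows "G z = G' z"
proof -
  have "0 islimpt (of_real ` {-\<epsilon><..<\<epsilon>} :: complex set)"
    unfolding islimpt_approachable
  proof (intro allI impI)
    fix e :: real assume "e > 0"
    then have "min e \<epsilon> / 2 \<in> {-\<epsilon><..<\<epsilon>}" "min e \<epsilon> / 2 < e" "0 < min e \<epsilon> / 2"
      using \<open>0 < \<epsilon>\<close> by auto
    then show "\<exists>x'\<in>of_real ` {-\<epsilon><..<\<epsilon>}. x' \<noteq> (0 :: complex) \<and> dist x' 0 < e"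
      by (intro bexI[of _ "of_real (min e \<epsilon> / 2)"] imageI) (simp_all del: of_real_divide of_real_mult)
  qed
  then have "G z - G' z = 0"
  proof (rule analytic_continuation[of "\<lambda>z. G z - G' z" "ball 0 \<epsilon>" "of_real ` {-\<epsilon><..<\<epsilon>}" 0, rotated 5])
    show "(\<lambda>z. G z - G' z) holomorphic_on ball 0 \<epsilon>" using assms(1,2) by (rule holomorphic_on_diff)
    show "G w - G' w = 0" if "w \<in> of_real ` {-\<epsilon><..<\<epsilon>}" for w
      using that eq by (force simp: abs_less_iff)
  qed (use assms(3) z in auto)
  then show ?thesis by simp
qed

text \<open>
Finitely many local extensions cover the compact set \<open>K\<close>. On the smallest of their discs, any two
that are defined at the same \<open>\<theta>\<close> agree there by uniqueness, so a choice made separately for each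
\<open>\<theta>\<close> is still continuous in \<open>\<theta>\<close>.
\<close>

lemma complex_extension_glue:
  assumes K: "compact K" and near: "\<And>\<theta>. \<theta> \<in> K \<Longrightarrow> extends_near F \<theta>"
  shows "\<exists>\<epsilon> G. complex_extension K \<epsilon> F G"
proof -
  obtain e G where G: "\<And>\<theta>. \<theta> \<in> K \<Longrightarrow> complex_extension (ball \<theta> (e \<theta>)) (e \<theta>) F (G \<theta>)"
    using near unfolding extends_near_def by metis
  then have e: "e \<theta> > 0" if "\<theta> \<in> K" for \<theta> using that by (auto simp: complex_extension_def)
  obtain D where D: "D \<subseteq> K" "finite D" "K \<subseteq> (\<Union>\<theta>\<in>D. ball \<theta> (e \<theta>))"
    using compactE_image[OF K, of K "\<lambda>\<theta>. ball \<theta> (e \<theta>)"] e by force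
  define \<epsilon> where "\<epsilon> = Min (insert 1 (e ` D))"
  have \<epsilon>: "\<epsilon> > 0" "\<And>\<theta>. \<theta> \<in> D \<Longrightarrow> \<epsilon> \<le> e \<theta>"
    using D e by (auto simp: \<epsilon>_def)
  have GD: "complex_extension (ball \<theta> (e \<theta>)) \<epsilon> F (G \<theta>)" if "\<theta> \<in> D" for \<theta>
    using that D \<epsilon> by (intro complex_extension_mono[OF G]) auto
  define pick where "pick \<theta> = (SOME \<theta>'. \<theta>' \<in> D \<and> \<theta> \<in> ball \<theta>' (e \<theta>'))" for \<theta>
  define A where "A = (\<Union>\<theta>\<in>D. ball \<theta> (e \<theta>))"
  have pick: "pick \<theta> \<in> D" "\<theta> \<in> ball (pick \<theta>) (e (pick \<theta>))" if "\<theta> \<in> A" for \<theta>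
  proof -
    have "\<exists>\<theta>'. \<theta>' \<in> D \<and> \<theta> \<in> ball \<theta>' (e \<theta>')" using that by (auto simp: A_def)
    from someI_ex[OF this] show "pick \<theta> \<in> D" "\<theta> \<in> ball (pick \<theta>) (e (pick \<theta>))"
      by (simp_all add: pick_def)
  qed
  have eq: "G (pick \<theta>) \<theta> z = G \<theta>' \<theta> z"
    if D': "\<theta>' \<in> D" and B': "\<theta> \<in> ball \<theta>' (e \<theta>')" and z: "z \<in> ball 0 \<epsilon>" for \<theta>' \<theta> z
  proof -
    have "\<theta> \<in> A" using D' B' by (auto simp: A_def)
    note p = pick[OF this]
    have "G (pick \<theta>) \<theta> holomorphic_on ball 0 \<epsilon>" "G \<theta>' \<theta> holomorphic_on ball 0 \<epsilon>"
      using GD[OF p(1)] GD[OF D'] p(2) B' unfolding complex_extension_def by blast+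
    moreover have "G (pick \<theta>) \<theta> (of_real x) = G \<theta>' \<theta> (of_real x)" if x: "\<bar>x\<bar> < \<epsilon>" for x
    proof -
      have "G (pick \<theta>) \<theta> (of_real x) = of_real (F \<theta> x)"
        using GD[OF p(1)] p(2) x unfolding complex_extension_def by blast
      moreover have "G \<theta>' \<theta> (of_real x) = of_real (F \<theta> x)"
        using GD[OF D'] B' x unfolding complex_extension_def by blast
      ultimately show ?thesis by simp
    qed
    ultimately show ?thesis using extension_unique[OF _ _ \<epsilon>(1) _ z] by blast
  qed
  have "continuous_on (\<Union>\<theta>'\<in>D. ball \<theta>' (e \<theta>') \<times> ball 0 \<epsilon>) (\<lambda>(\<theta>, z). G (pick \<theta>) \<theta> z)"
  proof (rule continuous_on_open_UN)
    fix \<theta>' assume \<theta>': "\<theta>' \<in> D"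
    show "open (ball \<theta>' (e \<theta>') \<times> ball (0 :: complex) \<epsilon>)" by (auto intro: open_Times)
    have "continuous_on (ball \<theta>' (e \<theta>') \<times> ball 0 \<epsilon>) (\<lambda>(\<theta>, z). G \<theta>' \<theta> z)"
      using GD[OF \<theta>'] by (auto simp: complex_extension_def)
    then show "continuous_on (ball \<theta>' (e \<theta>') \<times> ball 0 \<epsilon>) (\<lambda>(\<theta>, z). G (pick \<theta>) \<theta> z)"
      by (rule continuous_on_cong[THEN iffD1, rotated -1]) (use eq[OF \<theta>'] in auto)
  qed
  then have "continuous_on (K \<times> ball 0 \<epsilon>) (\<lambda>(\<theta>, z). G (pick \<theta>) \<theta> z)"
    by (rule continuous_on_subset) (use D in auto)
  moreover have "G (pick \<theta>) \<theta> holomorphic_on ball 0 \<epsilon> \<and>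
      (\<forall>x. \<bar>x\<bar> < \<epsilon> \<longrightarrow> G (pick \<theta>) \<theta> (of_real x) = of_real (F \<theta> x))" if "\<theta> \<in> K" for \<theta>
  proof -
    have "\<theta> \<in> A" using that D unfolding A_def by blast
    from GD[OF pick(1)[OF this]] pick(2)[OF this] show ?thesis by (auto simp: complex_extension_def)
  qed
  ultimately have "complex_extension K \<epsilon> F (\<lambda>\<theta>. G (pick \<theta>) \<theta>)"
    using \<epsilon> by (auto simp: complex_extension_def)
  then show ?thesis by blast
qed

section \<open>Complex flows and real analyticity\<close>

text \<open>
For \<open>\<theta>\<close> near \<open>\<theta>0\<close> the functions \<open>G \<theta>\<close> and \<open>G \<theta>0\<close> are uniformly close on a disc;
by Cauchy's inequality so are their derivatives on a smaller one.
\<close>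

lemma deriv_jointly_continuous:
  fixes G :: "'a::metric_space \<Rightarrow> complex \<Rightarrow> complex"
  assumes S: "compact S"
    and cont: "continuous_on (S \<times> ball 0 \<epsilon>) (\<lambda>(\<theta>, z). G \<theta> z)"
    and holo: "\<And>\<theta>. \<theta> \<in> S \<Longrightarrow> G \<theta> holomorphic_on ball 0 \<epsilon>"
  shows "continuous_on (S \<times> ball 0 \<epsilon>) (\<lambda>(\<theta>, z). deriv (G \<theta>) z)"
  unfolding continuous_on_iff
proof (intro ballI allI impI)
  fix p0 :: "'a \<times> complex" and e :: real assume p0: "p0 \<in> S \<times> ball 0 \<epsilon>" and e: "e > 0"
  obtain \<theta>0 z0 where [simp]: "p0 = (\<theta>0, z0)" and \<theta>0: "\<theta>0 \<in> S" and z0: "z0 \<in> ball 0 \<epsilon>"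
    using p0 by auto
  \<comment> \<open>Discs of radius \<open>r\<close> about points of \<open>ball z0 r\<close> stay in \<open>cball z0 (2 * r)\<close>, and
    this compact disc stays in \<open>ball 0 \<epsilon>\<close>.\<close>
  define r where "r = (\<epsilon> - norm z0) / 3"
  have r: "r > 0" using z0 by (simp add: r_def)
  have sub: "cball z r \<subseteq> cball z0 (2 * r)" if "z \<in> ball z0 r" for z
    using that by (intro subsetI) (metis add_mono dist_commute dist_triangle_le less_imp_le mem_ball mem_cball mult_2)
  have sub': "cball z0 (2 * r) \<subseteq> ball 0 \<epsilon>"
  proof
    fix z assume "z \<in> cball z0 (2 * r)"
    then have "norm z \<le> norm z0 + 2 * r"
      by (metis dist_commute dist_norm mem_cball norm_triangle_sub order_trans add_left_mono)
    then show "z \<in> ball 0 \<epsilon>" using r unfolding r_def by (simp add: field_simps)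
  qed
  have "uniformly_continuous_on (S \<times> cball z0 (2 * r)) (\<lambda>(\<theta>, z). G \<theta> z)"
    using sub' by (intro compact_uniformly_continuous continuous_on_subset[OF cont] compact_Times S) auto
  then obtain d where d: "d > 0"
    and G: "\<And>p q. p \<in> S \<times> cball z0 (2 * r) \<Longrightarrow> q \<in> S \<times> cball z0 (2 * r) \<Longrightarrow> dist q p < d \<Longrightarrow>
      dist (case q of (\<theta>, z) \<Rightarrow> G \<theta> z) (case p of (\<theta>, z) \<Rightarrow> G \<theta> z) < e * r / 2"
    using e r unfolding uniformly_continuous_on_def by (metis half_gt_zero mult_pos_pos)
  have "continuous_on (ball 0 \<epsilon>) (deriv (G \<theta>0))"
    by (intro holomorphic_on_imp_continuous_on holomorphic_deriv holo \<theta>0) auto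
  then obtain d' where d': "d' > 0"
    "\<And>z. z \<in> ball 0 \<epsilon> \<Longrightarrow> dist z z0 < d' \<Longrightarrow> dist (deriv (G \<theta>0) z) (deriv (G \<theta>0) z0) < e / 2"
    using z0 e unfolding continuous_on_iff by (metis half_gt_zero)
  show "\<exists>d>0. \<forall>p\<in>S \<times> ball 0 \<epsilon>. dist p p0 < d \<longrightarrow>
      dist (case p of (\<theta>, z) \<Rightarrow> deriv (G \<theta>) z) (case p0 of (\<theta>, z) \<Rightarrow> deriv (G \<theta>) z) < e"
  proof (intro exI[of _ "Min {d, d', r}"] conjI ballI impI)
    fix p assume p: "p \<in> S \<times> ball 0 \<epsilon>" and close: "dist p p0 < Min {d, d', r}"
    obtain \<theta> z where [simp]: "p = (\<theta>, z)" and \<theta>: "\<theta> \<in> S" and z: "z \<in> ball 0 \<epsilon>" using p by auto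
    have "dist \<theta> \<theta>0 \<le> dist p p0" "dist z z0 \<le> dist p p0"
      using dist_fst_le[of p p0] dist_snd_le[of p p0] by auto
    then have cl: "dist \<theta> \<theta>0 < d" "dist z z0 < d'" "z \<in> ball z0 r"
      using close by (auto simp: dist_commute)
    have hol: "G \<theta> holomorphic_on ball 0 \<epsilon>" "G \<theta>0 holomorphic_on ball 0 \<epsilon>"
      using holo \<theta> \<theta>0 by auto
    have "norm ((deriv ^^ 1) (\<lambda>w. G \<theta> w - G \<theta>0 w) z) \<le> fact 1 * (e * r / 2) / r ^ 1"
    proof (rule Cauchy_inequality[OF _ _ r])
      have "(\<lambda>w. G \<theta> w - G \<theta>0 w) holomorphic_on cball z r"
        using hol sub[OF cl(3)] sub' by (intro holomorphic_on_diff) (auto intro: holomorphic_on_subset)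
      then show "(\<lambda>w. G \<theta> w - G \<theta>0 w) holomorphic_on ball z r"
        "continuous_on (cball z r) (\<lambda>w. G \<theta> w - G \<theta>0 w)"
        using holomorphic_on_imp_continuous_on holomorphic_on_subset[OF _ ball_subset_cball] by blast+
      show "norm (G \<theta> w - G \<theta>0 w) \<le> e * r / 2" if "norm (z - w) = r" for w
      proof -
        have "w \<in> cball z0 (2 * r)" using that sub[OF cl(3)] by (auto simp: dist_norm)
        from G[of "(\<theta>0, w)" "(\<theta>, w)"] this \<theta> \<theta>0 cl(1)
        show ?thesis by (simp add: dist_Pair_Pair dist_norm)
      qed
    qed
    moreover have "deriv (\<lambda>w. G \<theta> w - G \<theta>0 w) z = deriv (G \<theta>) z - deriv (G \<theta>0) z"
      using hol z by (intro deriv_diff) (auto intro: holomorphic_on_imp_differentiable_at)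
    ultimately have "dist (deriv (G \<theta>) z) (deriv (G \<theta>0) z) \<le> e / 2"
      using r by (simp add: dist_norm)
    then show "dist (case p of (\<theta>, z) \<Rightarrow> deriv (G \<theta>) z) (case p0 of (\<theta>, z) \<Rightarrow> deriv (G \<theta>) z) < e"
      using d'(2)[OF z cl(2)] dist_triangle[of "deriv (G \<theta>) z" "deriv (G \<theta>0) z0" "deriv (G \<theta>0) z"]
      by simp
  qed (use d d' r in auto)
qed

lemma holomorphic_param_integral:
  fixes G :: "real \<Rightarrow> complex \<Rightarrow> complex"
  assumes T: "0 \<le> T"
    and cont: "continuous_on ({0..T} \<times> ball 0 \<epsilon>) (\<lambda>(\<theta>, z). G \<theta> z)"
    and holo: "\<And>\<theta>. \<theta> \<in> {0..T} \<Longrightarrow> G \<theta> holomorphic_on ball 0 \<epsilon>"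
  shows "(\<lambda>z. integral {0..T} (\<lambda>\<theta>. G \<theta> z)) holomorphic_on ball 0 \<epsilon>"
proof -
  have "(\<lambda>z. integral (cbox 0 T) (\<lambda>\<theta>. G \<theta> z)) holomorphic_on ball 0 \<epsilon>"
  proof (rule leibniz_rule_holomorphic[where fx = "\<lambda>z \<theta>. deriv (G \<theta>) z"])
    show "(G \<theta> has_field_derivative deriv (G \<theta>) z) (at z within ball 0 \<epsilon>)"
      if "z \<in> ball 0 \<epsilon>" "\<theta> \<in> cbox 0 T" for z \<theta>
      by (rule has_field_derivative_at_within, rule holomorphic_derivI[OF holo])
        (use that in auto)
    show "(\<lambda>\<theta>. G \<theta> z) integrable_on cbox 0 T" if "z \<in> ball 0 \<epsilon>" for z
      using that by (intro integrable_continuous continuous_on_compose_pair[OF cont] continuous_intros) auto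
    have "continuous_on ({0..T} \<times> ball 0 \<epsilon>) (\<lambda>(\<theta>, z). deriv (G \<theta>) z)"
      using cont holo by (intro deriv_jointly_continuous) auto
    then have "continuous_on (ball 0 \<epsilon> \<times> cbox 0 T) (\<lambda>p. deriv (G (snd p)) (fst p))"
      by (rule continuous_on_compose_pair[where F = "\<lambda>\<theta>. deriv (G \<theta>)"])
        (auto intro!: continuous_on_fst continuous_on_snd continuous_on_id)
    then show "continuous_on (ball 0 \<epsilon> \<times> cbox 0 T) (\<lambda>(z, \<theta>). deriv (G \<theta>) z)"
      by (simp add: split_def)
  qed auto
  then show ?thesis by simp
qed

text \<open>
The complexified equation is solved for complex initial values near \<open>0\<close>. Since \<open>0\<close> is an
equilibrium, solutions starting close to it stay in the disc up to time \<open>T\<close>, by Gronwall's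
inequality. For real initial values they are the real solutions, by uniqueness.
\<close>

lemma complex_flow:
  assumes T: "0 \<le> T" and q: "complex_extension {0..T} \<epsilon> q Q" and q0: "\<And>\<theta>. \<theta> \<in> {0..T} \<Longrightarrow> q \<theta> 0 = 0"
  shows "\<exists>S L \<delta>. 0 < \<delta> \<and> \<delta> \<le> \<epsilon> \<and>
    parametrized_flow Q (\<lambda>\<theta>. deriv (Q \<theta>)) S T L (ball 0 \<delta>) (cball 0 (\<epsilon> / 2)) \<and>
    (\<forall>r. (\<forall>\<theta>\<in>{0..T}. (r has_real_derivative q \<theta> (r \<theta>)) (at \<theta>) \<and> \<bar>r \<theta>\<bar> \<le> \<epsilon> / 2) \<and> \<bar>r 0\<bar> < \<delta> \<longrightarrow>
      (\<forall>\<theta>\<in>{0..T}. S \<theta> (of_real (r 0)) = of_real (r \<theta>)))"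
proof -
  define V where "V = cball (0 :: complex) (\<epsilon> / 2)"
  from q have \<epsilon>: "\<epsilon> > 0" and cont: "continuous_on ({0..T} \<times> ball 0 \<epsilon>) (\<lambda>(\<theta>, z). Q \<theta> z)"
    and holo: "\<And>\<theta>. \<theta> \<in> {0..T} \<Longrightarrow> Q \<theta> holomorphic_on ball 0 \<epsilon>"
    and real: "\<And>\<theta> x. \<theta> \<in> {0..T} \<Longrightarrow> \<bar>x\<bar> < \<epsilon> \<Longrightarrow> Q \<theta> (of_real x) = of_real (q \<theta> x)"
    by (auto simp: complex_extension_def)
  have sub: "V \<subseteq> ball 0 \<epsilon>" using \<epsilon> by (auto simp: V_def)
  have V: "compact V" "convex V" "V \<noteq> {}" using \<epsilon> by (auto simp: V_def)
  note cp = closest_point_in_set[OF compact_imp_closed[OF V(1)] V(3)]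
  have contV: "continuous_on ({0..T} \<times> V) (\<lambda>(\<theta>, z). Q \<theta> z)"
    by (rule continuous_on_subset[OF cont]) (use sub in auto)
  have contV': "continuous_on ({0..T} \<times> V) (\<lambda>(\<theta>, z). deriv (Q \<theta>) z)"
    by (rule continuous_on_subset[OF deriv_jointly_continuous[OF _ cont holo]]) (use sub in auto)
  have deriv: "(Q \<theta> has_field_derivative deriv (Q \<theta>) z) (at z)" if "\<theta> \<in> {0..T}" "z \<in> V" for \<theta> z
    using that sub by (intro holomorphic_derivI[OF holo]) auto
  obtain L M where L: "L > 0" and M: "\<forall>s\<in>{0..T}. \<forall>x. norm (Q s (closest_point V x)) \<le> M"
    and bound: "\<forall>s\<in>{0..T}. \<forall>x\<in>V. norm (deriv (Q s) x) \<le> L"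
    and lip_cp: "\<forall>s\<in>{0..T}. \<forall>x y. norm (Q s (closest_point V x) - Q s (closest_point V y)) \<le> L * norm (x - y)"
    and lip: "\<forall>s\<in>{0..T}. \<forall>x\<in>V. \<forall>y\<in>V. norm (Q s x - Q s y) \<le> L * norm (x - y)"
    using clamped_field_bounds[OF compact_Icc V contV contV' deriv] by blast
  note M = M[rule_format] and bound = bound[rule_format] and lip_cp = lip_cp[rule_format]
    and lip = lip[rule_format]
  define clamp where "clamp s = max 0 (min T s)" for s :: real
  have clamp: "clamp s \<in> {0..T}" for s using T by (auto simp: clamp_def)
  have clamp_id: "clamp s = s" if "s \<in> {0..T}" for s using that by (auto simp: clamp_def)
  define B where "B s x = Q (clamp s) (closest_point V x)" for s x
  have "\<exists>R. R 0 = x0 \<and> (\<forall>t. (R has_vector_derivative B t (R t)) (at t))" for x0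
  proof (rule global_ode_solution[where M = M, OF _ _ _ L])
    have "continuous_on UNIV (\<lambda>p. Q (clamp (fst p)) (closest_point V (snd p)))"
    proof (rule continuous_on_compose_pair[OF contV])
      show "continuous_on UNIV (\<lambda>p :: real \<times> complex. clamp (fst p))"
        unfolding clamp_def by (intro continuous_intros)
      show "continuous_on UNIV (\<lambda>p :: real \<times> complex. closest_point V (snd p))"
        by (rule continuous_on_compose2[OF continuous_on_closest_point[of V UNIV] continuous_on_snd])
          (use V in \<open>auto intro: compact_imp_closed continuous_on_id\<close>)
    qed (use clamp cp in auto)
    then show "continuous_on UNIV (\<lambda>(t, x). B t x)" by (simp add: B_def split_def)
  qed (use M lip_cp clamp in \<open>auto simp: B_def\<close>)
  then obtain R where R0: "R x0 0 = x0" and R: "(R x0 has_vector_derivative B t (R x0 t)) (at t)" for x0 t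
    by metis
  \<comment> \<open>The centre is its own nearest point, so it remains an equilibrium of the clamped field.\<close>
  have zero: "B \<theta> 0 = 0" if "\<theta> \<in> {0..T}" for \<theta>
  proof -
    have "closest_point V 0 = 0" using \<epsilon> by (intro closest_point_self) (auto simp: V_def)
    then show ?thesis using real[OF that, of 0] q0[OF that] \<epsilon> by (simp add: B_def clamp_id[OF that])
  qed
  have small: "norm (R x \<theta>) \<le> norm x * exp (L * T)" if "\<theta> \<in> {0..T}" for x \<theta>
  proof -
    have seg: "s \<in> {0..T}" if "s \<in> closed_segment 0 \<theta>" for s
      using that \<open>\<theta> \<in> {0..T}\<close> by (auto simp: closed_segment_eq_real_ivl split: if_splits)
    have "norm (R x \<theta> - 0) \<le> norm (R x 0 - 0) * exp (L * \<bar>\<theta> - 0\<bar>)"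
    proof (rule gronwall_distance[of 0 \<theta> "R x" "\<lambda>s. B s (R x s)" "\<lambda>_. 0" "\<lambda>s. B s 0"])
      show "((\<lambda>_. 0) has_vector_derivative B s 0) (at s)" if "s \<in> closed_segment 0 \<theta>" for s
        using zero[OF seg[OF that]] by simp
      show "norm (B s (R x s) - B s 0) \<le> L * norm (R x s - 0)" for s
        unfolding B_def by (rule lip_cp[OF clamp])
    qed (rule R)
    also have "\<dots> \<le> norm x * exp (L * T)"
      using that L by (auto simp: R0 intro!: mult_left_mono)
    finally show ?thesis by simp
  qed
  \<comment> \<open>The growth factor up to time \<open>T\<close> is at most \<open>exp (L * T)\<close>.\<close>
  define \<delta> where "\<delta> = \<epsilon> / 2 * exp (- L * T)"
  have \<delta>: "\<delta> > 0" "\<delta> \<le> \<epsilon>" "\<delta> \<le> \<epsilon> / 2"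
  proof -
    have "exp (- L * T) \<le> 1" using L T by simp
    then have "\<epsilon> / 2 * exp (- L * T) \<le> \<epsilon> / 2 * 1" using \<epsilon> by (intro mult_left_mono) auto
    then show "\<delta> \<le> \<epsilon> / 2" by (simp only: \<delta>_def mult_1_right)
    then show "\<delta> \<le> \<epsilon>" using \<epsilon> by linarith
  qed (use \<epsilon> in \<open>simp add: \<delta>_def\<close>)
  have inV: "R x \<theta> \<in> V" if "\<theta> \<in> {0..T}" "x \<in> ball 0 \<delta>" for x \<theta>
  proof -
    have "norm x * exp (L * T) \<le> \<delta> * exp (L * T)" using that by (intro mult_right_mono) auto
    also have "\<dots> = \<epsilon> / 2" by (simp add: \<delta>_def exp_minus)
    finally show ?thesis using small[OF that(1), of x] by (simp add: V_def)
  qed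
  have unclamped: "(R x has_vector_derivative Q \<theta> (R x \<theta>)) (at \<theta>)" if "\<theta> \<in> {0..T}" "x \<in> ball 0 \<delta>" for x \<theta>
    using R[of x \<theta>] inV[OF that] by (simp add: B_def clamp_id[OF that(1)] closest_point_self)
  show ?thesis
  proof (rule exI[of _ "\<lambda>\<theta> x. R x \<theta>"], rule exI[of _ L], rule exI[of _ \<delta>], intro conjI allI impI; (elim conjE)?)
    show "0 < \<delta>" "\<delta> \<le> \<epsilon>" by fact+
    show "parametrized_flow Q (\<lambda>\<theta>. deriv (Q \<theta>)) (\<lambda>\<theta> x. R x \<theta>) T L (ball 0 \<delta>) (cball 0 (\<epsilon> / 2))"
      unfolding V_def[symmetric]
      by unfold_locales (use T V deriv contV' bound unclamped R0 inV in auto)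
    fix r :: "real \<Rightarrow> real"
    assume "\<forall>\<theta>\<in>{0..T}. (r has_real_derivative q \<theta> (r \<theta>)) (at \<theta>) \<and> \<bar>r \<theta>\<bar> \<le> \<epsilon> / 2"
      and "\<bar>r 0\<bar> < \<delta>"
    then have r: "(r has_real_derivative q \<theta> (r \<theta>)) (at \<theta>)" and rV: "\<bar>r \<theta>\<bar> \<le> \<epsilon> / 2"
      if "\<theta> \<in> {0..T}" for \<theta> using that by auto
    show "\<forall>\<theta>\<in>{0..T}. R (of_real (r 0)) \<theta> = of_real (r \<theta>)"
    proof
      fix \<theta> assume \<theta>: "\<theta> \<in> {0..T}"
      have seg: "s \<in> {0..T}" if "s \<in> closed_segment 0 \<theta>" for s
        using that \<theta> by (auto simp: closed_segment_eq_real_ivl split: if_splits)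
      have xb: "complex_of_real (r 0) \<in> ball 0 \<delta>" using \<open>\<bar>r 0\<bar> < \<delta>\<close> by simp
      show "R (of_real (r 0)) \<theta> = of_real (r \<theta>)"
      proof (rule ode_unique[of 0 \<theta> _ "\<lambda>s. Q s (R (of_real (r 0)) s)" _ "\<lambda>s. Q s (of_real (r s))" L])
        fix s assume "s \<in> closed_segment 0 \<theta>"
        note s = seg[OF this]
        show "(R (of_real (r 0)) has_vector_derivative Q s (R (of_real (r 0)) s)) (at s)"
          using unclamped[OF s xb] .
        have "((\<lambda>s. of_real (r s)) has_vector_derivative complex_of_real (q s (r s))) (at s)"
          using r[OF s] by (rule has_vector_derivative_of_real)
        moreover have "\<bar>r s\<bar> < \<epsilon>" using rV[OF s] \<epsilon> by simp
        ultimately show "((\<lambda>s. of_real (r s)) has_vector_derivative Q s (of_real (r s))) (at s)"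
          by (simp add: real[OF s])
        show "norm (Q s (R (of_real (r 0)) s) - Q s (of_real (r s))) \<le> L * norm (R (of_real (r 0)) s - of_real (r s))"
          using rV[OF s] by (intro lip[OF s inV[OF s xb]]) (simp add: V_def)
      qed (use R0 in simp)
    qed
  qed
qed

text \<open>
The real parts of the Taylor coefficients of a holomorphic extension serve as real coefficients.
\<close>

lemma real_analytic_onI:
  assumes "\<And>a. a \<in> S \<Longrightarrow> \<exists>r>0. \<exists>G. G holomorphic_on ball (of_real a) r \<and>
    (\<forall>x. \<bar>x - a\<bar> < r \<longrightarrow> G (of_real x) = of_real (g x))"
  shows "real_analytic_on g S"
  unfolding real_analytic_on_def
proof
  fix a assume "a \<in> S"
  then obtain r G where r: "r > 0" and G: "G holomorphic_on ball (of_real a) r"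
    and real: "\<And>x. \<bar>x - a\<bar> < r \<Longrightarrow> G (of_real x) = of_real (g x)"
    using assms by blast
  define c where "c n = (deriv ^^ n) G (of_real a) / fact n" for n
  have sums: "(\<lambda>n. c n * (w - of_real a) ^ n) sums G w" if "w \<in> ball (of_real a) r" for w
    using holomorphic_power_series[OF G that] by (simp add: c_def)
  have "((\<lambda>n. Re (c n) * (x - a) ^ n) has_sum g x) UNIV" if x: "\<bar>x - a\<bar> < r" for x
  proof -
    define d where "d = (\<bar>x - a\<bar> + r) / 2"
    have d: "\<bar>x - a\<bar> < d" "d < r" using x by (auto simp: d_def)
    have "complex_of_real (a + d) \<in> ball (of_real a) r"
      using d by (simp add: dist_norm norm_minus_commute)
    then have "summable (\<lambda>n. c n * (of_real d) ^ n)"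
      using sums[of "of_real (a + d)"] by (simp add: sums_iff)
    then have "summable (\<lambda>n. norm (c n * (of_real (x - a)) ^ n))"
      by (rule powser_insidea) (use d in \<open>simp flip: of_real_diff\<close>)
    note majorant = this
    have le: "norm (Re (c n) * (x - a) ^ n) \<le> norm (c n * (of_real (x - a)) ^ n)" for n
      using abs_Re_le_cmod[of "c n"]
      by (simp add: norm_mult norm_power abs_mult mult_right_mono power_abs del: of_real_diff)
    have abs: "summable (\<lambda>n. norm (Re (c n) * (x - a) ^ n))"
      by (rule summable_norm_comparison_test[OF _ majorant]) (intro exI allI impI, rule le)
    have "(\<lambda>n. Re (c n * (of_real x - of_real a) ^ n)) sums Re (G (of_real x))"
      by (rule sums_Re, rule sums) (use x in \<open>simp add: dist_norm norm_minus_commute flip: of_real_diff\<close>)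
    moreover have "Re (c n * (of_real x - of_real a) ^ n) = Re (c n) * (x - a) ^ n" for n
      by (simp flip: of_real_diff of_real_power)
    ultimately have "(\<lambda>n. Re (c n) * (x - a) ^ n) sums g x"
      using real[OF x] by simp
    with abs show ?thesis by (rule norm_summable_imp_has_sum)
  qed
  then show "\<exists>r>0. \<exists>c. \<forall>x. \<bar>x - a\<bar> < r \<longrightarrow> ((\<lambda>n. c n * (x - a) ^ n) has_sum g x) UNIV"
    using r by (intro exI[of _ r] conjI exI[of _ "\<lambda>n. Re (c n)"]) auto
qed

lemma real_analytic_on_cong:
  assumes S: "open S" and eq: "\<And>x. x \<in> S \<Longrightarrow> g x = h x" and g: "real_analytic_on g S"
  shows "real_analytic_on h S"
  unfolding real_analytic_on_def
proof
  fix a assume a: "a \<in> S"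
  then obtain r c where r: "r > 0"
    and c: "\<And>x. \<bar>x - a\<bar> < r \<Longrightarrow> ((\<lambda>n. c n * (x - a) ^ n) has_sum g x) UNIV"
    using g unfolding real_analytic_on_def by blast
  obtain e where e: "e > 0" "ball a e \<subseteq> S" using S a open_contains_ball by blast
  have "((\<lambda>n. c n * (x - a) ^ n) has_sum h x) UNIV" if "\<bar>x - a\<bar> < min r e" for x
  proof -
    have "x \<in> ball a e" using that by (simp add: dist_real_def abs_minus_commute)
    then have "g x = h x" using e(2) by (intro eq) blast
    then show ?thesis using c[of x] that by simp
  qed
  then show "\<exists>r>0. \<exists>c. \<forall>x. \<bar>x - a\<bar> < r \<longrightarrow> ((\<lambda>n. c n * (x - a) ^ n) has_sum h x) UNIV"
    using r e(1) by (intro exI[of _ "min r e"] conjI exI[of _ c]) auto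
qed

lemma real_analytic2_on_uminus:
  assumes "real_analytic2_on f S"
  shows "real_analytic2_on (\<lambda>z. - f z) S"
  unfolding real_analytic2_on_def
proof safe
  fix a b assume "(a, b) \<in> S"
  then obtain r c where r: "r > 0" and c: "\<And>x y. \<bar>x - a\<bar> < r \<Longrightarrow> \<bar>y - b\<bar> < r \<Longrightarrow>
      ((\<lambda>(m, n). c m n * (x - a) ^ m * (y - b) ^ n) has_sum f (x, y)) UNIV"
    using assms unfolding real_analytic2_on_def by blast
  have "((\<lambda>(m, n). - c m n * (x - a) ^ m * (y - b) ^ n) has_sum - f (x, y)) UNIV"
    if "\<bar>x - a\<bar> < r" "\<bar>y - b\<bar> < r" for x y
  proof -
    have "((\<lambda>p. - (case p of (m, n) \<Rightarrow> c m n * (x - a) ^ m * (y - b) ^ n)) has_sum - f (x, y)) UNIV"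
      using c[OF that] by (simp add: has_sum_uminus)
    then show ?thesis by (simp add: split_def)
  qed
  then show "\<exists>r>0. \<exists>c. \<forall>x y. \<bar>x - a\<bar> < r \<and> \<bar>y - b\<bar> < r \<longrightarrow>
      ((\<lambda>(m, n). c m n * (x - a) ^ m * (y - b) ^ n) has_sum - f (x, y)) UNIV"
    using r by (intro exI[of _ r] conjI exI[of _ "\<lambda>m n. - c m n"]) auto
qed

section \<open>The equation in polar coordinates\<close>

lemma is_minimal_period_unique: "is_minimal_period u T \<Longrightarrow> is_minimal_period u S \<Longrightarrow> T = S"
  unfolding is_minimal_period_def by (meson antisym)

text \<open>
The name refers to the fact that every solution other than the equilibrium turns around the origin.
\<close>

locale rotating_field =
  fixes f :: "real \<times> real \<Rightarrow> real"
  assumes X_plus: "f \<in> X_plus"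
begin

lemma C2: "C_k_on 2 f UNIV"
  and even: "f (- u, v) = f (u, v)"
  and odd: "f (u, - v) = - f (u, v)"
  and deriv_pos: "deriv (\<lambda>v. f (u, v)) v > 0"
proof -
  have *: "C_k_on 2 f UNIV" "\<forall>u v. f (u, v) = f (- u, v)" "\<forall>u v. f (u, v) = - f (u, - v)"
    "\<forall>u v. deriv (\<lambda>v. f (u, v)) v > 0"
    using X_plus unfolding X_plus_def by blast+
  show "C_k_on 2 f UNIV" "deriv (\<lambda>v. f (u, v)) v > 0" using * by blast+
  show "f (- u, v) = f (u, v)" using *(2)[rule_format, of u v] by simp
  show "f (u, - v) = - f (u, v)" using *(3)[rule_format, of u v] by simp
qed

lemma f_has_derivative: "(f has_derivative frechet_derivative f (at z)) (at z)"
  using C2 unfolding numeral_2_eq_2 C_k_on.simps frechet_derivative_works[symmetric] by blast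

lemma partial_continuous: "continuous_on UNIV (\<lambda>z. frechet_derivative f (at z) v)"
proof -
  have "C_k_on 1 (\<lambda>z. frechet_derivative f (at z) v) UNIV"
    using C2 unfolding numeral_2_eq_2 One_nat_def C_k_on.simps(2)[of "Suc 0"] by blast
  then show ?thesis by (rule C_k_on_continuous)
qed

lemma f_continuous: "continuous_on UNIV f"
  using C2 by (rule C_k_on_continuous)

lemma continuous_on_f [continuous_intros]:
  "continuous_on S a \<Longrightarrow> continuous_on S b \<Longrightarrow> continuous_on S (\<lambda>x. f (a x, b x))"
  by (rule continuous_on_compose2[OF f_continuous]) (auto intro: continuous_on_Pair)

definition d2 :: "real \<times> real \<Rightarrow> real" where
  "d2 z = frechet_derivative f (at z) (0, 1)"

lemma d2_continuous: "continuous_on UNIV d2"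
  unfolding d2_def by (rule partial_continuous)

lemma has_d2: "((\<lambda>v. f (u, v)) has_real_derivative d2 (u, v)) (at v)"
proof -
  interpret D: bounded_linear "frechet_derivative f (at (u, v))"
    using f_has_derivative by (rule has_derivative_bounded_linear)
  have "((\<lambda>v. f (u, v)) has_derivative (\<lambda>h. frechet_derivative f (at (u, v)) (0, h))) (at v)"
    by (rule has_derivative_compose[OF has_derivative_Pair[OF has_derivative_const has_derivative_ident]
          f_has_derivative])
  moreover have "frechet_derivative f (at (u, v)) (0, h) = d2 (u, v) * h" for h
    using D.scaleR[of h "(0, 1)"] by (simp add: d2_def mult.commute)
  ultimately show ?thesis
    by (simp add: has_field_derivative_def)
qed

lemma d2_pos: "d2 z > 0"
  using deriv_pos[of "fst z" "snd z"] DERIV_imp_deriv[OF has_d2[of "fst z" "snd z"]] by simp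

lemma f_zero [simp]: "f (u, 0) = 0"
  using odd[of u 0] by simp

lemma f_pos: "v > 0 \<Longrightarrow> f (u, v) > 0"
  using DERIV_pos_imp_increasing[of 0 v "\<lambda>v. f (u, v)"] has_d2 d2_pos by fastforce

lemma times_f_pos: "v \<noteq> 0 \<Longrightarrow> v * f (u, v) > 0"
  using f_pos[of v u] f_pos[of "- v" u] odd[of u v]
  by (cases "v > 0") (auto simp: zero_less_mult_iff)

lemma times_f_nonneg: "v * f (u, v) \<ge> 0"
  using times_f_pos[of v u] by (cases "v = 0") auto

lemma f_eq_0_iff: "f (u, v) = 0 \<longleftrightarrow> v = 0"
  using times_f_pos[of v u] by (cases "v = 0") auto

lemma equilibria: "equilibria f = {(0, 0)}"
  by (auto simp: equilibria_def vfield_def f_eq_0_iff)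

text \<open>
The radius is \<open>exp \<rho>\<close>, so that every real \<open>\<rho>\<close> is admissible.
\<close>

definition X :: "real \<Rightarrow> real \<Rightarrow> real" where "X \<theta> \<rho> = exp \<rho> * cos \<theta>"
definition Y :: "real \<Rightarrow> real \<Rightarrow> real" where "Y \<theta> \<rho> = exp \<rho> * sin \<theta>"

text \<open>
With \<open>x' = - f (x, y)\<close> and \<open>y' = f (y, x)\<close>, the system run backwards in time, these are
\<open>x y' - y x'\<close> and \<open>x x' + y y'\<close>. Hence \<open>g\<close> is \<open>d\<rho>/d\<theta>\<close> and
\<open>time_density\<close> is \<open>dt/d\<theta>\<close>, where \<open>t\<close> is the reversed time.
\<close>

definition angular :: "real \<Rightarrow> real \<Rightarrow> real" where
  "angular \<theta> \<rho> = X \<theta> \<rho> * f (Y \<theta> \<rho>, X \<theta> \<rho>) + Y \<theta> \<rho> * f (X \<theta> \<rho>, Y \<theta> \<rho>)"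
definition radial :: "real \<Rightarrow> real \<Rightarrow> real" where
  "radial \<theta> \<rho> = - X \<theta> \<rho> * f (X \<theta> \<rho>, Y \<theta> \<rho>) + Y \<theta> \<rho> * f (Y \<theta> \<rho>, X \<theta> \<rho>)"
definition g :: "real \<Rightarrow> real \<Rightarrow> real" where "g \<theta> \<rho> = radial \<theta> \<rho> * inverse (angular \<theta> \<rho>)"
definition time_density :: "real \<Rightarrow> real \<Rightarrow> real" where "time_density \<theta> \<rho> = (exp \<rho> * exp \<rho>) * inverse (angular \<theta> \<rho>)"

lemma angular_pos: "angular \<theta> \<rho> > 0"
proof -
  have "X \<theta> \<rho> \<noteq> 0 \<or> Y \<theta> \<rho> \<noteq> 0"
    by (auto simp: X_def Y_def dest: sin_zero_abs_cos_one)
  then show ?thesis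
    unfolding angular_def by (auto intro: add_pos_nonneg add_nonneg_pos times_f_pos times_f_nonneg)
qed

lemma time_density_pos: "time_density \<theta> \<rho> > 0"
  using angular_pos[of \<theta> \<rho>] by (simp add: time_density_def)

lemma same_direction:
  assumes "cos \<theta>' = cos \<theta>" "sin \<theta>' = sin \<theta>"
  shows "g \<theta>' \<rho> = g \<theta> \<rho>" "time_density \<theta>' \<rho> = time_density \<theta> \<rho>"
  using assms by (simp_all add: g_def time_density_def radial_def angular_def X_def Y_def)

text \<open>
The next two identities express the two reversing symmetries of the system, the reflections in the
horizontal axis and in the diagonal.
\<close>

lemma g_minus: "g (- \<theta>) \<rho> = - g \<theta> \<rho>"
  using even odd by (simp add: g_def radial_def angular_def X_def Y_def algebra_simps)

lemma g_reflect: "g (pi / 2 - \<theta>) \<rho> = - g \<theta> \<rho>"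
  by (simp add: g_def radial_def angular_def X_def Y_def cos_diff sin_diff algebra_simps)

lemma g_continuous: "continuous_on UNIV (\<lambda>(\<theta>, \<rho>). g \<theta> \<rho>)"
  and time_density_continuous: "continuous_on UNIV (\<lambda>(\<theta>, \<rho>). time_density \<theta> \<rho>)"
proof -
  have X: "continuous_on UNIV (\<lambda>p. X (fst p) (snd p))" and Y: "continuous_on UNIV (\<lambda>p. Y (fst p) (snd p))"
    unfolding X_def Y_def by (intro continuous_intros)+
  then have "continuous_on UNIV (\<lambda>p. inverse (angular (fst p) (snd p)))" "continuous_on UNIV (\<lambda>p. radial (fst p) (snd p))"
    using angular_pos unfolding angular_def radial_def
    by (auto intro!: continuous_intros simp: less_imp_neq[symmetric])
  then show "continuous_on UNIV (\<lambda>(\<theta>, \<rho>). g \<theta> \<rho>)" "continuous_on UNIV (\<lambda>(\<theta>, \<rho>). time_density \<theta> \<rho>)"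
    unfolding g_def time_density_def split_def by (auto intro!: continuous_intros)
qed

lemma C_param_g_time_density:
  assumes "C_k_on k f UNIV"
  shows "C_param k T U g" "C_param k T U time_density"
proof -
  have X: "C_param k T U X" and Y: "C_param k T U Y"
    unfolding X_def[abs_def] Y_def[abs_def]
    by (intro C_param_mult C_param_exp C_param_id C_param_const continuous_intros)+
  note f = C_param_of_C_k[OF assms]
  have D: "C_param k T U (\<lambda>\<theta> \<rho>. inverse (angular \<theta> \<rho>))"
  proof (rule C_param_inverse)
    show "C_param k T U angular"
      unfolding angular_def[abs_def] by (intro C_param_add C_param_mult X Y f)
    show "angular s x \<noteq> 0" for s x using angular_pos[of s x] by simp
  qed
  have "C_param k T U radial"
    unfolding radial_def[abs_def] by (intro C_param_add C_param_mult C_param_uminus X Y f)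
  then show "C_param k T U g" unfolding g_def[abs_def] using D by (rule C_param_mult)
  show "C_param k T U time_density"
    unfolding time_density_def[abs_def] by (intro C_param_mult C_param_exp C_param_id D)
qed

lemma octant:
  assumes "\<theta> \<in> {0..pi / 4}"
  shows "0 \<le> Y \<theta> \<rho>" "Y \<theta> \<rho> \<le> X \<theta> \<rho>" "0 < X \<theta> \<rho>"
proof -
  have \<theta>: "0 \<le> \<theta>" "\<theta> \<le> pi / 4" using assms by auto
  have "0 \<le> sin \<theta>" using \<theta> pi_gt_zero by (intro sin_ge_zero) linarith+
  moreover have "0 < cos \<theta>" using \<theta> pi_gt_zero by (intro cos_gt_zero_pi) linarith+
  moreover have "sin \<theta> \<le> cos \<theta>"
  proof -
    have "sin \<theta> \<le> sin (pi / 4)" "cos (pi / 4) \<le> cos \<theta>"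
      using \<theta> pi_gt_zero by (intro sin_monotone_2pi_le cos_monotone_0_pi_le; linarith)+
    then show ?thesis by (simp add: sin_45 cos_45)
  qed
  ultimately show "0 \<le> Y \<theta> \<rho>" "Y \<theta> \<rho> \<le> X \<theta> \<rho>" "0 < X \<theta> \<rho>" by (auto simp: X_def Y_def)
qed

text \<open>
In this octant \<open>0 \<le> y \<le> x\<close>. The only positive contribution to \<open>radial\<close> is
\<open>y f (y, x)\<close>, which is at most the term \<open>x f (y, x)\<close> of \<open>angular\<close>.
\<close>

lemma g_le_1:
  assumes "\<theta> \<in> {0..pi / 4}"
  shows "g \<theta> \<rho> \<le> 1"
proof -
  let ?x = "X \<theta> \<rho>" and ?y = "Y \<theta> \<rho>"
  note o = octant[OF assms, of \<rho>]
  have fyx: "0 \<le> f (?y, ?x)" using f_pos[OF o(3)] less_imp_le by blast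
  have fxy: "0 \<le> f (?x, ?y)" using f_pos[of ?y ?x] o(1) by (cases "?y = 0") (auto intro: less_imp_le)
  have "radial \<theta> \<rho> \<le> ?y * f (?y, ?x)" using o fxy by (simp add: radial_def)
  also have "\<dots> \<le> ?x * f (?y, ?x)" using o fyx by (intro mult_right_mono)
  also have "\<dots> \<le> angular \<theta> \<rho>" using o fxy by (simp add: angular_def)
  finally show ?thesis using angular_pos[of \<theta> \<rho>] by (simp add: g_def field_simps)
qed

text \<open>
Let \<open>m\<close> and \<open>M\<close> be the extreme values of the second partial derivative on a square
that contains the region considered. Then \<open>x f (x, y) \<le> M x y \<le> M x\<^sup>2\<close>, while
\<open>x f (y, x) \<ge> m x\<^sup>2\<close>, so \<open>M / m\<close> bounds \<open>- g\<close>. As the bound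
holds for arbitrarily small radius, \<open>\<rho>\<close> cannot run off to \<open>-\<infinity>\<close> at a finite angle.
\<close>

lemma g_lower_bound: "\<exists>K\<ge>0. \<forall>\<theta>\<in>{0..pi / 4}. \<forall>\<rho>\<le>hi. - K \<le> g \<theta> \<rho>"
proof -
  define C where "C = cbox (0, 0) (exp hi, exp hi)"
  have C: "compact C" "C \<noteq> {}" unfolding C_def by (rule compact_cbox) (auto simp: cbox_Pair_eq)
  have cont: "continuous_on C d2" using d2_continuous by (rule continuous_on_subset) simp
  obtain z1 where z1: "z1 \<in> C" "\<And>z. z \<in> C \<Longrightarrow> d2 z1 \<le> d2 z"
    using continuous_attains_inf[OF C cont] by blast
  obtain z2 where z2: "z2 \<in> C" "\<And>z. z \<in> C \<Longrightarrow> d2 z \<le> d2 z2"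
    using continuous_attains_sup[OF C cont] by blast
  define m M where "m = d2 z1" and "M = d2 z2"
  have m: "m > 0" "M > 0" using d2_pos by (auto simp: m_def M_def)
  have bounds: "m * v \<le> f (u, v)" "f (u, v) \<le> M * v"
    if "0 \<le> u" "u \<le> exp hi" "0 \<le> v" "v \<le> exp hi" for u v
  proof -
    have "m * v \<le> f (u, v) \<and> f (u, v) \<le> M * v"
    proof (cases "v = 0")
      case False
      with that have "0 < v" by simp
      then obtain w where w: "0 < w" "w < v" "f (u, v) - f (u, 0) = (v - 0) * d2 (u, w)"
        using MVT2[of 0 v "\<lambda>v. f (u, v)" "\<lambda>v. d2 (u, v)"] has_d2 by blast
      have "(u, w) \<in> C" using w that by (auto simp: C_def)
      from z1(2)[OF this] z2(2)[OF this] w \<open>0 < v\<close> show ?thesis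
        by (auto simp: m_def M_def mult.commute)
    qed simp
    then show "m * v \<le> f (u, v)" "f (u, v) \<le> M * v" by auto
  qed
  show ?thesis
  proof (intro exI[of _ "M / m"] conjI ballI allI impI)
    show "0 \<le> M / m" using m by simp
    fix \<theta> \<rho> assume \<theta>: "\<theta> \<in> {0..pi / 4}" and \<rho>: "\<rho> \<le> hi"
    let ?x = "X \<theta> \<rho>" and ?y = "Y \<theta> \<rho>"
    note o = octant[OF \<theta>, of \<rho>]
    have "?x \<le> exp hi * 1" unfolding X_def using \<rho> o(3) by (intro mult_mono) (auto simp: X_def zero_less_mult_iff)
    then have hi: "?x \<le> exp hi" "?y \<le> exp hi" using o by auto
    have "- radial \<theta> \<rho> \<le> ?x * f (?x, ?y)"
      using times_f_nonneg o f_pos[OF o(3), of ?y] by (simp add: radial_def)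
    also have "\<dots> \<le> ?x * (M * ?y)" using bounds(2)[of ?x ?y] hi o by (intro mult_left_mono) auto
    also have "\<dots> \<le> ?x * (M * ?x)" using o m by (intro mult_left_mono) auto
    also have "\<dots> = (M / m) * (?x * (m * ?x))" using m by simp
    also have "\<dots> \<le> (M / m) * (?x * f (?y, ?x))"
      using bounds(1)[of ?y ?x] hi o m by (intro mult_left_mono) auto
    also have "\<dots> \<le> (M / m) * angular \<theta> \<rho>"
      using times_f_nonneg[of ?y ?x] m by (intro mult_left_mono) (auto simp: angular_def)
    finally show "- (M / m) \<le> g \<theta> \<rho>"
      using angular_pos[of \<theta> \<rho>] by (simp add: g_def field_simps)
  qed
qed

lemma angle_in_period: "\<exists>\<theta>'\<in>{0..2 * pi}. cos \<theta>' = cos \<theta> \<and> sin \<theta>' = sin \<theta>"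
  using sincos_total_2pi_le[of "cos \<theta>" "sin \<theta>"] by fastforce

text \<open>
The derivative of \<open>g\<close> in \<open>\<rho>\<close>, specified over one full turn, which is where integrals
are taken.
\<close>

definition g' :: "real \<Rightarrow> real \<Rightarrow> real" where
  "g' = (SOME g'. (\<forall>\<theta>\<in>{0..2 * pi}. \<forall>\<rho>. (g \<theta> has_real_derivative g' \<theta> \<rho>) (at \<rho>)) \<and> C_param 1 (2 * pi) UNIV g')"

lemma g': "\<theta> \<in> {0..2 * pi} \<Longrightarrow> (g \<theta> has_real_derivative g' \<theta> \<rho>) (at \<rho>)" "C_param 1 (2 * pi) UNIV g'"
proof -
  have "C_param (Suc 1) (2 * pi) UNIV g" using C_param_g_time_density(1)[OF C2] by (simp only: numeral_2_eq_2 One_nat_def)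
  then have "\<exists>g'. (\<forall>\<theta>\<in>{0..2 * pi}. \<forall>\<rho>. (g \<theta> has_real_derivative g' \<theta> \<rho>) (at \<rho>)) \<and> C_param 1 (2 * pi) UNIV g'"
    by (rule C_param_SucE) blast
  from someI_ex[OF this] show "\<theta> \<in> {0..2 * pi} \<Longrightarrow> (g \<theta> has_real_derivative g' \<theta> \<rho>) (at \<rho>)"
    "C_param 1 (2 * pi) UNIV g'" unfolding g'_def by auto
qed

definition polar_orbit :: "(real \<Rightarrow> real) \<Rightarrow> real \<Rightarrow> bool" where
  "polar_orbit r x \<longleftrightarrow> r 0 = x \<and> (\<forall>\<theta>. (r has_real_derivative g \<theta> (r \<theta>)) (at \<theta>)) \<and>
     (\<forall>\<theta>. r (\<theta> + 2 * pi) = r \<theta>)"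

text \<open>
The field is clamped in \<open>\<rho>\<close> to an interval, which makes it globally Lipschitz, and the clamped
equation is solved on the whole line. The clamped field has the same reversing symmetries, so its
solutions are even about \<open>0\<close> and \<open>\<pi>/4\<close> and it suffices to estimate them in one octant. There
\<open>- K \<le> g \<le> 1\<close> shows that they never leave the interval, so they solve the original equation.
One interval serves all initial values within distance \<open>1\<close> of \<open>b\<close>.
\<close>

lemma polar_family:
  "\<exists>R lo hi L. (\<forall>x\<in>ball b 1. polar_orbit (\<lambda>\<theta>. R \<theta> x) x) \<and>
    parametrized_flow g g' R (2 * pi) L (ball b 1) {lo..hi}"
proof -
  \<comment> \<open>Initial values lie within \<open>1\<close> of \<open>b\<close>; over an octant, of length \<open>\<pi>/4 < 1\<close>,
    a solution rises by less than \<open>1\<close> and falls by at most \<open>K\<close>.\<close>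
  define hi where "hi = b + 2"
  obtain K where K: "K \<ge> 0" "\<And>\<theta> \<rho>. \<theta> \<in> {0..pi / 4} \<Longrightarrow> \<rho> \<le> hi \<Longrightarrow> - K \<le> g \<theta> \<rho>"
    using g_lower_bound by blast
  define lo where "lo = b - 1 - K"
  define V where "V = {lo..hi}"
  have V: "compact V" "convex V" "V \<noteq> {}" using K(1) by (auto simp: V_def lo_def hi_def)
  note cp = closest_point_in_set[OF compact_imp_closed[OF V(1)] V(3)]
  have contV: "continuous_on ({0..2 * pi} \<times> V) (\<lambda>(s, x). g s x)"
    using g_continuous by (rule continuous_on_subset) simp
  have contV': "continuous_on ({0..2 * pi} \<times> V) (\<lambda>(s, x). g' s x)"
    using C_param_continuous[OF g'(2)] by (rule continuous_on_subset) auto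
  have derivV: "(g s has_field_derivative g' s x) (at x)" if "s \<in> {0..2 * pi}" "x \<in> V" for s x
    using that(1) by (rule g'(1))
  obtain L M where L: "L > 0" and M: "\<forall>s\<in>{0..2 * pi}. \<forall>x. norm (g s (closest_point V x)) \<le> M"
    and bound: "\<forall>s\<in>{0..2 * pi}. \<forall>x\<in>V. norm (g' s x) \<le> L"
    and lip_cp: "\<forall>s\<in>{0..2 * pi}. \<forall>x y. norm (g s (closest_point V x) - g s (closest_point V y)) \<le> L * norm (x - y)"
    using clamped_field_bounds[OF compact_Icc V contV contV' derivV] by blast
  note M = M[rule_format] and bound = bound[rule_format] and lip_cp = lip_cp[rule_format]
  define c where "c \<theta> x = g \<theta> (closest_point V x)" for \<theta> x
  have c_bound: "norm (c \<theta> x) \<le> M" and c_lip: "norm (c \<theta> x - c \<theta> y) \<le> L * norm (x - y)" for \<theta> x y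
  proof -
    obtain \<theta>' where \<theta>': "\<theta>' \<in> {0..2 * pi}" "cos \<theta>' = cos \<theta>" "sin \<theta>' = sin \<theta>"
      using angle_in_period by blast
    have "g \<theta> = g \<theta>'" by (intro ext same_direction(1)) (simp_all add: \<theta>')
    then show "norm (c \<theta> x) \<le> M" "norm (c \<theta> x - c \<theta> y) \<le> L * norm (x - y)"
      using M[OF \<theta>'(1)] lip_cp[OF \<theta>'(1)] by (auto simp: c_def)
  qed
  have "\<exists>R. R 0 = x0 \<and> (\<forall>t. (R has_vector_derivative c t (R t)) (at t))" for x0
  proof (rule global_ode_solution[where M = M, OF _ c_bound c_lip L])
    have "continuous_on UNIV (\<lambda>p. g (fst p) (closest_point V (snd p)))"
    proof (rule continuous_on_compose_pair[of UNIV UNIV g])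
      show "continuous_on UNIV (\<lambda>p :: real \<times> real. closest_point V (snd p))"
        by (rule continuous_on_compose2[OF continuous_on_closest_point[of V UNIV] continuous_on_snd])
          (use V in \<open>auto intro: compact_imp_closed continuous_on_id\<close>)
    qed (use g_continuous in \<open>auto intro: continuous_on_fst continuous_on_id\<close>)
    then show "continuous_on UNIV (\<lambda>(t, x). c t x)" by (simp add: c_def split_def)
  qed
  then obtain R where R0: "R x0 0 = x0" and "(R x0 has_vector_derivative c t (R x0 t)) (at t)" for x0 t
    by metis
  then have R: "(R x0 has_real_derivative c t (R x0 t)) (at t)" for x0 t
    by (simp add: has_real_derivative_iff_has_vector_derivative)
  have reflect0: "R x (- \<theta>) = R x \<theta>" for x \<theta>
    using reversible_solution_symmetric[of "R x" c L 0 \<theta>] R c_lip g_minus by (simp add: c_def)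
  have reflect1: "R x (pi / 2 - \<theta>) = R x \<theta>" for x \<theta>
    using reversible_solution_symmetric[of "R x" c L "pi / 4" \<theta>] R c_lip g_reflect by (simp add: c_def)
  have quarter: "R x (\<theta> + pi / 2) = R x \<theta>" for x \<theta>
    using reflect1[of x "- \<theta>"] reflect0[of x \<theta>] by (simp add: add.commute)
  have quarters_nat: "R x (\<theta> + real n * (pi / 2)) = R x \<theta>" for x \<theta> n
  proof (induction n)
    case (Suc n)
    have "\<theta> + real (Suc n) * (pi / 2) = (\<theta> + real n * (pi / 2)) + pi / 2"
      by (simp add: algebra_simps add_divide_distrib)
    then show ?case using Suc quarter by presburger
  qed simp
  have quarters: "R x (\<theta> + of_int n * (pi / 2)) = R x \<theta>" for x \<theta> n
  proof (cases "n \<ge> 0")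
    case True
    then show ?thesis using quarters_nat[of x \<theta> "nat n"] by simp
  next
    case False
    then show ?thesis
      using quarters_nat[of x "\<theta> + of_int n * (pi / 2)" "nat (- n)"] by simp
  qed
  have in_octant: "R x \<theta> \<in> V" if x: "x \<in> ball b 1" and \<theta>: "\<theta> \<in> {0..pi / 4}" for x \<theta>
  proof (cases "\<theta> = 0")
    case True
    then show ?thesis using x K(1) by (auto simp: R0 V_def lo_def hi_def dist_real_def)
  next
    case False
    then have "0 < \<theta>" using \<theta> by simp
    then obtain w where w: "0 < w" "w < \<theta>" "R x \<theta> - R x 0 = (\<theta> - 0) * c w (R x w)"
      using MVT2[of 0 \<theta> "R x" "\<lambda>w. c w (R x w)"] R by blast
    have w_in: "w \<in> {0..pi / 4}" using w \<theta> by auto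
    have le: "c w (R x w) \<le> 1" unfolding c_def by (rule g_le_1[OF w_in])
    have ge: "- K \<le> c w (R x w)" unfolding c_def using cp[of "R x w"] by (intro K(2) w_in) (simp add: V_def)
    have \<theta>1: "\<theta> \<le> 1" using \<theta> pi_less_4 by simp
    have "\<theta> * c w (R x w) \<le> \<theta> * 1" using le \<open>0 < \<theta>\<close> by (intro mult_left_mono) auto
    moreover have "\<theta> * (- K) \<le> \<theta> * c w (R x w)" using ge \<open>0 < \<theta>\<close> by (intro mult_left_mono) auto
    moreover have "1 * (- K) \<le> \<theta> * (- K)" using \<theta>1 K(1) by (intro mult_right_mono_neg) auto
    ultimately have "x - K \<le> R x \<theta>" "R x \<theta> \<le> x + 1" using w(3) \<theta>1 by (auto simp: R0)
    then show ?thesis using x by (auto simp: V_def lo_def hi_def dist_real_def)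
  qed
  have in_V: "R x \<theta> \<in> V" if x: "x \<in> ball b 1" for x \<theta>
  proof -
    define n where "n = \<lfloor>\<theta> / (pi / 2)\<rfloor>"
    define \<phi> where "\<phi> = \<theta> + of_int (- n) * (pi / 2)"
    have "of_int n \<le> \<theta> / (pi / 2)" "\<theta> / (pi / 2) < of_int n + 1" by (auto simp: n_def)
    then have \<phi>: "0 \<le> \<phi>" "\<phi> \<le> pi / 2"
      using pi_gt_zero by (auto simp: \<phi>_def field_simps)
    have "R x \<phi> \<in> V"
    proof (cases "\<phi> \<le> pi / 4")
      case True then show ?thesis using \<phi> by (intro in_octant x) auto
    next
      case False
      then have "R x (pi / 2 - \<phi>) \<in> V" using \<phi> by (intro in_octant x) auto
      then show ?thesis by (simp add: reflect1)
    qed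
    then show ?thesis unfolding \<phi>_def quarters .
  qed
  have sol: "(R x has_real_derivative g \<theta> (R x \<theta>)) (at \<theta>)" if "x \<in> ball b 1" for x \<theta>
    using R[of x \<theta>] in_V[OF that, of \<theta>] by (simp add: c_def closest_point_self)
  show ?thesis
  proof (rule exI[of _ "\<lambda>\<theta> x. R x \<theta>"], rule exI[of _ lo], rule exI[of _ hi], rule exI[of _ L],
      intro conjI ballI)
    show "polar_orbit (\<lambda>\<theta>. R x \<theta>) x" if "x \<in> ball b 1" for x
      \<comment> \<open>Four quarter turns make a full turn.\<close>
      using R0 sol[OF that] quarters[of x _ 4] by (simp add: polar_orbit_def)
    show "parametrized_flow g g' (\<lambda>\<theta> x. R x \<theta>) (2 * pi) L (ball b 1) {lo..hi}"
      unfolding V_def[symmetric]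
      by unfold_locales
        (use V g' contV' bound sol R0 in_V in
          \<open>auto simp: has_real_derivative_iff_has_vector_derivative[symmetric]\<close>)
  qed
qed

subsection \<open>From polar orbits to periodic solutions\<close>

lemma vfield_lipschitz:
  obtains L where "\<And>p q. p \<in> cball 0 B \<Longrightarrow> q \<in> cball 0 B \<Longrightarrow>
    norm (vfield f p - vfield f q) \<le> L * norm (p - q)"
proof -
  define A where "A v z = frechet_derivative f (at z) v" for v z
  have bdd: "\<exists>M\<ge>0. \<forall>z\<in>cball 0 B. norm (A v z) \<le> M" for v
  proof -
    have "bounded (A v ` cball 0 B)"
      unfolding A_def by (intro compact_imp_bounded compact_continuous_image
          continuous_on_subset[OF partial_continuous]) auto
    then obtain M where "\<forall>z\<in>cball 0 B. norm (A v z) \<le> M" unfolding bounded_iff by auto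
    then show ?thesis by (intro exI[of _ "max M 0"]) auto
  qed
  obtain M1 where M1: "M1 \<ge> 0" "\<And>z. z \<in> cball 0 B \<Longrightarrow> norm (A (1, 0) z) \<le> M1" using bdd by blast
  obtain M2 where M2: "M2 \<ge> 0" "\<And>z. z \<in> cball 0 B \<Longrightarrow> norm (A (0, 1) z) \<le> M2" using bdd by blast
  have onorm: "onorm (\<lambda>v. A v z) \<le> M1 + M2" if z: "z \<in> cball 0 B" for z
  proof (rule onorm_bound)
    interpret A: bounded_linear "\<lambda>v. A v z"
      unfolding A_def using f_has_derivative by (rule has_derivative_bounded_linear)
    fix v :: "real \<times> real"
    have "v = fst v *\<^sub>R (1, 0) + snd v *\<^sub>R (0, 1)" by (simp add: prod_eq_iff)
    then have "A v z = fst v * A (1, 0) z + snd v * A (0, 1) z"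
      using A.add A.scaleR by (metis real_scaleR_def)
    also have "norm \<dots> \<le> norm v * M1 + norm v * M2"
      using M1(2)[OF z] M2(2)[OF z] norm_fst_le[of "fst v" "snd v"] norm_snd_le[of "snd v" "fst v"]
      by (intro norm_triangle_mono) (auto simp: abs_mult intro!: mult_mono)
    finally show "norm (A v z) \<le> (M1 + M2) * norm v" by (simp add: algebra_simps)
  qed (use M1 M2 in auto)
  have f_lip: "norm (f p - f q) \<le> (M1 + M2) * norm (p - q)" if "p \<in> cball 0 B" "q \<in> cball 0 B" for p q
    by (rule differentiable_bound[of "cball 0 B" f "\<lambda>z v. A v z"])
      (use that onorm f_has_derivative in \<open>auto simp: A_def intro: has_derivative_at_withinI\<close>)
  show thesis
  proof (rule that[of "2 * (M1 + M2)"])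
    fix p q :: "real \<times> real" assume pq: "p \<in> cball 0 B" "q \<in> cball 0 B"
    define p' q' where "p' = (snd p, fst p)" and "q' = (snd q, fst q)"
    have swap: "norm (snd z, fst z) = norm z" for z :: "real \<times> real"
      by (simp add: norm_prod_def add.commute)
    have "norm p' = norm p" "norm q' = norm q" "norm (p' - q') = norm (p - q)"
      using swap[of p] swap[of q] swap[of "p - q"] by (auto simp: p'_def q'_def)
    then have "norm (f p' - f q') \<le> (M1 + M2) * norm (p - q)"
      using f_lip[of p' q'] pq by simp
    moreover have "vfield f p - vfield f q = (f p - f q, - (f p' - f q'))"
      by (simp add: vfield_def split_def p'_def q'_def)
    ultimately show "norm (vfield f p - vfield f q) \<le> 2 * (M1 + M2) * norm (p - q)"
      using f_lip[OF pq] norm_Pair_le[of "f p - f q" "- (f p' - f q')"] by (simp add: algebra_simps)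
  qed
qed

lemma solves_ivp_unique:
  assumes u: "solves_ivp f u z" and v: "solves_ivp f v z"
  shows "u = v"
proof
  fix t :: real
  let ?I = "closed_segment 0 t"
  have "continuous_on ?I u" "continuous_on ?I v"
    using u v unfolding solves_ivp_def
    by (auto intro!: continuous_at_imp_continuous_on has_vector_derivative_continuous)
  then have "bounded (u ` ?I \<union> v ` ?I)"
    by (intro compact_imp_bounded compact_Un compact_continuous_image) auto
  then obtain B where B: "\<And>s. s \<in> ?I \<Longrightarrow> u s \<in> cball 0 B" "\<And>s. s \<in> ?I \<Longrightarrow> v s \<in> cball 0 B"
    unfolding bounded_iff by auto
  obtain L where L: "\<And>p q. p \<in> cball 0 B \<Longrightarrow> q \<in> cball 0 B \<Longrightarrow>
      norm (vfield f p - vfield f q) \<le> L * norm (p - q)"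
    using vfield_lipschitz by metis
  show "u t = v t"
  proof (rule ode_unique[of 0 t u "\<lambda>s. vfield f (u s)" v "\<lambda>s. vfield f (v s)" L])
    show "norm (vfield f (u s) - vfield f (v s)) \<le> L * norm (u s - v s)" if "s \<in> ?I" for s
      using B that by (intro L) auto
  qed (use u v in \<open>auto simp: solves_ivp_def\<close>)
qed

definition orbit_point :: "(real \<Rightarrow> real) \<Rightarrow> real \<Rightarrow> real \<times> real" where
  "orbit_point r \<theta> = (X \<theta> (r \<theta>), Y \<theta> (r \<theta>))"

text \<open>
The change of variables: in the parameter \<open>\<theta>\<close> the orbit runs against the vector field, with
speed factor \<open>time_density\<close>. Both components reduce to \<open>x\<^sup>2 + y\<^sup>2 = exp (2 \<rho>)\<close>.
\<close>

lemma orbit_point_derivative: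
  assumes "(r has_real_derivative g \<theta> (r \<theta>)) (at \<theta>)"
  shows "(orbit_point r has_vector_derivative - time_density \<theta> (r \<theta>) *\<^sub>R vfield f (orbit_point r \<theta>)) (at \<theta>)"
proof -
  let ?x = "X \<theta> (r \<theta>)" and ?y = "Y \<theta> (r \<theta>)" and ?g = "g \<theta> (r \<theta>)"
  have "((\<lambda>\<theta>. X \<theta> (r \<theta>)) has_real_derivative ?x * ?g - ?y) (at \<theta>)"
    "((\<lambda>\<theta>. Y \<theta> (r \<theta>)) has_real_derivative ?y * ?g + ?x) (at \<theta>)"
    unfolding X_def Y_def by (auto intro!: derivative_eq_intros assms simp: algebra_simps)
  moreover have rr: "exp (r \<theta>) * exp (r \<theta>) = ?x * ?x + ?y * ?y"
  proof -
    have "?x * ?x + ?y * ?y = exp (r \<theta>) * exp (r \<theta>) * ((cos \<theta>)\<^sup>2 + (sin \<theta>)\<^sup>2)"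
      unfolding X_def Y_def by (simp add: power2_eq_square algebra_simps del: sin_cos_squared_add sin_cos_squared_add2 sin_cos_squared_add3)
    then show ?thesis by simp
  qed
  have D: "angular \<theta> (r \<theta>) \<noteq> 0" using angular_pos[of \<theta> "r \<theta>"] by simp
  have "?x * ?g - ?y = - time_density \<theta> (r \<theta>) * f (?x, ?y)"
  proof -
    have "(?x * ?g - ?y) * angular \<theta> (r \<theta>) = ?x * radial \<theta> (r \<theta>) - ?y * angular \<theta> (r \<theta>)"
      using D by (simp add: g_def algebra_simps)
    also have "\<dots> = - (exp (r \<theta>) * exp (r \<theta>)) * f (?x, ?y)"
      unfolding rr radial_def angular_def by algebra
    also have "\<dots> = (- time_density \<theta> (r \<theta>) * f (?x, ?y)) * angular \<theta> (r \<theta>)"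
      using D by (simp add: time_density_def)
    finally show ?thesis unfolding mult_right_cancel[OF D] .
  qed
  moreover have "?y * ?g + ?x = - time_density \<theta> (r \<theta>) * - f (?y, ?x)"
  proof -
    have "(?y * ?g + ?x) * angular \<theta> (r \<theta>) = ?y * radial \<theta> (r \<theta>) + ?x * angular \<theta> (r \<theta>)"
      using D by (simp add: g_def algebra_simps)
    also have "\<dots> = exp (r \<theta>) * exp (r \<theta>) * f (?y, ?x)"
      unfolding rr radial_def angular_def by algebra
    also have "\<dots> = (- time_density \<theta> (r \<theta>) * - f (?y, ?x)) * angular \<theta> (r \<theta>)"
      using D by (simp add: time_density_def)
    finally show ?thesis unfolding mult_right_cancel[OF D] .
  qed
  ultimately show ?thesis
    unfolding orbit_point_def[abs_def] has_real_derivative_iff_has_vector_derivative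
    by (auto simp: vfield_def dest: has_vector_derivative_Pair)
qed

text \<open>
Reversed time \<open>\<tau>\<close> is a strictly increasing bijection of the angle with
\<open>\<tau> (\<theta> + 2\<pi>) = \<tau> \<theta> + T\<close>; following the orbit at angle \<open>\<tau>\<^bsup>-1\<^esup>\<close> of the time and reversing
time again gives the solution. A return to the starting point \<open>(exp x, 0)\<close> forces the angle to be
a multiple of \<open>2\<pi>\<close>, so no positive time smaller than \<open>T\<close> is a period.
\<close>

lemma polar_orbit_period:
  assumes r: "polar_orbit r x"
  defines "T \<equiv> integral {0..2 * pi} (\<lambda>\<theta>. time_density \<theta> (r \<theta>))"
  shows "\<exists>u. solves_ivp f u (exp x, 0) \<and> \<not> u constant_on UNIV \<and> is_minimal_period u T"
proof -
  define h where "h \<theta> = time_density \<theta> (r \<theta>)" for \<theta>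
  have r0: "r 0 = x" and r': "\<And>\<theta>. (r has_real_derivative g \<theta> (r \<theta>)) (at \<theta>)"
    and r_per: "\<And>\<theta>. r (\<theta> + 2 * pi) = r \<theta>"
    using r by (auto simp: polar_orbit_def)
  have r_cont: "continuous_on UNIV r"
    using r' by (auto intro!: continuous_at_imp_continuous_on DERIV_isCont)
  have h_cont: "continuous_on S h" for S
    unfolding h_def by (rule continuous_on_subset[OF continuous_on_compose_pair[of UNIV UNIV time_density]])
      (use time_density_continuous r_cont in \<open>auto intro: continuous_on_id\<close>)
  have h_per: "h (\<theta> + 2 * pi) = h \<theta>" for \<theta>
    using same_direction(2)[of "\<theta> + 2 * pi" \<theta>] by (simp add: h_def r_per)
  have h_pos: "h \<theta> > 0" for \<theta> by (simp add: h_def time_density_pos)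
  define \<tau> where "\<tau> = primitive h"
  have \<tau>': "(\<tau> has_real_derivative h \<theta>) (at \<theta>)" for \<theta>
    unfolding \<tau>_def has_real_derivative_iff_has_vector_derivative
    by (rule has_vector_derivative_primitive[OF h_cont])
  have \<tau>0: "\<tau> 0 = 0" by (simp add: \<tau>_def)
  have T: "\<tau> (2 * pi) = T"
    by (simp add: \<tau>_def primitive_def T_def h_def[abs_def])
  have \<tau>_mono: "strict_mono \<tau>"
    by (rule strict_monoI) (use \<tau>' h_pos in \<open>blast intro: DERIV_pos_imp_increasing\<close>)
  have T_pos: "T > 0" using strict_monoD[OF \<tau>_mono, of 0 "2 * pi"] T \<tau>0 by simp
  have \<tau>_per: "\<tau> (\<theta> + 2 * pi) = \<tau> \<theta> + T" for \<theta>
  proof -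
    have "((\<lambda>\<theta>. \<tau> (\<theta> + 2 * pi) - \<tau> \<theta>) has_real_derivative 0) (at \<theta>)" for \<theta>
      using DERIV_diff[OF DERIV_shift[THEN iffD1, OF \<tau>'] \<tau>', of "2 * pi" \<theta>] by (simp add: h_per)
    then have "\<tau> (\<theta> + 2 * pi) - \<tau> \<theta> = \<tau> (0 + 2 * pi) - \<tau> 0"
      using DERIV_isconst_all by blast
    then show ?thesis by (simp add: T \<tau>0)
  qed
  have \<tau>_n: "\<tau> (real n * (2 * pi)) = real n * T" "\<tau> (- (real n * (2 * pi))) = - (real n * T)" for n
  proof -
    show "\<tau> (real n * (2 * pi)) = real n * T"
    proof (induction n)
      case (Suc n)
      then show ?case using \<tau>_per[of "real n * (2 * pi)"] by (simp add: algebra_simps)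
    qed (simp add: \<tau>0)
    show "\<tau> (- (real n * (2 * pi))) = - (real n * T)"
    proof (induction n)
      case (Suc n)
      then show ?case using \<tau>_per[of "- (real (Suc n) * (2 * pi))"] by (simp add: algebra_simps)
    qed (simp add: \<tau>0)
  qed
  have \<tau>_cont: "continuous_on S \<tau>" for S
    using \<tau>' by (auto intro!: continuous_at_imp_continuous_on DERIV_isCont)
  have "\<exists>\<theta>. \<tau> \<theta> = t" for t
  proof -
    obtain n :: nat where n: "\<bar>t\<bar> / T < real n" using reals_Archimedean2 by blast
    then have "\<bar>t\<bar> \<le> real n * T" using T_pos by (simp add: field_simps)
    then have "\<exists>\<theta>\<ge>- (real n * (2 * pi)). \<theta> \<le> real n * (2 * pi) \<and> \<tau> \<theta> = t"
      by (intro IVT' \<tau>_cont) (auto simp: \<tau>_n)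
    then show ?thesis by blast
  qed
  then have surj: "surj \<tau>" by (metis surjI)
  define \<Theta> where "\<Theta> = inv \<tau>"
  have \<tau>\<Theta>: "\<tau> (\<Theta> t) = t" for t using surj by (simp add: \<Theta>_def surj_f_inv_f)
  have \<Theta>\<tau>: "\<Theta> (\<tau> \<theta>) = \<theta>" for \<theta>
    using strict_mono_imp_inj_on[OF \<tau>_mono] by (simp add: \<Theta>_def)
  have \<Theta>': "(\<Theta> has_real_derivative inverse (h (\<Theta> t))) (at t)" for t
  proof (rule DERIV_inverse_function[where f = \<tau> and a = "t - 1" and b = "t + 1"])
    have "isCont \<tau> z" for z using \<tau>' DERIV_isCont by blast
    then show "isCont \<Theta> t"
      using isCont_inverse_function[of 1 "\<Theta> t" \<Theta> \<tau>] \<Theta>\<tau> by (simp add: \<tau>\<Theta>)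
  qed (use \<tau>' h_pos[of "\<Theta> t"] \<tau>\<Theta> in auto)
  define w where "w t = orbit_point r (\<Theta> t)" for t
  have w': "(w has_vector_derivative - vfield f (w t)) (at t)" for t
  proof -
    have "((orbit_point r \<circ> \<Theta>) has_vector_derivative
        inverse (h (\<Theta> t)) *\<^sub>R (- time_density (\<Theta> t) (r (\<Theta> t)) *\<^sub>R vfield f (orbit_point r (\<Theta> t)))) (at t)"
      by (rule vector_diff_chain_at[OF \<Theta>'[unfolded has_real_derivative_iff_has_vector_derivative]])
        (rule orbit_point_derivative[OF r'])
    then show ?thesis using h_pos[of "\<Theta> t"] by (simp add: w_def[abs_def] o_def h_def[symmetric])
  qed
  define u where "u t = w (- t)" for t
  have \<Theta>_per: "\<Theta> (t + T) = \<Theta> t + 2 * pi" for t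
    using \<Theta>\<tau>[of "\<Theta> t + 2 * pi"] by (simp add: \<tau>_per \<tau>\<Theta>)
  have point_per: "orbit_point r (\<theta> + 2 * pi) = orbit_point r \<theta>" for \<theta>
    by (simp add: orbit_point_def X_def Y_def r_per)
  have w_per: "w (t + T) = w t" for t by (simp add: w_def \<Theta>_per point_per)
  have w0: "w 0 = (exp x, 0)"
    using \<Theta>\<tau>[of 0] by (simp add: w_def orbit_point_def X_def Y_def \<tau>0 r0)
  have "(u has_vector_derivative vfield f (u t)) (at t)" for t
  proof -
    have "(uminus has_vector_derivative - 1) (at t)"
      unfolding has_real_derivative_iff_has_vector_derivative[symmetric]
      by (auto intro!: derivative_eq_intros)
    from vector_diff_chain_at[OF this w'[of "- t"]]
    show ?thesis by (simp add: u_def[abs_def] o_def)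
  qed
  then have sol: "solves_ivp f u (exp x, 0)" by (simp add: solves_ivp_def u_def w0)
  \<comment> \<open>After half a turn the orbit meets the negative horizontal axis.\<close>
  have "u (- \<tau> pi) = (- exp (r pi), 0)"
    by (simp add: u_def w_def \<Theta>\<tau> orbit_point_def X_def Y_def)
  moreover have "u 0 = (exp x, 0)" by (simp add: u_def w0)
  moreover have "- exp (r pi) < 0" "0 < exp x" by auto
  ultimately have "u (- \<tau> pi) \<noteq> u 0" by (metis order_less_asym prod.inject)
  then have "\<not> u constant_on UNIV" unfolding constant_on_def by (metis UNIV_I)
  moreover have "is_minimal_period u T"
    unfolding is_minimal_period_def is_period_def
  proof (intro conjI allI impI T_pos)
    show "u (t + T) = u t" for t using w_per[of "- (t + T)"] by (simp add: u_def)
    fix S assume S: "0 < S \<and> (\<forall>t. u (t + S) = u t)"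
    then have "u (- S + S) = u (- S)" by blast
    then have "w S = (exp x, 0)" by (simp add: u_def w0)
    then have sin: "sin (\<Theta> S) = 0" and "exp (r (\<Theta> S)) * cos (\<Theta> S) = exp x"
      by (auto simp: w_def orbit_point_def X_def Y_def)
    then have "cos (\<Theta> S) > 0" by (metis exp_gt_zero zero_less_mult_pos)
    then have "cos (\<Theta> S) = 1" using sin_zero_abs_cos_one[OF sin] by simp
    then obtain n :: int where n: "\<Theta> S = of_int n * 2 * pi" using cos_one_2pi_int by blast
    have "\<Theta> S > 0" using strict_mono_less[OF \<tau>_mono, of 0 "\<Theta> S"] S by (simp add: \<tau>\<Theta> \<tau>0)
    then have "of_int n > (0 :: real)" using n by (simp add: zero_less_mult_iff)
    then have "1 \<le> (of_int n :: real)" by simp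
    then have "2 * pi \<le> \<Theta> S" using mult_right_mono[of 1 "of_int n" "2 * pi"] n by simp
    then show "T \<le> S" using strict_mono_less_eq[OF \<tau>_mono, of "2 * pi" "\<Theta> S"] by (simp add: T \<tau>\<Theta>)
  qed
  ultimately show ?thesis using sol by blast
qed

lemma sol_periodic:
  assumes r: "polar_orbit r x"
  shows "\<exists>!u. solves_ivp f u (exp x, 0)" "periodic (sol f (exp x))"
    "is_minimal_period (sol f (exp x)) (period_map f (exp x))"
    "period_map f (exp x) = integral {0..2 * pi} (\<lambda>\<theta>. time_density \<theta> (r \<theta>))"
proof -
  obtain u where u: "solves_ivp f u (exp x, 0)" "\<not> u constant_on UNIV"
    "is_minimal_period u (integral {0..2 * pi} (\<lambda>\<theta>. time_density \<theta> (r \<theta>)))"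
    using polar_orbit_period[OF r] by blast
  show ex1: "\<exists>!u. solves_ivp f u (exp x, 0)" using u(1) solves_ivp_unique by blast
  have sol: "sol f (exp x) = u"
    unfolding sol_def using u(1) solves_ivp_unique by (intro the_equality) auto
  show "periodic (sol f (exp x))"
    using u unfolding sol periodic_def is_minimal_period_def by blast
  show eq: "period_map f (exp x) = integral {0..2 * pi} (\<lambda>\<theta>. time_density \<theta> (r \<theta>))"
    unfolding period_map_def sol using u(3) is_minimal_period_unique by (intro the_equality) auto
  show "is_minimal_period (sol f (exp x)) (period_map f (exp x))" unfolding sol eq by (rule u(3))
qed

subsection \<open>Regularity of the period\<close>

lemma all_sols_periodic:
  assumes "a > 0"
  shows "\<exists>!u. solves_ivp f u (a, 0)" "periodic (sol f a)" "is_minimal_period (sol f a) (period_map f a)"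
proof -
  obtain R where "\<forall>x\<in>ball (ln a) 1. polar_orbit (\<lambda>\<theta>. R \<theta> x) x"
    using polar_family[of "ln a"] by blast
  then have "polar_orbit (\<lambda>\<theta>. R \<theta> (ln a)) (ln a)" by simp
  from sol_periodic[OF this] show "\<exists>!u. solves_ivp f u (a, 0)" "periodic (sol f a)"
    "is_minimal_period (sol f a) (period_map f a)"
    using assms by simp_all
qed

text \<open>
Locally the period is \<open>\<integral>\<close> of \<open>time_density \<theta> (R \<theta> (ln a))\<close> over one turn, a
composition and integral of functions that are \<open>C\<^bsup>k+1\<^esup>\<close> in the parameter.
\<close>

lemma period_map_C_k:
  assumes f: "C_k_on (Suc k) f UNIV"
  shows "C_k_on (Suc k) (period_map f) {0<..}"
proof (rule C_k_on_local)
  fix a :: real assume "a \<in> {0<..}"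
  define b where "b = ln a"
  obtain R lo hi L where R: "\<forall>x\<in>ball b 1. polar_orbit (\<lambda>\<theta>. R \<theta> x) x"
    and flow: "parametrized_flow g g' R (2 * pi) L (ball b 1) {lo..hi}"
    using polar_family by blast
  note R = R[rule_format]
  obtain G' where G': "\<And>\<theta> \<rho>. \<theta> \<in> {0..2 * pi} \<Longrightarrow> \<rho> \<in> UNIV \<Longrightarrow> (g \<theta> has_real_derivative G' \<theta> \<rho>) (at \<rho>)"
    "C_param k (2 * pi) UNIV G'"
    using C_param_g_time_density(1)[OF f] by (rule C_param_SucE) blast
  have "C_param k (2 * pi) UNIV g'"
    by (rule C_param_cong[OF open_UNIV _ G'(2)]) (use G'(1) g'(1) DERIV_unique in blast)
  then have "C_param k (2 * pi) {lo..hi} g'" by (rule C_param_subset[rotated]) simp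
  from C_param_flow[OF flow convex_ball this]
  have CR: "C_param (Suc k) (2 * pi) (ball b 1) R" .
  have "C_param (Suc k) (2 * pi) (ball b 1) (\<lambda>s x. time_density s (R s x))"
    by (rule C_param_compose[OF _ C_param_g_time_density(2)[OF f, where U = UNIV] CR]) simp
  then have int: "C_param (Suc k) (2 * pi) (ball b 1) (\<lambda>s x. integral {0..s} (\<lambda>\<sigma>. time_density \<sigma> (R \<sigma> x)))"
    by (intro C_param_integral) auto
  define U where "U = {exp (b - 1)<..<exp (b + 1)}"
  have U_pos: "x > 0" if "x \<in> U" for x using that by (auto simp: U_def intro: less_trans[OF exp_gt_zero])
  have ln_U: "ln x \<in> ball b 1" if "x \<in> U" for x
  proof -
    have "exp (b - 1) < exp (ln x)" "exp (ln x) < exp (b + 1)"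
      using that U_pos[OF that] by (auto simp: U_def)
    then show ?thesis by (simp add: dist_real_def)
  qed
  have "C_param (Suc k) (2 * pi) U (\<lambda>s x. integral {0..s} (\<lambda>\<sigma>. time_density \<sigma> (R \<sigma> (ln x))))"
    by (rule C_param_compose[OF _ int, where R = "\<lambda>s x. ln x"])
      (use ln_U U_pos in \<open>auto intro!: C_param_ln simp del: C_param.simps\<close>)
  then have "C_k_on (Suc k) (\<lambda>x. integral {0..2 * pi} (\<lambda>\<sigma>. time_density \<sigma> (R \<sigma> (ln x)))) U"
    by (rule C_k_on_of_C_param[rotated -1]) (auto simp: U_def)
  then have "C_k_on (Suc k) (period_map f) U"
  proof (rule C_k_on_cong[rotated -1])
    show "integral {0..2 * pi} (\<lambda>\<sigma>. time_density \<sigma> (R \<sigma> (ln x))) = period_map f x" if "x \<in> U" for x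
      using sol_periodic(4)[OF R[OF ln_U[OF that]]] U_pos[OF that] by simp
  qed (simp add: U_def)
  moreover have "a \<in> U"
  proof -
    have "exp (b - 1) < exp b" "exp b < exp (b + 1)" by simp_all
    moreover have "exp b = a" using \<open>a \<in> {0<..}\<close> by (simp add: b_def)
    ultimately show ?thesis by (simp add: U_def)
  qed
  ultimately show "\<exists>U. open U \<and> a \<in> U \<and> C_k_on (Suc k) (period_map f) U"
    by (intro exI[of _ U]) (auto simp: U_def)
qed

lemma extends_near_g_time_density:
  assumes f: "real_analytic2_on f UNIV" and r: "continuous_on UNIV r"
  shows "extends_near (\<lambda>\<theta> s. g \<theta> (r \<theta> + s)) \<theta>" "extends_near (\<lambda>\<theta> s. time_density \<theta> (r \<theta> + s)) \<theta>"
proof -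
  have e: "extends_near (\<lambda>\<theta> s. exp (r \<theta> + s)) \<theta>"
    by (intro extends_near_exp extends_near_add extends_near_const extends_near_id r)
  have X: "extends_near (\<lambda>\<theta> s. X \<theta> (r \<theta> + s)) \<theta>" and Y: "extends_near (\<lambda>\<theta> s. Y \<theta> (r \<theta> + s)) \<theta>"
    unfolding X_def Y_def by (intro extends_near_mult e extends_near_const continuous_intros)+
  note an = extends_near_analytic2[OF f]
  have D: "extends_near (\<lambda>\<theta> s. inverse (angular \<theta> (r \<theta> + s))) \<theta>"
  proof (rule extends_near_inverse)
    show "extends_near (\<lambda>\<theta> s. angular \<theta> (r \<theta> + s)) \<theta>"
      unfolding angular_def by (intro extends_near_add extends_near_mult X Y an)
    show "angular \<theta> (r \<theta> + 0) \<noteq> 0" using angular_pos[of \<theta> "r \<theta>"] by simp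
  qed
  have "extends_near (\<lambda>\<theta> s. radial \<theta> (r \<theta> + s)) \<theta>"
    unfolding radial_def by (intro extends_near_add extends_near_mult extends_near_uminus X Y an)
  then show "extends_near (\<lambda>\<theta> s. g \<theta> (r \<theta> + s)) \<theta>" unfolding g_def using D by (rule extends_near_mult)
  show "extends_near (\<lambda>\<theta> s. time_density \<theta> (r \<theta> + s)) \<theta>"
    unfolding time_density_def by (intro extends_near_mult e D)
qed

text \<open>
Put \<open>r = R \<theta> b\<close>. The deviation \<open>s\<close> of a solution from \<open>r\<close> satisfies
\<open>s' = g \<theta> (r + s) - g \<theta> r\<close>, an equation with equilibrium \<open>0\<close>, to which \<open>complex_flow\<close>
applies. Measuring from \<open>r\<close> moves the centre of all holomorphic extensions to \<open>0\<close>, whatever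
the angle.
\<close>

lemma period_holomorphic:
  assumes f: "real_analytic2_on f UNIV"
  obtains P \<delta> where "\<delta> > 0" "P holomorphic_on ball (0 :: complex) \<delta>"
    "\<And>x. \<bar>x\<bar> < \<delta> \<Longrightarrow> P (of_real x) = of_real (period_map f (exp (b + x)))"
proof -
  obtain R lo hi L where R: "\<forall>x\<in>ball b 1. polar_orbit (\<lambda>\<theta>. R \<theta> x) x"
    and flow: "parametrized_flow g g' R (2 * pi) L (ball b 1) {lo..hi}"
    using polar_family by blast
  note R = R[rule_format]
  have deriv: "((\<lambda>\<theta>. R \<theta> x) has_real_derivative g \<theta> (R \<theta> x)) (at \<theta>)" and R0: "R 0 x = x"
    if "x \<in> ball b 1" for x \<theta>
    using R[OF that] by (auto simp: polar_orbit_def)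
  define r where "r \<theta> = R \<theta> b" for \<theta>
  have r': "(r has_real_derivative g \<theta> (r \<theta>)) (at \<theta>)" for \<theta>
    using deriv[of b \<theta>] by (simp add: r_def[abs_def])
  have r_cont: "continuous_on UNIV r"
    using r' by (auto intro!: continuous_at_imp_continuous_on DERIV_isCont)
  have g_r: "continuous_on UNIV (\<lambda>\<theta>. - g \<theta> (r \<theta>))"
    by (intro continuous_on_minus continuous_on_compose_pair[of UNIV UNIV g])
      (use g_continuous r_cont in \<open>auto intro: continuous_on_id\<close>)
  define q where "q \<theta> s = g \<theta> (r \<theta> + s) + - g \<theta> (r \<theta>)" for \<theta> s
  have "extends_near q \<theta>" for \<theta>
    unfolding q_def[abs_def] by (intro extends_near_add extends_near_g_time_density f r_cont extends_near_const g_r)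
  then obtain \<epsilon>1 Q where Q1: "complex_extension {0..2 * pi} \<epsilon>1 q Q"
    using complex_extension_glue[of "{0..2 * pi}" q] by auto
  obtain \<epsilon>2 E where E2: "complex_extension {0..2 * pi} \<epsilon>2 (\<lambda>\<theta> s. time_density \<theta> (r \<theta> + s)) E"
    using complex_extension_glue[of "{0..2 * pi}" "\<lambda>\<theta> s. time_density \<theta> (r \<theta> + s)"] extends_near_g_time_density(2)[OF f r_cont]
    by auto
  define \<epsilon> where "\<epsilon> = min \<epsilon>1 \<epsilon>2"
  have \<epsilon>: "\<epsilon> > 0" "\<epsilon> \<le> \<epsilon>1" "\<epsilon> \<le> \<epsilon>2" using Q1 E2 by (auto simp: \<epsilon>_def complex_extension_def)
  have Q: "complex_extension {0..2 * pi} \<epsilon> q Q" using \<epsilon> by (intro complex_extension_mono[OF Q1]) auto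
  have E: "complex_extension {0..2 * pi} \<epsilon> (\<lambda>\<theta> s. time_density \<theta> (r \<theta> + s)) E"
    using \<epsilon> by (intro complex_extension_mono[OF E2]) auto
  obtain S :: "real \<Rightarrow> complex \<Rightarrow> complex" and L' \<delta>1 where \<delta>1: "0 < \<delta>1" "\<delta>1 \<le> \<epsilon>"
    and S: "parametrized_flow Q (\<lambda>\<theta>. deriv (Q \<theta>)) S (2 * pi) L' (ball 0 \<delta>1) (cball 0 (\<epsilon> / 2))"
    and S_real: "\<forall>u. (\<forall>\<theta>\<in>{0..2 * pi}. (u has_real_derivative q \<theta> (u \<theta>)) (at \<theta>) \<and> \<bar>u \<theta>\<bar> \<le> \<epsilon> / 2) \<and>
      \<bar>u 0\<bar> < \<delta>1 \<longrightarrow> (\<forall>\<theta>\<in>{0..2 * pi}. S \<theta> (of_real (u 0)) = of_real (u \<theta>))"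
  proof -
    have "q \<theta> 0 = 0" for \<theta> by (simp add: q_def)
    from complex_flow[OF _ Q this] that show thesis by auto
  qed
  interpret S: parametrized_flow Q "\<lambda>\<theta>. deriv (Q \<theta>)" S "2 * pi" L' "ball 0 \<delta>1" "cball 0 (\<epsilon> / 2)" by fact
  interpret R: parametrized_flow g g' R "2 * pi" L "ball b 1" "{lo..hi}" by fact
  have sub: "cball 0 (\<epsilon> / 2) \<subseteq> ball (0 :: complex) \<epsilon>" using \<epsilon> by auto
  have S_in: "S \<theta> z \<in> ball 0 \<epsilon>" if "\<theta> \<in> {0..2 * pi}" "z \<in> ball 0 \<delta>1" for \<theta> z
    using S.range[OF that] sub by blast
  define P where "P z = integral {0..2 * pi} (\<lambda>\<theta>. E \<theta> (S \<theta> z))" for z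
  have P_holo: "P holomorphic_on ball 0 \<delta>1"
    unfolding P_def[abs_def]
  proof (rule holomorphic_param_integral)
    have "continuous_on ({0..2 * pi} \<times> ball 0 \<epsilon>) (\<lambda>(\<theta>, z). E \<theta> z)"
      using E by (simp add: complex_extension_def)
    then have "continuous_on ({0..2 * pi} \<times> ball 0 \<delta>1) (\<lambda>p. E (fst p) (S (fst p) (snd p)))"
      by (rule continuous_on_compose_pair[where F = E])
        (use S.joint_continuous S_in in
          \<open>auto simp: split_def simp del: mem_ball intro!: continuous_on_fst continuous_on_id\<close>)
    then show "continuous_on ({0..2 * pi} \<times> ball 0 \<delta>1) (\<lambda>(\<theta>, z). E \<theta> (S \<theta> z))" by (simp add: split_def)
    fix \<theta> assume \<theta>: "\<theta> \<in> {0..2 * pi}"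
    have "S \<theta> holomorphic_on ball 0 \<delta>1"
      unfolding holomorphic_on_open[OF open_ball] using S.has_derivative_initial_value[OF _ \<theta>] by blast
    moreover have "E \<theta> holomorphic_on ball 0 \<epsilon>" using E \<theta> by (simp add: complex_extension_def)
    moreover have "S \<theta> ` ball 0 \<delta>1 \<subseteq> ball 0 \<epsilon>" using S_in[OF \<theta>] by blast
    ultimately have "(E \<theta> \<circ> S \<theta>) holomorphic_on ball 0 \<delta>1" by (rule holomorphic_on_compose_gen)
    then show "(\<lambda>z. E \<theta> (S \<theta> z)) holomorphic_on ball 0 \<delta>1" by (simp add: o_def)
  qed simp
  \<comment> \<open>The entry \<open>1\<close> keeps \<open>b + x\<close> among the initial values of \<open>R\<close>; the last one keeps the
    deviation from \<open>r\<close> below \<open>\<epsilon> / 2\<close> during the whole turn.\<close>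
  define \<delta> where "\<delta> = Min {\<delta>1, 1, \<epsilon> / 2 * exp (- L * (2 * pi))}"
  have \<delta>: "\<delta> > 0" "\<delta> \<le> \<delta>1" "\<delta> \<le> 1" "\<delta> \<le> \<epsilon> / 2 * exp (- L * (2 * pi))"
    using \<delta>1 \<epsilon> by (auto simp: \<delta>_def)
  have P_real: "P (of_real x) = of_real (period_map f (exp (b + x)))" if x: "\<bar>x\<bar> < \<delta>" for x
  proof -
    have xb: "b + x \<in> ball b 1" using x \<delta> by (simp add: dist_real_def)
    define u where "u \<theta> = R \<theta> (b + x) - r \<theta>" for \<theta>
    have u': "(u has_real_derivative q \<theta> (u \<theta>)) (at \<theta>)" for \<theta>
      using DERIV_diff[OF deriv[OF xb] r', of \<theta>] by (simp add: u_def[abs_def] q_def)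
    have u_le: "\<bar>u \<theta>\<bar> \<le> \<epsilon> / 2" if "\<theta> \<in> {0..2 * pi}" for \<theta>
    proof -
      have "\<bar>u \<theta>\<bar> \<le> \<bar>x\<bar> * exp (L * (2 * pi))"
        using R.lipschitz[OF _ xb that, of b] by (simp add: u_def r_def)
      also have "\<dots> \<le> \<epsilon> / 2 * exp (- L * (2 * pi)) * exp (L * (2 * pi))"
        using x \<delta> by (intro mult_right_mono) auto
      also have "\<dots> = \<epsilon> / 2" by (simp add: mult.assoc flip: exp_add)
      finally show ?thesis .
    qed
    have "u 0 = x" using R0[OF xb] R0[of b] by (simp add: u_def r_def)
    then have S_x: "S \<theta> (of_real x) = of_real (u \<theta>)" if "\<theta> \<in> {0..2 * pi}" for \<theta>
      using S_real[rule_format, of u \<theta>] u' u_le x \<delta>(2) that by auto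
    have small: "\<bar>u \<theta>\<bar> < \<epsilon>" if "\<theta> \<in> {0..2 * pi}" for \<theta>
      using u_le[OF that] \<epsilon>(1) by linarith
    have "E \<theta> (S \<theta> (of_real x)) = of_real (time_density \<theta> (R \<theta> (b + x)))" if "\<theta> \<in> {0..2 * pi}" for \<theta>
    proof -
      have "E \<theta> (of_real (u \<theta>)) = of_real (time_density \<theta> (r \<theta> + u \<theta>))"
        using E that small[OF that] unfolding complex_extension_def by blast
      then show ?thesis unfolding S_x[OF that] by (simp add: u_def)
    qed
    then have "P (of_real x) = integral {0..2 * pi} (\<lambda>\<theta>. of_real (time_density \<theta> (R \<theta> (b + x))))"
      unfolding P_def by (intro Henstock_Kurzweil_Integration.integral_cong)
    also have "\<dots> = of_real (integral {0..2 * pi} (\<lambda>\<theta>. time_density \<theta> (R \<theta> (b + x))))"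
    proof -
      have "continuous_on {0..2 * pi} (\<lambda>\<theta>. R \<theta> (b + x))" by (rule R.time_continuous[OF xb])
      then have "(\<lambda>\<theta>. time_density \<theta> (R \<theta> (b + x))) integrable_on {0..2 * pi}"
        using time_density_continuous
        by (intro integrable_continuous_real continuous_on_compose_pair[of UNIV UNIV time_density]) (auto intro: continuous_on_id)
      from integral_linear[OF this bounded_linear_of_real] show ?thesis by (simp add: o_def)
    qed
    finally show ?thesis using sol_periodic(4)[OF R[OF xb]] by simp
  qed
  have "P holomorphic_on ball 0 \<delta>" using P_holo \<delta>(2) by (rule holomorphic_on_subset[OF _ subset_ball])
  from that[OF \<delta>(1) this P_real] show thesis .
qed

lemma period_map_analytic:
  assumes f: "real_analytic2_on f UNIV"
  shows "real_analytic_on (period_map f) {0<..}"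
proof (rule real_analytic_onI)
  fix a :: real assume "a \<in> {0<..}"
  then have a: "a > 0" by simp
  obtain P \<delta> where \<delta>: "\<delta> > 0" and P: "P holomorphic_on ball (0 :: complex) \<delta>"
    and P_real: "\<And>x. \<bar>x\<bar> < \<delta> \<Longrightarrow> P (of_real x) = of_real (period_map f (exp (ln a + x)))"
    using period_holomorphic[OF f, of "ln a"] by metis
  define l where "l z = Ln z - of_real (ln a)" for z
  have "isCont l (of_real a)" unfolding l_def using a by (intro continuous_intros) (auto simp: complex_nonpos_Reals_iff)
  then obtain d where d: "d > 0" "\<And>z. dist z (of_real a) < d \<Longrightarrow> dist (l z) (l (of_real a)) < \<delta>"
    using \<delta> unfolding continuous_at_eps_delta by metis
  define r where "r = min d a"
  have r: "r > 0" using d a by (simp add: r_def)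
  have Re_pos: "Re z > 0" if "z \<in> ball (of_real a) r" for z
    using that abs_Re_le_cmod[of "of_real a - z"] abs_ge_self[of "a - Re z"]
    by (simp add: r_def dist_norm)
  have "l (of_real a) = 0" using a by (simp add: l_def Ln_of_real)
  then have l_small: "l z \<in> ball 0 \<delta>" if "z \<in> ball (of_real a) r" for z
    using d(2)[of z] that by (simp add: r_def dist_commute)
  have "z \<notin> \<real>\<^sub>\<le>\<^sub>0" if "z \<in> ball (of_real a) r" for z :: complex
    using Re_pos[OF that] by (auto simp: complex_nonpos_Reals_iff)
  then have "l holomorphic_on ball (of_real a) r"
    unfolding l_def[abs_def] by (intro holomorphic_intros) auto
  then have "(P \<circ> l) holomorphic_on ball (of_real a) r"
    by (rule holomorphic_on_compose_gen[OF _ P]) (use l_small in blast)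
  moreover have "(P \<circ> l) (of_real x) = of_real (period_map f x)" if x: "\<bar>x - a\<bar> < r" for x
  proof -
    have xp: "x > 0" using x by (auto simp: r_def)
    have "complex_of_real x \<in> ball (of_real a) r"
      using x by (simp add: dist_norm norm_minus_commute flip: of_real_diff)
    from l_small[OF this] have "\<bar>ln x - ln a\<bar> < \<delta>" and "l (of_real x) = of_real (ln x - ln a)"
      using xp by (auto simp: l_def Ln_of_real simp flip: of_real_diff)
    then show ?thesis using P_real[of "ln x - ln a"] xp by (simp del: of_real_diff)
  qed
  ultimately show "\<exists>r>0. \<exists>G. G holomorphic_on ball (of_real a) r \<and>
      (\<forall>x. \<bar>x - a\<bar> < r \<longrightarrow> G (of_real x) = of_real (period_map f x))"
    using r by blast
qed

end

section \<open>Time reversal\<close>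

definition reversed :: "(real \<Rightarrow> 'a) \<Rightarrow> real \<Rightarrow> 'a" where
  "reversed u t = u (- t)"

lemma reversed_reversed [simp]: "reversed (reversed u) = u"
  by (simp add: reversed_def[abs_def])

lemma solves_ivp_reversed:
  assumes "solves_ivp f u z"
  shows "solves_ivp (\<lambda>z. - f z) (reversed u) z"
proof -
  have u: "(u has_vector_derivative vfield f (u t)) (at t)" for t
    using assms by (simp add: solves_ivp_def)
  have "(reversed u has_vector_derivative vfield (\<lambda>z. - f z) (reversed u t)) (at t)" for t
  proof -
    have "(uminus has_vector_derivative - 1) (at t)"
      unfolding has_real_derivative_iff_has_vector_derivative[symmetric]
      by (auto intro!: derivative_eq_intros)
    from vector_diff_chain_at[OF this u[of "- t"]]
    show ?thesis by (simp add: reversed_def[abs_def] o_def vfield_def split_def)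
  qed
  then show ?thesis using assms by (simp add: solves_ivp_def reversed_def)
qed

lemma solves_ivp_reversed_iff: "solves_ivp (\<lambda>z. - f z) u z \<longleftrightarrow> solves_ivp f (reversed u) z"
  using solves_ivp_reversed[of f "reversed u" z] solves_ivp_reversed[of "\<lambda>z. - f z" u z] by auto

lemma is_period_reversed: "is_period (reversed u) = is_period u"
proof (intro ext iffI)
  have *: "is_period (reversed u) T" if "is_period u T" for T and u :: "real \<Rightarrow> 'a"
    unfolding is_period_def
  proof (intro conjI allI)
    show "0 < T" using that by (simp add: is_period_def)
    fix t
    have "u ((- t - T) + T) = u (- t - T)" using that unfolding is_period_def by blast
    then show "reversed u (t + T) = reversed u t" by (simp add: reversed_def)
  qed
  show "is_period (reversed u) T" if "is_period u T" for T using *[OF that] .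
  show "is_period u T" if "is_period (reversed u) T" for T using *[OF that] by simp
qed

lemma is_minimal_period_reversed: "is_minimal_period (reversed u) = is_minimal_period u"
  by (simp add: is_minimal_period_def[abs_def] is_period_reversed)

lemma periodic_reversed: "periodic (reversed u) = periodic u"
proof -
  have "reversed u constant_on UNIV \<longleftrightarrow> u constant_on UNIV"
    unfolding constant_on_def reversed_def by (metis UNIV_I minus_minus)
  then show ?thesis by (simp add: periodic_def is_period_reversed)
qed

lemma sol_uminus:
  assumes "\<exists>!u. solves_ivp f u (a, 0)"
  shows "\<exists>!u. solves_ivp (\<lambda>z. - f z) u (a, 0)" "sol (\<lambda>z. - f z) a = reversed (sol f a)"
proof -
  from assms obtain u where u: "solves_ivp f u (a, 0)" "\<And>v. solves_ivp f v (a, 0) \<Longrightarrow> v = u" by blast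
  have u': "solves_ivp (\<lambda>z. - f z) (reversed u) (a, 0)" using u(1) by (rule solves_ivp_reversed)
  have uniq: "v = reversed u" if "solves_ivp (\<lambda>z. - f z) v (a, 0)" for v
    using u(2)[of "reversed v"] that by (metis reversed_reversed solves_ivp_reversed_iff)
  show "\<exists>!u. solves_ivp (\<lambda>z. - f z) u (a, 0)" using u' uniq by blast
  have "sol f a = u" unfolding sol_def using u by (rule the_equality)
  moreover have "sol (\<lambda>z. - f z) a = reversed u" unfolding sol_def using u' uniq by (rule the_equality)
  ultimately show "sol (\<lambda>z. - f z) a = reversed (sol f a)" by simp
qed

theorem lemma1p1:
  fixes f :: "real \<times> real \<Rightarrow> real"
  assumes "f \<in> X_class"
  shows "equilibria f = {(0, 0)} \<and>
    (\<forall>a>0. (\<exists>!u. solves_ivp f u (a, 0)) \<and>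
       periodic (sol f a) \<and> is_minimal_period (sol f a) (period_map f a)) \<and>
    (\<forall>k\<ge>2. C_k_on k f UNIV \<longrightarrow> C_k_on k (period_map f) {0<..}) \<and>
    (real_analytic2_on f UNIV \<longrightarrow> real_analytic_on (period_map f) {0<..})"
proof -
  have smooth: "C_k_on k (period_map f) {0<..}"
    if "rotating_field f" "k \<ge> 2" "C_k_on k f UNIV" for k f
    using rotating_field.period_map_C_k[OF that(1), of "k - 1"] that by simp
  show ?thesis
  proof (cases "f \<in> X_plus")
    case True
    then interpret rotating_field f by unfold_locales
    show ?thesis
      using equilibria all_sols_periodic smooth[OF rotating_field_axioms] period_map_analytic by blast
  next
    case False
    \<comment> \<open>Reversing time exchanges the systems of \<open>h\<close> and \<open>- h\<close> and preserves periods.\<close>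
    then have "f \<in> X_minus" using assms by (simp add: X_class_def)
    then obtain h where h: "h \<in> X_plus" and f: "f = (\<lambda>z. - h z)" by (auto simp: X_minus_def)
    interpret rotating_field h using h by unfold_locales
    have "equilibria f = equilibria h" by (auto simp: equilibria_def vfield_def f)
    moreover have sol: "(\<exists>!u. solves_ivp f u (a, 0)) \<and> sol f a = reversed (sol h a) \<and>
        period_map f a = period_map h a" if "a > 0" for a
      using sol_uminus[OF all_sols_periodic(1)[OF that]]
      by (simp add: f period_map_def is_minimal_period_reversed)
    moreover have "C_k_on k (period_map f) {0<..}" if "k \<ge> 2" "C_k_on k f UNIV" for k
    proof -
      have "C_k_on k h UNIV" using C_k_on_uminus[OF that(2)] by (simp add: f)
      from smooth[OF rotating_field_axioms that(1) this] show ?thesis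
        by (rule C_k_on_cong[rotated -1]) (use sol in auto)
    qed
    moreover have "real_analytic_on (period_map f) {0<..}" if "real_analytic2_on f UNIV"
    proof -
      have "real_analytic2_on h UNIV" using real_analytic2_on_uminus[OF that] by (simp add: f)
      then have "real_analytic_on (period_map h) {0<..}" by (rule period_map_analytic)
      then show ?thesis by (rule real_analytic_on_cong[rotated -1]) (use sol in auto)
    qed
    ultimately show ?thesis
      using equilibria all_sols_periodic
      by (simp add: periodic_reversed is_minimal_period_reversed)
  qed
qed

end
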